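(* Let $0<p\leq q<\infty$, $\omega\in\mathcal{D}$, and let $\mu$ be a positive Borel measure on $\mathbb{D}$. For $r\in(0,1)$ and $z\in\mathbb{D}$, write $$G_{\mu,r}(z):=\frac{\mu(\Delta(z,r))^{\frac1q}}{\widehat{\omega}(z)^{\frac1p}(1-|z|)^{\frac1q}}.$$ Then the following conditions are equivalent: (a) $I_d:AT^{\infty}_p(\omega)\to T^{\infty}_q(\mu)$ is compact; (b) $I_d:AT^0_p(\omega)\to T^0_q(\mu)$ is compact; (c) for some (or any) $r\in(0,1/4)$, $G_{\mu,r}\in\mathrm{C}_0(\mathbb{D})$.
   Context: $\mathbb{D}$ is the open unit disk of $\mathbb{C}$, $\mathbb{T}=\partial\mathbb{D}$ is the unit circle, $dA$ is Lebesgue area measure on $\mathbb{D}$, and $\mathcal{H}(\mathbb{D})$ is the space of analytic functions on $\mathbb{D}$. $\mathrm{C}_0(\mathbb{D})$ is the space of continuous functions $f$ on $\mathbb{D}$ with $f(z)\to0$ as $|z|\to1^-$. Weights: a weight is a function $\omega:\mathbb{D}\to[0,\infty)$ that is integrable over $\mathbb{D}$; it is radial if $\omega(z)=\omega(|z|)$ for all $z\in\mathbb{D}$. For a radial weight put $\widehat{\omega}(z)=\int_{|z|}^1\omega(s)\,ds$. A radial weight $\omega$ belongs to $\widehat{\mathcal{D}}$ if there is $C\ge1$ with $\widehat{\omega}(r)\le C\widehat{\omega}\left(\frac{1+r}{2}\right)$ for all $0\le r<1$; it belongs to $\check{\mathcal{D}}$ if there are $K>1$ and $C>1$ with $\widehat{\omega}(r)\ge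 C\widehat{\omega}\left(1-\frac{1-r}{K}\right)$ for all $0\le r<1$. $\mathcal{D}:=\widehat{\mathcal{D}}\cap\check{\mathcal{D}}$. Tent spaces: for $\xi\in\mathbb{T}$ let $\Gamma(\xi):=\{z\in\mathbb{D}:|1-\bar{\xi}z|<1-|z|^2\}$. The Carleson squares are $S(0):=\mathbb{D}$ and $S(re^{i\theta}):=\{\rho e^{it}:r\le\rho<1,\ |t-\theta|\le\frac{1-r}{2}\}$ for $re^{i\theta}\in\mathbb{D}\setminus\{0\}$. For $0<q<\infty$ and a positive Borel measure $\mu$ on $\mathbb{D}$, $T^{\infty}_q(\mu)$ consists of the $\mu$-measurable functions $f$ on $\mathbb{D}$ with $$\|f\|_{T^{\infty}_q(\mu)}:=\operatorname*{ess\,sup}_{\xi\in\mathbb{T}}\left(\sup_{a\in\Gamma(\xi)}\frac{1}{1-|a|}\int_{S(a)}|f(z)|^q\,d\mu(z)\right)^{\frac1q}<\infty,$$ and $T^0_q(\mu)$ is the subspace of $T^{\infty}_q(\mu)$ consisting of those $f$ with $\lim_{|a|\to1^-}\frac{1}{1-|a|}\int_{S(a)}|f(z)|^q\,d\mu(z)=0$. When $d\mu=\omega\,dA$ for a radial weight $\omega$, these are written $T^{\infty}_q(\omega)$ and $T^0_q(\omega)$. Set $AT^{\infty}_q(\omega):=T^{\infty}_q(\omega)\cap\mathcal{H}(\mathbb{D})$ and $AT^0_q(\omega):=T^0_q(\omega)\cap\mathcal{H}(\mathbb{D})$, with the inherited (quasi-)norm. Other notation: the pseudo-hyperbolic metric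 is $d(z,u):=\left|\frac{z-u}{1-z\overline{u}}\right|$, and $\Delta(z,r):=\{u\in\mathbb{D}:d(z,u)<r\}$ for $z\in\mathbb{D}$, $r\in(0,1)$. $I_d$ is the identity (embedding) operator $f\mapsto f$; "$I_d:X\to Y$ is compact" means that $X\subset Y$ and $I_d$ maps bounded subsets of $X$ to relatively compact subsets of $Y$.
   Formalization: Membership of G in C_0(D) is read as: G is finite on D and tends to 0 at the circle; with continuity the claim fails for μ a point mass at 1/2. Also assumed: ω̂>0 on D, so that G is defined, and μ({0})<∞, since the tent norm ignores even an infinite mass at 0. *)

theory Defs
  imports "HOL-Complex_Analysis.Complex_Analysis" "HOL-Probability.Essential_Supremum"
begin

abbreviation disk :: "complex set" where
  "disk \<equiv> ball 0 1"

definition to_circle :: "complex filter" where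
  "to_circle = filtercomap norm (at_left 1)"

text \<open>Powers of extended nonnegative reals; used for exponents \<open>a > 0\<close> only.\<close>

definition epow :: "ennreal \<Rightarrow> real \<Rightarrow> ennreal" where
  "epow x a = (if x = \<infinity> then \<infinity> else ennreal (enn2real x powr a))"


subsection \<open>Radial weights\<close>

definition radial_weight :: "(complex \<Rightarrow> real) \<Rightarrow> bool" where
  "radial_weight \<omega> \<longleftrightarrow>
     (\<forall>z\<in>disk. 0 \<le> \<omega> z) \<and> set_integrable lebesgue disk \<omega> \<and>
     (\<forall>z\<in>disk. \<omega> z = \<omega> (of_real (norm z)))"

text \<open>The tail integral is extended-valued: integrability over the disk does not exclude that it is
  infinite at the origin (take \<open>\<omega> z = 1 / norm z\<close>).\<close>

definition weight_hat :: "(complex \<Rightarrow> real) \<Rightarrow> complex \<Rightarrow> ennreal" where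
  "weight_hat \<omega> z = (\<integral>\<^sup>+s\<in>{norm z..<1}. ennreal (\<omega> (of_real s)) \<partial>lebesgue)"

definition D_hat :: "(complex \<Rightarrow> real) set" where
  "D_hat = {\<omega>. radial_weight \<omega> \<and>
     (\<exists>C\<ge>1. \<forall>r. 0 \<le> r \<and> r < 1 \<longrightarrow>
        weight_hat \<omega> (of_real r) \<le> ennreal C * weight_hat \<omega> (of_real ((1 + r) / 2)))}"

definition D_check :: "(complex \<Rightarrow> real) set" where
  "D_check = {\<omega>. radial_weight \<omega> \<and>
     (\<exists>K>1. \<exists>C>1. \<forall>r. 0 \<le> r \<and> r < 1 \<longrightarrow>
        weight_hat \<omega> (of_real r) \<ge> ennreal C * weight_hat \<omega> (of_real (1 - (1 - r) / K)))}"

definition D_class :: "(complex \<Rightarrow> real) set" where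
  "D_class = D_hat \<inter> D_check"

definition weight_measure :: "(complex \<Rightarrow> real) \<Rightarrow> complex measure" where
  "weight_measure \<omega> = density (restrict_space lebesgue disk) (\<lambda>z. ennreal (\<omega> z))"


subsection \<open>Tent spaces\<close>

definition arc_length :: "complex measure" where
  "arc_length = distr (restrict_space lborel {0..<2 * pi}) (restrict_space borel (sphere 0 1)) cis"

definition cone :: "complex \<Rightarrow> complex set" where
  "cone \<xi> = {z \<in> disk. norm (1 - cnj \<xi> * z) < 1 - (norm z)\<^sup>2}"

definition carleson_square :: "complex \<Rightarrow> complex set" where
  "carleson_square a =
     (if a = 0 then disk
      else {of_real \<rho> * cis t | \<rho> t. norm a \<le> \<rho> \<and> \<rho> < 1 \<and> \<bar>t - Arg a\<bar> \<le> (1 - norm a) / 2})"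

definition carleson_mean :: "complex measure \<Rightarrow> real \<Rightarrow> (complex \<Rightarrow> complex) \<Rightarrow> complex \<Rightarrow> ennreal" where
  "carleson_mean \<mu> q f a =
     (\<integral>\<^sup>+z\<in>carleson_square a. ennreal (norm (f z) powr q) \<partial>\<mu>) / ennreal (1 - norm a)"

definition tent_norm :: "complex measure \<Rightarrow> real \<Rightarrow> (complex \<Rightarrow> complex) \<Rightarrow> ennreal" where
  "tent_norm \<mu> q f = esssup arc_length (\<lambda>\<xi>. epow (SUP a\<in>cone \<xi>. carleson_mean \<mu> q f a) (1 / q))"

text \<open>The origin lies in no cone, and in no Carleson square with nonzero apex; hence the quasi-norm
  does not see a point mass of \<open>\<mu>\<close> at the origin, not even an infinite one.\<close>

text \<open>Elements are total functions; their values outside the disk affect neither membership nor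
  the quasi-norm, since \<open>\<mu>\<close> is a measure on the disk. Functions at quasi-norm distance zero are not
  identified. Measurability with respect to \<open>\<mu>\<close> means measurability for its completion.\<close>

definition tent_infty :: "complex measure \<Rightarrow> real \<Rightarrow> (complex \<Rightarrow> complex) set" where
  "tent_infty \<mu> q = {f \<in> borel_measurable (completion \<mu>). tent_norm \<mu> q f < \<infinity>}"

definition tent_zero :: "complex measure \<Rightarrow> real \<Rightarrow> (complex \<Rightarrow> complex) set" where
  "tent_zero \<mu> q = {f \<in> tent_infty \<mu> q. (carleson_mean \<mu> q f \<longlongrightarrow> 0) to_circle}"

definition AT_infty :: "(complex \<Rightarrow> real) \<Rightarrow> real \<Rightarrow> (complex \<Rightarrow> complex) set" where
  "AT_infty \<omega> q = tent_infty (weight_measure \<omega>) q \<inter> {f. f holomorphic_on disk}"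

definition AT_zero :: "(complex \<Rightarrow> real) \<Rightarrow> real \<Rightarrow> (complex \<Rightarrow> complex) set" where
  "AT_zero \<omega> q = tent_zero (weight_measure \<omega>) q \<inter> {f. f holomorphic_on disk}"


subsection \<open>Compactness of embeddings of quasi-normed function spaces\<close>

definition qnorm_topology ::
    "(complex \<Rightarrow> complex) set \<Rightarrow> ((complex \<Rightarrow> complex) \<Rightarrow> ennreal) \<Rightarrow> (complex \<Rightarrow> complex) topology" where
  "qnorm_topology Y N =
     topology (\<lambda>U. U \<subseteq> Y \<and> (\<forall>f\<in>U. \<exists>e>0. {g \<in> Y. N (\<lambda>z. g z - f z) < e} \<subseteq> U))"

lemma openin_qnorm_topology:
  "openin (qnorm_topology Y N) U \<longleftrightarrow>
     U \<subseteq> Y \<and> (\<forall>f\<in>U. \<exists>e>0. {g \<in> Y. N (\<lambda>z. g z - f z) < e} \<subseteq> U)"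
proof -
  let ?P = "\<lambda>U. U \<subseteq> Y \<and> (\<forall>f\<in>U. \<exists>e>0. {g \<in> Y. N (\<lambda>z. g z - f z) < e} \<subseteq> U)"
  have "?P (S \<inter> T)" if S: "?P S" and T: "?P T" for S T
  proof (intro conjI ballI)
    fix f assume "f \<in> S \<inter> T"
    then obtain d e where "d > 0" "e > 0" "{g \<in> Y. N (\<lambda>z. g z - f z) < d} \<subseteq> S"
      "{g \<in> Y. N (\<lambda>z. g z - f z) < e} \<subseteq> T"
      using S T by (meson IntD1 IntD2)
    then show "\<exists>e>0. {g \<in> Y. N (\<lambda>z. g z - f z) < e} \<subseteq> S \<inter> T"
      by (intro exI[of _ "min d e"]) auto
  qed (use S in auto)
  moreover have "?P (\<Union>\<K>)" if "\<forall>K\<in>\<K>. ?P K" for \<K>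
    using that by (meson Sup_least Union_upper UnionE subset_trans)
  ultimately have "istopology ?P"
    unfolding istopology_def by blast
  then show ?thesis
    by (simp add: qnorm_topology_def topology_inverse')
qed

lemma topspace_qnorm_topology: "topspace (qnorm_topology Y N) = Y"
proof (rule antisym)
  show "topspace (qnorm_topology Y N) \<subseteq> Y"
    by (metis openin_qnorm_topology openin_topspace)
  have "openin (qnorm_topology Y N) Y"
    unfolding openin_qnorm_topology using zero_less_one by blast
  then show "Y \<subseteq> topspace (qnorm_topology Y N)"
    by (rule openin_subset)
qed

definition compact_embedding ::
    "(complex \<Rightarrow> complex) set \<Rightarrow> ((complex \<Rightarrow> complex) \<Rightarrow> ennreal) \<Rightarrow>
     (complex \<Rightarrow> complex) set \<Rightarrow> ((complex \<Rightarrow> complex) \<Rightarrow> ennreal) \<Rightarrow> bool" where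
  "compact_embedding X NX Y NY \<longleftrightarrow>
     X \<subseteq> Y \<and>
     (\<forall>S\<subseteq>X. (\<exists>M<\<infinity>. \<forall>f\<in>S. NX f \<le> M) \<longrightarrow>
        compactin (qnorm_topology Y NY) (qnorm_topology Y NY closure_of S))"


subsection \<open>The growth condition\<close>

definition pseudo_hyp_disk :: "complex \<Rightarrow> real \<Rightarrow> complex set" where
  "pseudo_hyp_disk z r = {u \<in> disk. norm ((z - u) / (1 - z * cnj u)) < r}"

definition G_fun ::
    "(complex \<Rightarrow> real) \<Rightarrow> complex measure \<Rightarrow> real \<Rightarrow> real \<Rightarrow> real \<Rightarrow> complex \<Rightarrow> ennreal" where
  "G_fun \<omega> \<mu> p q r z =
     epow (emeasure \<mu> (pseudo_hyp_disk z r)) (1 / q) /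
     (epow (weight_hat \<omega> z) (1 / p) * ennreal ((1 - norm z) powr (1 / q)))"

text \<open>Membership of \<open>G_fun\<close> in \<open>C\<^sub>0\<close> of the disk is read as: finite-valued and tending to zero at the
  unit circle. Continuity in the interior cannot be meant, because \<open>z \<mapsto> \<mu>(\<Delta>(z,r))\<close> is in general
  only lower semicontinuous: if \<open>\<mu>\<close> is a point mass, it is a multiple of the indicator function of a
  disk, whereas the embeddings are then of rank at most one, hence compact.\<close>

definition vanishes_at_circle :: "(complex \<Rightarrow> ennreal) \<Rightarrow> bool" where
  "vanishes_at_circle g \<longleftrightarrow> (\<forall>z\<in>disk. g z < \<infinity>) \<and> (g \<longlongrightarrow> 0) to_circle"

end

theory Submission
  imports Defs
begin

text \<open>
  Write \<open>h = 1 - norm z\<close> and let \<open>H h\<close> be the tail mass of the weight at \<open>z\<close>. For \<open>\<rho>\<close> between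
  \<open>1 - h / 2\<close> and \<open>1 - h / (2 * K)\<close> the modulus power \<open>norm (f z) powr p\<close> is dominated by the Poisson
  integral of \<open>norm f powr p\<close> over the circle of radius \<open>\<rho>\<close>. Integrating in \<open>\<rho>\<close> against the weight,
  which by reverse doubling gives this annulus a fixed proportion of \<open>H h\<close>, bounds
  \<open>norm (f z) powr p * H h\<close> by the integral of \<open>h / norm (1 - cnj z * w)\<^sup>2\<close> against
  \<open>norm (f w) powr p\<close> times the weight over the annulus. Since this measure is Carleson with constant
  the \<open>p\<close>-th power of the tent norm, \<open>norm (f z) powr p * H h\<close> is bounded by the same constant.

  If the growth condition holds with a small constant near the circle, write
  \<open>norm f powr q = norm f powr p * norm f powr (q - p)\<close>, use the pointwise bound for the second factor
  and the integral bound for the first, and exchange the integrals: the inner \<open>\<mu>\<close>-integral lives on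
  an annulus of comparable height, where the condition makes \<open>\<mu>\<close> comparable to arc length. Hence
  \<open>f\<close> has small \<open>\<mu>\<close>-tent norm near the circle, and compactness follows by normal families.
  Conversely, the functions \<open>H (1 - norm a) powr (- 1 / p) * ((1 - norm a) / (1 - cnj a * z)) ^ n\<close> are
  bounded, lie in the small space, tend to zero pointwise and are large on \<open>\<Delta>(a,r)\<close>.
\<close>


section \<open>Polar coordinates\<close>

text \<open>Membership in \<open>D_class\<close> controls tail masses only: the weight may vanish on
  whole annuli, so area averages over hyperbolic disks cannot be compared with weighted ones.
  Averages over circles, integrated in the radius against the weight, need nothing but a tail
  estimate. The price is a Poisson inequality for \<open>norm f powr p\<close> with arbitrary
  \<open>p > 0\<close>, which comes from an exact Cauchy formula for a holomorphic power of a
  zero-free majorant. The resulting kernel is symmetric in its two points up to the factor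
  \<open>2 * K\<close> between their heights; this makes the exchange of integrals useful, because
  afterwards everything is expressed at the inner point. One dyadic lemma then serves
  \<open>\<mu>\<close>, the weighted measure and the test functions. Two subtleties remain on the
  topological side: functions at distance zero are not identified, so limits are determined only up
  to the gauge, and quasi-norm balls need not be open. Compactness is therefore handled through
  sequences. The numerical constants are simply what the crude estimates produce.\<close>

text \<open>The substitution \<open>s = tan t\<close> as an identity of measures, so that it applies
  to arbitrary nonnegative integrands; on intervals it is the fundamental theorem of
  calculus.\<close>

lemma distr_tan_lborel:
  "distr (density lborel (\<lambda>t. ennreal (1 / (cos t)\<^sup>2) * indicator {-pi/2<..<pi/2} t)) borel tan = (lborel :: real measure)"
  (is "?M = _")
proof (rule lborel_eqI[symmetric])
  have tan_meas[measurable]: "tan \<in> borel_measurable (borel :: real measure)"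
    unfolding tan_def by measurable
  fix l u :: real
  assume "\<And>b. b \<in> Basis \<Longrightarrow> l \<bullet> b \<le> u \<bullet> b"
  then have lu: "l \<le> u" by auto
  let ?a = "arctan l" and ?b = "arctan u"
  have ab: "-pi/2 < ?a" "?a \<le> ?b" "?b < pi/2"
    using lu arctan_lbound[of l] arctan_ubound[of u] arctan_monotone'[of l u] by auto
  have vim: "t \<in> {-pi/2<..<pi/2} \<and> tan t \<in> box l u \<longleftrightarrow> t \<in> {?a<..<?b}" for t
  proof -
    have "tan t \<in> box l u \<longleftrightarrow> ?a < t \<and> t < ?b" if "-pi/2 < t" "t < pi/2"
      using that arctan_less_iff[of l "tan t"] arctan_less_iff[of "tan t" u] arctan_tan[of t] by auto
    then show ?thesis using ab by auto
  qed
  have [measurable]: "tan -` {l<..<u} \<in> sets borel"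
    using measurable_sets_borel[OF tan_meas, of "{l<..<u}"] by simp
  have "emeasure ?M (box l u) = (\<integral>\<^sup>+t. ennreal (1 / (cos t)\<^sup>2) * indicator {-pi/2<..<pi/2} t * indicator (tan -` box l u) t \<partial>lborel)"
    by (subst emeasure_distr, simp, simp, subst emeasure_density) auto
  also have "\<dots> = (\<integral>\<^sup>+t. ennreal (1 / (cos t)\<^sup>2) * indicator {?a..?b} t \<partial>lborel)"
  proof (rule nn_integral_cong_AE, use AE_lborel_singleton[of ?a] AE_lborel_singleton[of ?b] in eventually_elim)
    fix t assume "t \<noteq> ?a" "t \<noteq> ?b"
    then show "ennreal (1 / (cos t)\<^sup>2) * indicator {-pi/2<..<pi/2} t * indicator (tan -` box l u) t
      = ennreal (1 / (cos t)\<^sup>2) * indicator {?a..?b} t"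
      using vim[of t] by (auto simp: indicator_def)
  qed
  also have "\<dots> = ennreal (tan ?b - tan ?a)"
  proof (rule nn_integral_FTC_Icc)
    fix x assume "x \<in> {?a..?b}"
    then have "cos x \<noteq> 0"
      using ab cos_gt_zero_pi[of x] by auto
    then show "(tan has_real_derivative 1 / (cos x)\<^sup>2) (at x)"
      by (auto intro!: derivative_eq_intros simp: field_simps)
  qed (use ab in auto)
  finally show "emeasure ?M (box l u) = (\<Prod>b\<in>Basis. (u - l) \<bullet> b)"
    by (simp add: tan_arctan)
qed simp

lemma lborel_complex_eq: "(lborel :: complex measure) = distr (lborel \<Otimes>\<^sub>M lborel) borel (\<lambda>p. Complex (fst p) (snd p))"
proof (rule lborel_eqI)
  have Cm[measurable]: "(\<lambda>p. Complex (fst p) (snd p)) \<in> borel_measurable (lborel \<Otimes>\<^sub>M lborel)"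
    unfolding Complex_eq by measurable
  fix l u :: complex
  assume le: "\<And>b. b \<in> Basis \<Longrightarrow> l \<bullet> b \<le> u \<bullet> b"
  then have le': "Re l \<le> Re u" "Im l \<le> Im u"
    by (force simp: Basis_complex_def inner_complex_def)+
  have vim: "(\<lambda>p. Complex (fst p) (snd p)) -` box l u = {Re l<..<Re u} \<times> {Im l<..<Im u}"
    by (auto simp: in_box_complex_iff)
  have "emeasure (distr (lborel \<Otimes>\<^sub>M lborel) borel (\<lambda>p. Complex (fst p) (snd p))) (box l u)
      = emeasure (lborel \<Otimes>\<^sub>M lborel) ({Re l<..<Re u} \<times> {Im l<..<Im u})"
    using emeasure_distr[OF Cm, of "box l u"] unfolding vim by (simp add: space_pair_measure)
  also have "\<dots> = ennreal ((Re u - Re l) * (Im u - Im l))"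
    using le' by (simp add: lborel.emeasure_pair_measure_Times ennreal_mult)
  also have "(Re u - Re l) * (Im u - Im l) = (\<Prod>b\<in>Basis. (u - l) \<bullet> b)"
    by (simp add: Basis_complex_def inner_complex_def)
  finally show "emeasure (distr (lborel \<Otimes>\<^sub>M lborel) borel (\<lambda>p. Complex (fst p) (snd p))) (box l u)
    = (\<Prod>b\<in>Basis. (u - l) \<bullet> b)" .
qed simp

lemma nn_integral_lborel_complex:
  fixes F :: "complex \<Rightarrow> ennreal"
  assumes [measurable]: "F \<in> borel_measurable borel"
  shows "(\<integral>\<^sup>+z. F z \<partial>lborel) = (\<integral>\<^sup>+x. \<integral>\<^sup>+y. F (Complex x y) \<partial>lborel \<partial>lborel)"
proof -
  have Cm[measurable]: "(\<lambda>p. Complex (fst p) (snd p)) \<in> borel_measurable (lborel \<Otimes>\<^sub>M lborel)"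
    unfolding Complex_eq by measurable
  show ?thesis
    by (subst lborel_complex_eq)
      (simp add: nn_integral_distr case_prod_beta lborel.nn_integral_fst[symmetric])
qed

lemma borel_measurable_Complex[measurable (raw)]:
  assumes "f \<in> borel_measurable M" "g \<in> borel_measurable M"
  shows "(\<lambda>x. Complex (f x) (g x)) \<in> borel_measurable M"
  unfolding Complex_eq using assms by measurable

lemma borel_measurable_cis[measurable]: "cis \<in> borel_measurable borel"
  by (intro borel_measurable_continuous_onI continuous_intros)

text \<open>Fubini with the one-dimensional substitutions \<open>y = x * s\<close>, \<open>s = tan t\<close>, \<open>x = \<rho> * cos t\<close>.\<close>

lemma nn_integral_polar_half:
  fixes F :: "complex \<Rightarrow> ennreal"
  assumes [measurable]: "F \<in> borel_measurable borel"
  shows "(\<integral>\<^sup>+z. F z * indicator {z. 0 < Re z} z \<partial>lborel)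
    = (\<integral>\<^sup>+t\<in>{-pi/2<..<pi/2}. (\<integral>\<^sup>+\<rho>\<in>{0<..}. ennreal \<rho> * F (of_real \<rho> * cis t) \<partial>lborel) \<partial>lborel)"
proof -
  have tan_meas[measurable]: "tan \<in> borel_measurable (borel :: real measure)"
    unfolding tan_def by measurable
  have "(\<integral>\<^sup>+z. F z * indicator {z. 0 < Re z} z \<partial>lborel)
      = (\<integral>\<^sup>+x. (\<integral>\<^sup>+y. F (Complex x y) \<partial>lborel) * indicator {0<..} x \<partial>lborel)"
    by (subst nn_integral_lborel_complex) (auto simp: nn_integral_multc[symmetric] intro!: nn_integral_cong split: split_indicator)
  also have "\<dots> = (\<integral>\<^sup>+x. (\<integral>\<^sup>+s. ennreal x * F (Complex x (x * s)) * indicator {0<..} x \<partial>lborel) \<partial>lborel)"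
  proof (rule nn_integral_cong)
    fix x :: real
    show "(\<integral>\<^sup>+y. F (Complex x y) \<partial>lborel) * indicator {0<..} x
       = (\<integral>\<^sup>+s. ennreal x * F (Complex x (x * s)) * indicator {0<..} x \<partial>lborel)"
      by (cases "x > 0") (auto simp: nn_integral_real_affine[where c = x and t = 0 and f = "\<lambda>y. F (Complex x y)"] nn_integral_cmult)
  qed
  also have "\<dots> = (\<integral>\<^sup>+x. (\<integral>\<^sup>+t. ennreal (1 / (cos t)\<^sup>2) * indicator {-pi/2<..<pi/2} t * (ennreal x * F (Complex x (x * tan t)) * indicator {0<..} x) \<partial>lborel) \<partial>lborel)"
    by (subst distr_tan_lborel[symmetric], subst nn_integral_distr, simp, simp, subst nn_integral_density) auto
  also have "\<dots> = (\<integral>\<^sup>+t. (\<integral>\<^sup>+x. ennreal (1 / (cos t)\<^sup>2) * indicator {-pi/2<..<pi/2} t * (ennreal x * F (Complex x (x * tan t)) * indicator {0<..} x) \<partial>lborel) \<partial>lborel)"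
    by (rule lborel_pair.Fubini') measurable
  also have "\<dots> = (\<integral>\<^sup>+t\<in>{-pi/2<..<pi/2}. (\<integral>\<^sup>+\<rho>\<in>{0<..}. ennreal \<rho> * F (of_real \<rho> * cis t) \<partial>lborel) \<partial>lborel)"
  proof (rule nn_integral_cong)
    fix t :: real
    show "(\<integral>\<^sup>+x. ennreal (1 / (cos t)\<^sup>2) * indicator {-pi/2<..<pi/2} t * (ennreal x * F (Complex x (x * tan t)) * indicator {0<..} x) \<partial>lborel)
       = (\<integral>\<^sup>+\<rho>\<in>{0<..}. ennreal \<rho> * F (of_real \<rho> * cis t) \<partial>lborel) * indicator {-pi/2<..<pi/2} t"
    proof (cases "t \<in> {-pi/2<..<pi/2}")
      case True
      then have c: "cos t > 0" using cos_gt_zero_pi[of t] by auto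
      \<comment> \<open>The Jacobian \<open>cos t\<close> of \<open>x = \<rho> * cos t\<close>, the
        factor \<open>x\<close> and \<open>1 / (cos t)\<^sup>2\<close> combine to
        \<open>\<rho>\<close>.\<close>
      have "(\<integral>\<^sup>+x. ennreal (1 / (cos t)\<^sup>2) * (ennreal x * F (Complex x (x * tan t)) * indicator {0<..} x) \<partial>lborel)
        = ennreal (cos t) * (\<integral>\<^sup>+\<rho>. ennreal (1 / (cos t)\<^sup>2) * (ennreal (cos t * \<rho>) * F (Complex (cos t * \<rho>) (cos t * \<rho> * tan t)) * indicator {0<..} (cos t * \<rho>)) \<partial>lborel)"
        using c by (subst nn_integral_real_affine[where c = "cos t" and t = 0]) auto
      also have "\<dots> = (\<integral>\<^sup>+\<rho>\<in>{0<..}. ennreal \<rho> * F (of_real \<rho> * cis t) \<partial>lborel)"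
        using c
        apply (subst nn_integral_cmult[symmetric])
         apply measurable
        apply (intro nn_integral_cong)
        apply (auto split: split_indicator simp: zero_less_mult_iff mult.assoc[symmetric] ennreal_mult'[symmetric])
        apply (simp add: tan_def power2_eq_square cis.code complex_eq_iff ennreal_mult[symmetric] field_simps Complex_eq)
        done
      finally show ?thesis using True by simp
    qed auto
  qed
  finally show ?thesis .
qed


lemma cis_add_2pi: "cis (t + 2 * pi) = cis t"
  by (simp add: cis.code complex_eq_iff)

text \<open>The map \<open>z \<mapsto> - z\<close> carries the left half-plane to the right one and
  shifts the angle by \<open>pi\<close>, so the half-plane formula covers everything except the null
  line \<open>Re z = 0\<close>.\<close>

lemma nn_integral_polar:
  fixes F :: "complex \<Rightarrow> ennreal"
  assumes [measurable]: "F \<in> borel_measurable borel"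
  shows "(\<integral>\<^sup>+z. F z \<partial>lborel)
    = (\<integral>\<^sup>+t\<in>{0..<2*pi}. (\<integral>\<^sup>+\<rho>\<in>{0<..}. ennreal \<rho> * F (of_real \<rho> * cis t) \<partial>lborel) \<partial>lborel)"
proof -
  define G where "G t = (\<integral>\<^sup>+\<rho>\<in>{0<..}. ennreal \<rho> * F (of_real \<rho> * cis t) \<partial>lborel)" for t
  have [measurable]: "G \<in> borel_measurable borel"
    unfolding G_def by measurable
  have per: "G (t + 2 * pi) = G t" for t
    unfolding G_def by (simp add: cis_add_2pi)
  have Re0: "AE z :: complex in lborel. Re z \<noteq> 0"
  proof -
    have "emeasure lborel {z :: complex. Re z = 0} = (\<integral>\<^sup>+z. indicator {z :: complex. Re z = 0} z \<partial>lborel)"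
      by simp
    also have "\<dots> = (\<integral>\<^sup>+(x::real). (\<integral>\<^sup>+(y::real). indicator {0} x \<partial>lborel) \<partial>lborel)"
      by (subst nn_integral_lborel_complex) (auto intro!: nn_integral_cong simp: indicator_def)
    also have "\<dots> = (\<integral>\<^sup>+(x::real). 0 \<partial>lborel)"
      by (intro nn_integral_cong_AE, use AE_lborel_singleton[of "0::real"] in eventually_elim) auto
    finally show ?thesis
      by (intro AE_I[where N = "{z. Re z = 0}"]) auto
  qed
  have neg: "(\<integral>\<^sup>+z. H z \<partial>lborel) = (\<integral>\<^sup>+z. H (- z) \<partial>lborel)"
    if [measurable]: "H \<in> borel_measurable borel" for H :: "complex \<Rightarrow> ennreal"
    by (subst lborel_affine[of "-1" 0]) (simp_all add: nn_integral_density nn_integral_distr)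
  have "(\<integral>\<^sup>+z. F z \<partial>lborel)
      = (\<integral>\<^sup>+z. F z * indicator {z. 0 < Re z} z + F z * indicator {z. Re z < 0} z \<partial>lborel)"
    using Re0 by (intro nn_integral_cong_AE) (auto elim!: eventually_mono split: split_indicator)
  also have "\<dots> = (\<integral>\<^sup>+z. F z * indicator {z. 0 < Re z} z \<partial>lborel) + (\<integral>\<^sup>+z. F z * indicator {z. Re z < 0} z \<partial>lborel)"
    by (rule nn_integral_add) auto
  also have "(\<integral>\<^sup>+z. F z * indicator {z. Re z < 0} z \<partial>lborel) = (\<integral>\<^sup>+z. F (- z) * indicator {z. 0 < Re z} z \<partial>lborel)"
    by (subst neg) (auto intro!: nn_integral_cong split: split_indicator)
  also have "\<dots> = (\<integral>\<^sup>+t. G (pi + 1 * t) * indicator {-pi/2<..<pi/2} t \<partial>lborel)"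
    by (subst nn_integral_polar_half, simp) (auto simp: G_def cis_mult[symmetric] intro!: nn_integral_cong split: split_indicator)
  also have "\<dots> = (\<integral>\<^sup>+t. (\<lambda>s. G s * indicator {pi/2<..<3*pi/2} s) (pi + 1 * t) \<partial>lborel)"
    by (intro nn_integral_cong) (auto split: split_indicator simp: field_simps)
  also have "\<dots> = (\<integral>\<^sup>+t. G t * indicator {pi/2<..<3*pi/2} t \<partial>lborel)"
    by (subst nn_integral_real_affine[where c = 1 and t = pi and f = "\<lambda>s. G s * indicator {pi/2<..<3*pi/2} s"]) auto
  also have "(\<integral>\<^sup>+z. F z * indicator {z. 0 < Re z} z \<partial>lborel) = (\<integral>\<^sup>+t. G t * indicator {-pi/2<..<pi/2} t \<partial>lborel)"
    by (subst nn_integral_polar_half) (auto simp: G_def)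
  also have "\<dots> = (\<integral>\<^sup>+t. G t * indicator {0..<pi/2} t + G t * indicator {-pi/2<..<0} t \<partial>lborel)"
    by (intro nn_integral_cong) (auto split: split_indicator)
  also have "\<dots> = (\<integral>\<^sup>+t. G t * indicator {0..<pi/2} t \<partial>lborel) + (\<integral>\<^sup>+t. G t * indicator {-pi/2<..<0} t \<partial>lborel)"
    by (rule nn_integral_add) auto
  \<comment> \<open>Negative angles move up by one period; the three arcs then fill
    \<open>{0..<2*pi}\<close> up to two points.\<close>
  also have "(\<integral>\<^sup>+t. G t * indicator {-pi/2<..<0} t \<partial>lborel)
      = (\<integral>\<^sup>+t. G (-2*pi + 1 * t) * indicator {-pi/2<..<0} (-2*pi + 1 * t) \<partial>lborel)"
    by (subst nn_integral_real_affine[where c = 1 and t = "-2*pi" and f = "\<lambda>s. G s * indicator {-pi/2<..<0} s"]) auto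
  also have "\<dots> = (\<integral>\<^sup>+t. G t * indicator {3*pi/2<..<2*pi} t \<partial>lborel)"
    using per[of "_ - 2 * pi"] by (intro nn_integral_cong) (auto split: split_indicator simp: field_simps)
  also have "(\<integral>\<^sup>+t. G t * indicator {0..<pi/2} t \<partial>lborel) + (\<integral>\<^sup>+t. G t * indicator {3*pi/2<..<2*pi} t \<partial>lborel)
      + (\<integral>\<^sup>+t. G t * indicator {pi/2<..<3*pi/2} t \<partial>lborel)
      = (\<integral>\<^sup>+t. G t * indicator {0..<pi/2} t + G t * indicator {3*pi/2<..<2*pi} t + G t * indicator {pi/2<..<3*pi/2} t \<partial>lborel)"
    by (subst nn_integral_add; (subst nn_integral_add)?) auto
  also have "\<dots> = (\<integral>\<^sup>+t. G t * indicator {0..<2*pi} t \<partial>lborel)"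
    by (intro nn_integral_cong_AE, use AE_lborel_singleton[of "pi/2"] AE_lborel_singleton[of "3*pi/2"] in eventually_elim)
      (use pi_gt_zero in \<open>auto split: split_indicator\<close>)
  finally show ?thesis
    unfolding G_def .
qed


section \<open>The Poisson inequality for powers of moduli of holomorphic functions\<close>

text \<open>The local factorization at \<open>a\<close> supplies the multiplicity. Its cofactor
  repairs the quotient at \<open>a\<close>, and the two open sets on which the result is holomorphic
  cover the disk.\<close>

lemma split_off_zero:
  assumes holf: "f holomorphic_on ball 0 R" and "\<not> f constant_on ball 0 R"
    and a: "a \<in> ball 0 R" "f a = 0"
  obtains n h where "n > (0::nat)" "h holomorphic_on ball 0 R" "\<And>z. z \<in> ball 0 R \<Longrightarrow> f z = (z - a) ^ n * h z"
    "h a \<noteq> 0"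
proof -
  obtain g r n where g: "0 < n" "0 < r" "ball a r \<subseteq> ball 0 R" "g holomorphic_on ball a r"
      "\<And>w. w \<in> ball a r \<Longrightarrow> f w = (w - a)^n * g w" "\<And>w. w \<in> ball a r \<Longrightarrow> g w \<noteq> 0"
    by (rule holomorphic_factor_zero_nonconstant[OF holf _ _ a assms(2)]) auto
  define h where "h z = (if z = a then g a else f z / (z - a) ^ n)" for z
  have "h holomorphic_on ball a r"
    by (rule holomorphic_transform[OF g(4)]) (use g in \<open>auto simp: h_def\<close>)
  moreover have "h holomorphic_on ball 0 R - {a}"
    by (rule holomorphic_transform[where f = "\<lambda>z. f z / (z - a) ^ n"])
      (auto simp: h_def intro!: holomorphic_intros holomorphic_on_subset[OF holf])
  ultimately have "h holomorphic_on ball a r \<union> (ball 0 R - {a})"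
    by (intro holomorphic_on_Un) auto
  moreover have "ball a r \<union> (ball 0 R - {a}) = ball 0 R"
    using g(2,3) a by auto
  ultimately have "h holomorphic_on ball 0 R" by simp
  moreover have "f z = (z - a) ^ n * h z" if "z \<in> ball 0 R" for z
    using a g(1) by (auto simp: h_def)
  moreover have "h a \<noteq> 0"
    using g(2,6) by (auto simp: h_def)
  ultimately show thesis
    using that g(1) by blast
qed

lemma norm_one_minus_cnj_mult_sphere:
  assumes "norm (w::complex) = 1"
  shows "norm (1 - cnj z * w) = norm (w - z)"
proof -
  have "norm (1 - cnj z * w) = norm (w * (cnj w - cnj z))"
    using assms by (simp add: algebra_simps complex_norm_square[symmetric])
  also have "\<dots> = norm (cnj (w - z))"
    using assms by (simp add: norm_mult)
  finally show ?thesis by (simp only: complex_mod_cnj)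
qed

lemma norm_diff_le_one_minus_cnj_mult:
  assumes "norm (z::complex) \<le> 1" "norm w \<le> 1"
  shows "norm (w - z) \<le> norm (1 - cnj z * w)"
proof (rule power2_le_imp_le)
  have "(norm (1 - cnj z * w))\<^sup>2 - (norm (w - z))\<^sup>2 = (1 - (norm z)\<^sup>2) * (1 - (norm w)\<^sup>2)"
    unfolding cmod_power2 by (simp add: power2_eq_square algebra_simps)
  moreover have "\<dots> \<ge> 0"
    using assms by (simp add: power_le_one)
  ultimately show "(norm (w - z))\<^sup>2 \<le> (norm (1 - cnj z * w))\<^sup>2" by linarith
qed simp

text \<open>Dividing out the Blaschke factors keeps the modulus on the circle and increases it inside.\<close>

lemma zero_free_majorant:
  assumes "R > 1" "f holomorphic_on ball 0 R" "\<And>z. norm z = 1 \<Longrightarrow> f z \<noteq> 0"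
  shows "\<exists>g. g holomorphic_on ball 0 R \<and> (\<forall>z\<in>cball 0 1. g z \<noteq> 0)
    \<and> (\<forall>z. norm z = 1 \<longrightarrow> norm (g z) = norm (f z)) \<and> (\<forall>z\<in>ball 0 1. norm (f z) \<le> norm (g z))"
  using assms(2,3)
\<comment> \<open>Zeros are counted without multiplicity: \<open>split_off_zero\<close> removes the
  full order of a zero at once, so the count drops.\<close>
proof (induction "card {z \<in> cball 0 1. f z = 0}" arbitrary: f rule: less_induct)
  case less
  show ?case
  proof (cases "{z \<in> cball 0 1. f z = 0} = {}")
    case True
    then show ?thesis using less.prems by (intro exI[of _ f]) auto
  next
    case False
    then obtain a where a: "norm a \<le> 1" "f a = 0" by auto
    have sub: "cball 0 1 \<subseteq> ball (0::complex) R" using assms(1) by auto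
    \<comment> \<open>A constant \<open>f\<close> would take the value \<open>f a = 0\<close> at the
      point \<open>1\<close> of the circle.\<close>
    have ncon: "\<not> f constant_on ball 0 R"
      unfolding constant_on_def using less.prems(2)[of 1] a sub assms(1) by force
    have fin: "finite {z \<in> cball 0 1. f z = 0}"
      using less.prems(1) sub ncon by (intro holomorphic_compact_finite_zeros[of f "ball 0 R"]) auto
    have a1: "norm a < 1" using a less.prems(2)[of a] by force
    then have aR: "a \<in> ball 0 R" using assms(1) by auto
    obtain n h where h: "n > (0::nat)" "h holomorphic_on ball 0 R"
        "\<And>z. z \<in> ball 0 R \<Longrightarrow> f z = (z - a) ^ n * h z" "h a \<noteq> 0"
      using split_off_zero[OF less.prems(1) ncon aR a(2)] by metis
    \<comment> \<open>This is \<open>f\<close> divided by the \<open>n\<close>-th power of the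
      Blaschke factor of \<open>a\<close>, written without a division.\<close>
    define f1 where "f1 z = (1 - cnj a * z) ^ n * h z" for z
    have nz: "1 - cnj a * z \<noteq> 0" if "norm z \<le> 1" for z
    proof
      assume "1 - cnj a * z = 0"
      then have "norm (cnj a * z) = 1" by (metis diff_eq_diff_eq diff_zero eq_iff_diff_eq_0 norm_one)
      moreover have "norm (cnj a * z) \<le> norm a * 1"
        unfolding norm_mult using that by (intro mult_mono) auto
      ultimately show False using a1 by simp
    qed
    have "{z \<in> cball 0 1. f1 z = 0} = {z \<in> cball 0 1. f z = 0} - {a}"
      using h(1,3,4) nz sub by (auto simp: f1_def)
    then have "card {z \<in> cball 0 1. f1 z = 0} < card {z \<in> cball 0 1. f z = 0}"
      using fin a by (simp only:) (intro card_Diff1_less, auto)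
    moreover have "f1 holomorphic_on ball 0 R"
      unfolding f1_def using h(2) by (intro holomorphic_intros)
    moreover have eq: "norm (f1 z) = norm (f z)" if "norm z = 1" for z
      using h(3)[of z] that assms(1) norm_one_minus_cnj_mult_sphere[OF that, of a]
      by (simp add: f1_def norm_mult norm_power)
    moreover have "f1 z \<noteq> 0" if "norm z = 1" for z
      using eq[OF that] less.prems(2)[OF that] by auto
    ultimately obtain g where g: "g holomorphic_on ball 0 R" "\<forall>z\<in>cball 0 1. g z \<noteq> 0"
        "\<forall>z. norm z = 1 \<longrightarrow> norm (g z) = norm (f1 z)" "\<forall>z\<in>ball 0 1. norm (f1 z) \<le> norm (g z)"
      using less.hyps[of f1] by blast
    have "norm (f z) \<le> norm (f1 z)" if "norm z < 1" for z
    proof -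
      have "norm (z - a) ^ n \<le> norm (1 - cnj a * z) ^ n"
        using norm_diff_le_one_minus_cnj_mult[of a z] a1 that by (intro power_mono) auto
      then show ?thesis
        using h(3)[of z] that assms(1) by (simp add: f1_def norm_mult norm_power mult_right_mono)
    qed
    then show ?thesis
      using g eq by (intro exI[of _ g]) force
  qed
qed

text \<open>A zero-free \<open>g\<close> has a holomorphic \<open>p\<close>-th power
  \<open>exp (p * h)\<close>. The Poisson formula for that power, with absolute values taken inside,
  gives the inequality for \<open>g\<close>, and \<open>g\<close> has the modulus of
  \<open>f\<close> on the circle and a larger one inside.\<close>

lemma poisson_submean_unit:
  assumes "R > 1" and holf: "f holomorphic_on ball 0 R" and nz: "\<And>z. norm z = 1 \<Longrightarrow> f z \<noteq> 0"
    and z: "norm z < 1" and p: "p > 0"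
  shows "ennreal (2 * pi * norm (f z) powr p)
    \<le> (\<integral>\<^sup>+t\<in>{0..<2*pi}. ennreal ((1 - (norm z)\<^sup>2) / (norm (cis t - z))\<^sup>2 * norm (f (cis t)) powr p) \<partial>lborel)"
proof -
  obtain g where g: "g holomorphic_on ball 0 R" "\<And>z. norm z \<le> 1 \<Longrightarrow> g z \<noteq> 0"
      "\<And>z. norm z = 1 \<Longrightarrow> norm (g z) = norm (f z)" "\<And>z. norm z < 1 \<Longrightarrow> norm (f z) \<le> norm (g z)"
    using zero_free_majorant[OF assms(1) holf nz] by (metis mem_ball_0 mem_cball_0)
  \<comment> \<open>Zero-freeness passes from the closed disk to an open disk of radius
    \<open>1 + e\<close>, which is simply connected and so carries a logarithm of
    \<open>g\<close>.\<close>
  define U where "U = {z \<in> ball 0 R. g z \<noteq> 0}"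
  have "U = ball 0 R \<inter> g -` (- {0})" by (auto simp: U_def)
  moreover have "open (ball 0 R \<inter> g -` (- {0}))"
    by (rule continuous_open_preimage) (use g(1) holomorphic_on_imp_continuous_on in auto)
  ultimately have "open U" by simp
  moreover have "cball 0 1 \<subseteq> U" using g(2) assms(1) by (auto simp: U_def)
  ultimately obtain e where e: "e > 0" "(\<Union>x\<in>cball 0 1. ball x e) \<subseteq> U"
    using compact_subset_open_imp_ball_epsilon_subset[of "cball (0::complex) 1" U] compact_cball by auto
  have ball_sub: "ball 0 (1 + e) \<subseteq> U"
  proof
    fix w :: complex assume w: "w \<in> ball 0 (1 + e)"
    show "w \<in> U"
    proof (cases "norm w \<le> 1")
      case True
      then show ?thesis using e by (intro subsetD[OF e(2)]) (auto intro!: bexI[of _ w])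
    next
      case False
      then have "dist (w / norm w) w = norm w - 1"
      proof -
        have "w / norm w - w = - (w / norm w) * of_real (norm w - 1)"
          using False by (auto simp: divide_simps algebra_simps)
        moreover have "norm (of_real (norm w) - 1 :: complex) = norm w - 1"
          using False norm_of_real[of "norm w - 1", where 'a = complex] by simp
        ultimately show ?thesis using False by (auto simp: dist_norm norm_mult norm_divide)
      qed
      then have "w \<in> ball (w / norm w) e" "w / norm w \<in> cball 0 1"
        using w False by (auto simp: norm_divide)
      then show ?thesis using e(2) by blast
    qed
  qed
  obtain h where h: "h holomorphic_on ball 0 (1 + e)" "\<And>w. w \<in> ball 0 (1 + e) \<Longrightarrow> exp (h w) = g w"
    by (rule holomorphic_logarithm_exists[of "ball 0 (1 + e)" g 0])
      (use ball_sub e in \<open>auto simp: U_def intro!: holomorphic_on_subset[OF g(1)]\<close>)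
  have gp: "norm (exp (of_real p * h w)) = norm (g w) powr p" if "norm w \<le> 1" for w
  proof -
    have "g w = exp (h w)" using h(2)[of w] that e by auto
    then show ?thesis by (simp add: powr_def)
  qed
  \<comment> \<open>The added factor is \<open>1\<close> at \<open>w = z\<close>. On the circle
    \<open>norm (1 - cnj z * w) = norm (w - z)\<close>, so the Cauchy integrand
    \<open>F w / (w - z)\<close> has as modulus the Poisson kernel times
    \<open>norm (f w) powr p\<close>.\<close>
  define F where "F w = exp (of_real p * h w) * of_real (1 - (norm z)\<^sup>2) / (1 - cnj z * w)" for w
  have nz': "1 - cnj z * w \<noteq> 0" if "norm w \<le> 1" for w
  proof
    assume "1 - cnj z * w = 0"
    then have "norm (cnj z * w) = 1" by (metis diff_eq_diff_eq diff_zero eq_iff_diff_eq_0 norm_one)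
    moreover have "norm (cnj z * w) \<le> norm z * 1"
      unfolding norm_mult using that by (intro mult_mono) auto
    ultimately show False using z by simp
  qed
  have "F holomorphic_on cball 0 1"
    unfolding F_def using nz' e by (intro holomorphic_intros holomorphic_on_subset[OF h(1)]) auto
  then have "((\<lambda>u. F u / (u - z)) has_contour_integral (2 * of_real pi * \<i> * F z)) (circlepath 0 1)"
    using z by (intro Cauchy_integral_circlepath_simple) auto
  then have I: "((\<lambda>t. F (cis t) / (cis t - z) * cis t * \<i>) has_integral 2 * of_real pi * \<i> * F z) {0..2*pi}"
    unfolding circlepath_def by (subst (asm) has_contour_integral_part_circlepath_iff) (auto simp: cis_conv_exp algebra_simps)
  define K where "K t = (1 - (norm z)\<^sup>2) / (norm (cis t - z))\<^sup>2 * norm (f (cis t)) powr p" for t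
  have Kc: "continuous_on {0..2*pi} K"
    unfolding K_def using z holf assms(1) nz
    by (intro continuous_intros continuous_on_compose2[OF holomorphic_on_imp_continuous_on[OF holf]]) auto
  then have KI: "(K has_integral integral {0..2*pi} K) {0..2*pi}"
    by (intro integrable_integral integrable_continuous_real)
  have normeq: "norm (F (cis t) / (cis t - z) * cis t * \<i>) = K t" for t
  proof -
    have "norm (F (cis t)) = norm (f (cis t)) powr p * (1 - (norm z)\<^sup>2) / norm (cis t - z)"
      using gp[of "cis t"] g(3)[of "cis t"] z
      by (simp add: F_def norm_mult norm_divide norm_one_minus_cnj_mult_sphere power_le_one abs_square_le_1 del: of_real_diff)
    then show ?thesis
      by (simp add: K_def norm_mult norm_divide power2_eq_square)
  qed
  have "2 * pi * norm (f z) powr p \<le> 2 * pi * norm (g z) powr p"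
    using g(4)[OF z] p by (auto intro!: mult_left_mono powr_mono2)
  also have "norm (g z) powr p = norm (F z)"
  proof -
    have "1 - cnj z * z = of_real (1 - (norm z)\<^sup>2)"
      using complex_norm_square[of z] by (simp add: mult.commute)
    then have "F z = exp (of_real p * h z)"
      using nz'[of z] z by (simp add: F_def)
    then show ?thesis using gp[of z] z by simp
  qed
  also have "2 * pi * norm (F z) = norm (2 * of_real pi * \<i> * F z)"
    by (simp add: norm_mult)
  also have "\<dots> \<le> integral {0..2*pi} K"
    using has_integral_integrable[OF KI] normeq has_integral_integrable[OF I]
    by (subst integral_unique[OF I, symmetric]) (rule integral_norm_bound_integral, auto)
  finally have "ennreal (2 * pi * norm (f z) powr p) \<le> ennreal (integral {0..2*pi} K)"
    by (rule ennreal_leI)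
  also have "\<dots> = (\<integral>\<^sup>+t. indicator {0..2*pi} t * K t \<partial>lborel)"
    by (rule nn_integral_has_integral_lebesgue[OF _ KI, symmetric]) (use z in \<open>auto simp: K_def power_le_one abs_square_le_1\<close>)
  also have "\<dots> = (\<integral>\<^sup>+t\<in>{0..<2*pi}. ennreal (K t) \<partial>lborel)"
    by (intro nn_integral_cong_AE, use AE_lborel_singleton[of "2*pi"] in eventually_elim) (auto split: split_indicator)
  finally show ?thesis unfolding K_def .
qed

lemma poisson_submean:
  assumes holf: "f holomorphic_on disk" and \<rho>: "norm z < \<rho>" "\<rho> < 1" and nz: "\<And>w. norm w = \<rho> \<Longrightarrow> f w \<noteq> 0"
    and p: "p > 0"
  shows "ennreal (2 * pi * norm (f z) powr p)
    \<le> (\<integral>\<^sup>+t\<in>{0..<2*pi}. ennreal ((\<rho>\<^sup>2 - (norm z)\<^sup>2) / (norm (of_real \<rho> * cis t - z))\<^sup>2 * norm (f (of_real \<rho> * cis t)) powr p) \<partial>lborel)"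
proof -
  have \<rho>0: "\<rho> > 0" using \<rho> norm_ge_zero[of z] by linarith
  have K: "(1 - (norm (z / of_real \<rho>))\<^sup>2) / (norm (cis t - z / of_real \<rho>))\<^sup>2
      = (\<rho>\<^sup>2 - (norm z)\<^sup>2) / (norm (of_real \<rho> * cis t - z))\<^sup>2" for t
  proof -
    have "cis t - z / of_real \<rho> = (of_real \<rho> * cis t - z) / of_real \<rho>"
      using \<rho>0 by (simp add: field_simps)
    then have "norm (cis t - z / of_real \<rho>) = norm (of_real \<rho> * cis t - z) / \<rho>"
      using \<rho>0 by (simp add: norm_divide)
    then show ?thesis
      using \<rho>0 by (simp add: norm_divide power_divide divide_simps)
  qed
  have "(\<lambda>w. f (of_real \<rho> * w)) holomorphic_on ball 0 (1 / \<rho>)"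
    using \<rho>0 by (intro holomorphic_on_compose_gen[OF _ holf, unfolded o_def] holomorphic_intros)
      (auto simp: norm_mult field_simps)
  moreover have "1 / \<rho> > 1" using \<rho>0 \<rho> by simp
  ultimately have "ennreal (2 * pi * norm (f (of_real \<rho> * (z / of_real \<rho>))) powr p)
    \<le> (\<integral>\<^sup>+t\<in>{0..<2*pi}. ennreal ((1 - (norm (z / of_real \<rho>))\<^sup>2) / (norm (cis t - z / of_real \<rho>))\<^sup>2 * norm (f (of_real \<rho> * cis t)) powr p) \<partial>lborel)"
    using \<rho>0 \<rho> nz p by (intro poisson_submean_unit[where R = "1 / \<rho>"]) (auto simp: norm_mult norm_divide)
  then show ?thesis using \<rho>0 unfolding K by simp
qed


section \<open>Sequential compactness in quasi-normed spaces\<close>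

lemma subseq_of_infinite:
  assumes "\<And>k::nat. infinite {n. P k (n::nat)}"
  shows "\<exists>r. strict_mono r \<and> (\<forall>k. P k (r k))"
proof -
  have "\<exists>r. \<forall>k. P k (r k) \<and> r k < r (Suc k)"
  proof (rule dependent_nat_choice)
    show "\<exists>n. P 0 n" using assms[of 0] by (metis (no_types, lifting) Collect_empty_eq finite.emptyI)
    fix n k
    have "infinite ({m. P (Suc k) m} - {..n})" using assms[of "Suc k"] by simp
    then obtain m where "m \<in> {m. P (Suc k) m} - {..n}" by (metis finite.emptyI ex_in_conv)
    then show "\<exists>m. P (Suc k) m \<and> n < m" by auto
  qed
  then show ?thesis unfolding strict_mono_Suc_iff by blast
qed

text \<open>The gauge may vanish on a nonzero difference, and with \<open>C > 1\<close> its balls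
  need not be open. The topology is still the one generated by requiring a ball around every
  point.\<close>

locale quasi_gauge =
  fixes Y :: "(complex \<Rightarrow> complex) set" and N :: "(complex \<Rightarrow> complex) \<Rightarrow> ennreal" and C :: real
  assumes zero: "N (\<lambda>_. 0) = 0"
    and sym: "N (\<lambda>z. f z - g z) = N (\<lambda>z. g z - f z)"
    and tri: "f \<in> Y \<Longrightarrow> g \<in> Y \<Longrightarrow> h \<in> Y \<Longrightarrow>
        N (\<lambda>z. f z - h z) \<le> ennreal C * (N (\<lambda>z. f z - g z) + N (\<lambda>z. g z - h z))"
    and C: "C \<ge> 1"
begin

abbreviation "D f g \<equiv> N (\<lambda>z. f z - g z)"
abbreviation "T \<equiv> qnorm_topology Y N"

text \<open>The substitute for \<open>e / 2\<close> under the quasi-triangle inequality. A finite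
  \<open>r\<close> is extracted first because \<open>e\<close> may be infinite.\<close>

lemma halve:
  assumes "e > 0"
  shows "\<exists>d>0. d \<le> e \<and> ennreal C * (d + d) \<le> e"
proof -
  obtain r where r: "ennreal r \<le> e" "r > 0"
  proof (cases e)
    case (real r)
    then show ?thesis using that[of r] assms by auto
  next
    case top
    then show ?thesis using that[of 1] by auto
  qed
  have "ennreal C * (ennreal (r / (2 * C)) + ennreal (r / (2 * C))) = ennreal (C * (r / (2 * C) + r / (2 * C)))"
    using r C by (subst ennreal_plus[symmetric]) (auto simp: ennreal_mult[symmetric] simp del: ennreal_plus)
  also have "C * (r / (2 * C) + r / (2 * C)) = r" using C by (simp add: field_simps)
  finally have 1: "ennreal C * (ennreal (r / (2 * C)) + ennreal (r / (2 * C))) \<le> e" using r by simp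
  have "r / (2 * C) \<le> r" using C r by (simp add: divide_le_eq)
  then have 2: "ennreal (r / (2 * C)) \<le> e" by (meson ennreal_leI order_trans r(1))
  show ?thesis
    by (intro exI[of _ "ennreal (r / (2 * C))"] conjI 1 2) (use r C in auto)
qed

text \<open>The ball itself may fail to be open; the set of points that have some small ball inside
  it is open, since \<open>halve\<close> fits a smaller ball around each nearby point.\<close>

lemma ball_neighbourhood:
  assumes g: "g \<in> Y" and e: "e > 0"
  shows "\<exists>U. openin T U \<and> g \<in> U \<and> U \<subseteq> {h \<in> Y. D h g < e}"
proof -
  define U where "U = {h \<in> Y. \<exists>d>0. {k \<in> Y. D k h < d} \<subseteq> {k \<in> Y. D k g < e}}"
  have "\<exists>d>0. {k \<in> Y. D k h < d} \<subseteq> U" if h: "h \<in> U" for h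
  proof -
    obtain d where d: "d > 0" "{k \<in> Y. D k h < d} \<subseteq> {k \<in> Y. D k g < e}" and hY: "h \<in> Y"
      using h by (auto simp: U_def)
    obtain d' where d': "d' > 0" "ennreal C * (d' + d') \<le> d" using halve[OF d(1)] by auto
    have "k \<in> U" if k: "k \<in> Y" "D k h < d'" for k
    proof -
      have "{l \<in> Y. D l k < d'} \<subseteq> {l \<in> Y. D l h < d}"
      proof safe
        fix l assume l: "l \<in> Y" "D l k < d'"
        have "D l h \<le> ennreal C * (D l k + D k h)" using tri l k hY by auto
        also have "\<dots> < ennreal C * (d' + d')"
          using l k C by (intro ennreal_mult_strict_left_mono add_strict_mono) auto
        finally show "D l h < d" using d' by auto
      qed
      then show ?thesis using k d d' by (auto simp: U_def intro!: exI[of _ d'])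
    qed
    then show ?thesis using d' by (intro exI[of _ d']) auto
  qed
  then have "openin T U" unfolding openin_qnorm_topology by (auto simp: U_def)
  moreover have "g \<in> U" using g e by (auto simp: U_def)
  moreover have "U \<subseteq> {h \<in> Y. D h g < e}"
    using zero by (auto simp: U_def subset_iff) 
  ultimately show ?thesis by blast
qed

text \<open>If no subsequence converged, every point of \<open>K\<close> would have a neighbourhood
  containing \<open>x n\<close> for finitely many \<open>n\<close> only, and a finite subcover would
  exhaust the natural numbers.\<close>

lemma compactin_imp_seq:
  assumes K: "compactin T K" and x: "\<And>n. x n \<in> K"
  obtains g r where "g \<in> K" "strict_mono (r::nat \<Rightarrow> nat)" "(\<lambda>n. D (x (r n)) g) \<longlonglongrightarrow> 0"
proof (rule ccontr)
  note conclude = that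
  assume no: "\<not> thesis"
  have KY: "K \<subseteq> Y" using compactin_subset_topspace[OF K] by (simp add: topspace_qnorm_topology)
  have fin: "\<exists>e>0. finite {n. D (x n) g < e}" if "g \<in> K" for g
  proof (rule ccontr)
    assume "\<not> ?thesis"
    moreover have "ennreal (1 / Suc k) > 0" for k by simp
    ultimately have "\<And>k::nat. infinite {n. D (x n) g < ennreal (1 / Suc k)}" by blast
    then obtain r where r: "strict_mono r" "\<And>k::nat. D (x (r k)) g < ennreal (1 / Suc k)"
      using subseq_of_infinite[of "\<lambda>k n. D (x n) g < ennreal (1 / Suc k)"] by blast
    have "(\<lambda>k. ennreal (1 / Suc k)) \<longlonglongrightarrow> ennreal 0"
      by (intro tendsto_ennrealI LIMSEQ_Suc lim_1_over_n)
    then have "(\<lambda>k. D (x (r k)) g) \<longlonglongrightarrow> 0"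
      using tendsto_sandwich[of "\<lambda>_. 0" "\<lambda>k. D (x (r k)) g" sequentially "\<lambda>k. ennreal (1 / Suc k)" 0] less_imp_le[OF r(2)] by simp
    then show False using no conclude[OF \<open>g \<in> K\<close> r(1)] by blast
  qed
  then have "\<forall>g\<in>K. \<exists>e. e > 0 \<and> finite {n. D (x n) g < e}" by blast
  from bchoice[OF this] obtain e where e: "\<And>g. g \<in> K \<Longrightarrow> e g > 0 \<and> finite {n. D (x n) g < e g}" by blast
  have "\<forall>g\<in>K. \<exists>U. openin T U \<and> g \<in> U \<and> U \<subseteq> {h \<in> Y. D h g < e g}"
  proof
    fix g assume "g \<in> K"
    then have "g \<in> Y" "e g > 0" using KY e by auto
    then show "\<exists>U. openin T U \<and> g \<in> U \<and> U \<subseteq> {h \<in> Y. D h g < e g}"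
      by (rule ball_neighbourhood)
  qed
  from bchoice[OF this] obtain U where U: "\<And>g. g \<in> K \<Longrightarrow> openin T (U g) \<and> g \<in> U g \<and> U g \<subseteq> {h \<in> Y. D h g < e g}" by blast
  have "K \<subseteq> \<Union>(U ` K)" and "\<And>V. V \<in> U ` K \<Longrightarrow> openin T V" using U by auto
  then obtain \<F> where F: "finite \<F>" "\<F> \<subseteq> U ` K" "K \<subseteq> \<Union>\<F>"
    using compactinD[OF K, of "U ` K"] by auto
  then obtain J where J: "finite J" "J \<subseteq> K" "\<F> = U ` J" by (meson finite_subset_image)
  have "UNIV \<subseteq> (\<Union>g\<in>J. {n. D (x n) g < e g})"
  proof
    fix n :: nat
    obtain g where "g \<in> J" "x n \<in> U g" using x[of n] F(3) J(3) by blast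
    then have "D (x n) g < e g" using U[of g] J(2) by auto
    then show "n \<in> (\<Union>g\<in>J. {n. D (x n) g < e g})" using \<open>g \<in> J\<close> by auto
  qed
  moreover have "finite (\<Union>g\<in>J. {n. D (x n) g < e g})"
    using J e by auto
  ultimately show False using finite_subset[of UNIV] infinite_UNIV_nat by auto
qed

text \<open>The metric argument survives the constant \<open>C\<close>: a Lebesgue number for the
  cover, then total boundedness at that scale.\<close>

lemma seq_imp_compactin:
  assumes KY: "K \<subseteq> Y"
    and seq: "\<And>x. (\<And>n::nat. x n \<in> K) \<Longrightarrow> \<exists>g\<in>K. \<exists>r. strict_mono r \<and> (\<lambda>n. D (x (r n)) g) \<longlonglongrightarrow> 0"
  shows "compactin T K"
  unfolding compactin_def
proof (intro conjI allI impI)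
  show "K \<subseteq> topspace T" using KY by (simp add: topspace_qnorm_topology)
  fix \<U> assume \<U>: "Ball \<U> (openin T) \<and> K \<subseteq> \<Union>\<U>"
  \<comment> \<open>Lebesgue number: otherwise centres \<open>f n\<close> with bad balls of radius
    \<open>1 / Suc n\<close> accumulate at some \<open>g\<close>, and a member of the cover around
    \<open>g\<close> swallows one of these balls.\<close>
  have "\<exists>e>0. \<forall>f\<in>K. \<exists>U\<in>\<U>. {g \<in> Y. D g f < e} \<subseteq> U"
  proof (rule ccontr)
    assume no: "\<not> ?thesis"
    have "\<exists>f. f \<in> K \<and> (\<forall>U\<in>\<U>. \<not> {g \<in> Y. D g f < ennreal (1 / Suc n)} \<subseteq> U)" for n
    proof (rule ccontr)
      assume "\<not> ?thesis"
      then have "\<forall>f\<in>K. \<exists>U\<in>\<U>. {g \<in> Y. D g f < ennreal (1 / Suc n)} \<subseteq> U" by blast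
      moreover have "ennreal (1 / Suc n) > 0" by simp
      ultimately show False using no by blast
    qed
    then have "\<forall>n. \<exists>f. f \<in> K \<and> (\<forall>U\<in>\<U>. \<not> {g \<in> Y. D g f < ennreal (1 / Suc n)} \<subseteq> U)" ..
    from choice[OF this] obtain f
      where f': "\<forall>n. f n \<in> K \<and> (\<forall>U\<in>\<U>. \<not> {g \<in> Y. D g (f n) < ennreal (1 / Suc n)} \<subseteq> U)" ..
    have f: "f n \<in> K" "U \<in> \<U> \<Longrightarrow> \<not> {g \<in> Y. D g (f n) < ennreal (1 / Suc n)} \<subseteq> U" for n U
      using spec[OF f', of n] by blast+
    obtain g r where g: "g \<in> K" "strict_mono (r::nat\<Rightarrow>nat)" "(\<lambda>n. D (f (r n)) g) \<longlonglongrightarrow> 0"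
      using seq[of f] f(1) by blast
    obtain U where U: "U \<in> \<U>" "g \<in> U" using g \<U> by blast
    obtain d where d: "d > 0" "{h \<in> Y. D h g < d} \<subseteq> U"
      using \<U> U unfolding openin_qnorm_topology by blast
    obtain d' where d': "d' > 0" "ennreal C * (d' + d') \<le> d" using halve[OF d(1)] by auto
    have "(\<lambda>k. ennreal (1 / Suc (r k))) \<longlonglongrightarrow> ennreal 0"
      using LIMSEQ_subseq_LIMSEQ[OF LIMSEQ_Suc[OF lim_1_over_n[where 'a = real]] g(2)] by (intro tendsto_ennrealI) (simp add: o_def)
    then have "eventually (\<lambda>k. ennreal (1 / Suc (r k)) < d') sequentially"
      using d' by (intro order_tendstoD) auto
    moreover have "eventually (\<lambda>k. D (f (r k)) g < d') sequentially"
      using d' g(3) by (intro order_tendstoD) auto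
    ultimately have "eventually (\<lambda>k. ennreal (1 / Suc (r k)) < d' \<and> D (f (r k)) g < d') sequentially"
      by eventually_elim simp
    then obtain k where k: "ennreal (1 / Suc (r k)) < d'" "D (f (r k)) g < d'"
      by (auto simp: eventually_sequentially)
    have "{h \<in> Y. D h (f (r k)) < ennreal (1 / Suc (r k))} \<subseteq> {h \<in> Y. D h g < d}"
    proof safe
      fix h assume h: "h \<in> Y" "D h (f (r k)) < ennreal (1 / Suc (r k))"
      have "D h g \<le> ennreal C * (D h (f (r k)) + D (f (r k)) g)"
        using h(1) f(1)[of "r k"] g(1) KY by (intro tri) blast+
      also have "\<dots> < ennreal C * (d' + d')"
        using less_trans[OF h(2) k(1)] k(2) C by (intro ennreal_mult_strict_left_mono add_strict_mono) auto
      finally show "D h g < d" using d' by auto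
    qed
    then show False using f(2)[OF U(1), of "r k"] d(2) by blast
  qed
  then obtain e where e: "e > 0" "\<And>f. f \<in> K \<Longrightarrow> \<exists>U\<in>\<U>. {g \<in> Y. D g f < e} \<subseteq> U" by blast
  \<comment> \<open>Total boundedness: otherwise a sequence with mutual gauge at least
    \<open>e\<close> exists, and it has no convergent subsequence.\<close>
  have "\<exists>F. finite F \<and> F \<subseteq> K \<and> (\<forall>g\<in>K. \<exists>f\<in>F. D g f < e)"
  proof (rule ccontr)
    assume no: "\<not> ?thesis"
    have "\<exists>x. \<forall>n::nat. x n \<in> K \<and> (\<forall>m<n. \<not> D (x n) (x m) < e)"
    proof (rule dependent_wellorder_choice)
      fix x and n :: nat
      assume "\<And>m. m < n \<Longrightarrow> x m \<in> K \<and> (\<forall>k<m. \<not> D (x m) (x k) < e)"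
      then have "finite (x ` {..<n}) \<and> x ` {..<n} \<subseteq> K" by auto
      with no have "\<not> (\<forall>g\<in>K. \<exists>f\<in>x ` {..<n}. D g f < e)" by (meson)
      then obtain g where "g \<in> K" "\<not> (\<exists>f\<in>x ` {..<n}. D g f < e)" by (meson)
      then show "\<exists>y. y \<in> K \<and> (\<forall>m<n. \<not> D y (x m) < e)" by (intro exI[of _ g]) auto
    qed simp
    then obtain x where x: "\<And>n::nat. x n \<in> K" "\<And>n m. m < n \<Longrightarrow> \<not> D (x n) (x m) < e" by blast
    obtain g r where g: "g \<in> K" "strict_mono (r::nat\<Rightarrow>nat)" "(\<lambda>n. D (x (r n)) g) \<longlonglongrightarrow> 0"
      using seq[of x] x(1) by blast
    obtain d where d: "d > 0" "ennreal C * (d + d) \<le> e" using halve[OF e(1)] by auto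
    have "eventually (\<lambda>k. D (x (r k)) g < d) sequentially"
      using d g(3) by (intro order_tendstoD) auto
    then obtain k where k: "\<And>n. n \<ge> k \<Longrightarrow> D (x (r n)) g < d" by (auto simp: eventually_sequentially)
    have "D (x (r (Suc k))) (x (r k)) \<le> ennreal C * (D (x (r (Suc k))) g + D g (x (r k)))"
      using tri x(1) g(1) KY by blast
    also have "\<dots> < ennreal C * (d + d)"
      using k[of k] k[of "Suc k"] C sym[of g] by (intro ennreal_mult_strict_left_mono add_strict_mono) auto
    finally have "D (x (r (Suc k))) (x (r k)) < e" using d by auto
    then show False using x(2)[of "r k" "r (Suc k)"] g(2) by (simp add: strict_mono_Suc_iff)
  qed
  then obtain F where F: "finite F" "F \<subseteq> K" "\<And>g. g \<in> K \<Longrightarrow> \<exists>f\<in>F. D g f < e" by blast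
  have "\<forall>f\<in>F. \<exists>U. U \<in> \<U> \<and> {g \<in> Y. D g f < e} \<subseteq> U" using e(2) F(2) by blast
  from bchoice[OF this] obtain V where V': "\<forall>f\<in>F. V f \<in> \<U> \<and> {g \<in> Y. D g f < e} \<subseteq> V f" ..
  then have V: "V f \<in> \<U> \<and> {g \<in> Y. D g f < e} \<subseteq> V f" if "f \<in> F" for f
    using that by blast
  have "K \<subseteq> \<Union>(V ` F)"
  proof
    fix g assume g: "g \<in> K"
    then obtain f where f: "f \<in> F" "D g f < e" using F(3) by blast
    then have "g \<in> V f" using V[of f] g KY by blast
    then show "g \<in> \<Union>(V ` F)" using f by blast
  qed
  then show "\<exists>\<F>. finite \<F> \<and> \<F> \<subseteq> \<U> \<and> K \<subseteq> \<Union>\<F>"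
    using F(1) V by (intro exI[of _ "V ` F"]) auto
qed

text \<open>Points of the closure are approximated by points of \<open>S\<close> with error
  \<open>1 / Suc n\<close>, so only sequences in \<open>S\<close> need testing; a limit merely in
  \<open>Y\<close> lies automatically in the closure.\<close>

lemma relatively_compact:
  assumes S: "S \<subseteq> Y"
    and seq: "\<And>x. (\<And>n::nat. x n \<in> S) \<Longrightarrow> \<exists>g\<in>Y. \<exists>r. strict_mono r \<and> (\<lambda>n. D (x (r n)) g) \<longlonglongrightarrow> 0"
  shows "compactin T (T closure_of S)"
proof (rule seq_imp_compactin)
  show cY: "T closure_of S \<subseteq> Y"
    using closure_of_subset_topspace[of T S] by (simp add: topspace_qnorm_topology)
  fix y assume y: "\<And>n::nat. y n \<in> T closure_of S"
  have "\<exists>x. x \<in> S \<and> D x (y n) < ennreal (1 / Suc n)" for n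
  proof -
    have "y n \<in> Y" using y cY by blast
    then obtain U where U: "openin T U" "y n \<in> U" "U \<subseteq> {h \<in> Y. D h (y n) < ennreal (1 / Suc n)}"
      using ball_neighbourhood[of "y n" "ennreal (1 / Suc n)"] by auto
    then show ?thesis using y[of n] unfolding in_closure_of by blast
  qed
  then have "\<forall>n. \<exists>x. x \<in> S \<and> D x (y n) < ennreal (1 / Suc n)" ..
  from choice[OF this] obtain x where "\<forall>n. x n \<in> S \<and> D (x n) (y n) < ennreal (1 / Suc n)" ..
  then have x: "x n \<in> S" "D (x n) (y n) < ennreal (1 / Suc n)" for n by simp_all
  obtain g r where g: "g \<in> Y" "strict_mono (r::nat\<Rightarrow>nat)" "(\<lambda>n. D (x (r n)) g) \<longlonglongrightarrow> 0"
    using seq[of x] x(1) by blast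
  have "(\<lambda>k. ennreal (1 / Suc (r k))) \<longlonglongrightarrow> ennreal 0"
    using LIMSEQ_subseq_LIMSEQ[OF LIMSEQ_Suc[OF lim_1_over_n[where 'a = real]] g(2)] by (intro tendsto_ennrealI) (simp add: o_def)
  then have "(\<lambda>k. ennreal C * (ennreal (1 / Suc (r k)) + D (x (r k)) g)) \<longlonglongrightarrow> ennreal C * (ennreal 0 + 0)"
    by (intro ennreal_tendsto_cmult tendsto_add g) auto
  then have lim: "(\<lambda>k. ennreal C * (ennreal (1 / Suc (r k)) + D (x (r k)) g)) \<longlonglongrightarrow> 0" by simp
  have "D (y (r k)) g \<le> ennreal C * (ennreal (1 / Suc (r k)) + D (x (r k)) g)" for k
  proof -
    have "D (y (r k)) g \<le> ennreal C * (D (y (r k)) (x (r k)) + D (x (r k)) g)"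
      using y cY x(1) S g by (intro tri) auto
    also have "\<dots> \<le> ennreal C * (ennreal (1 / Suc (r k)) + D (x (r k)) g)"
      using x(2)[of "r k"] sym[of "y (r k)"] by (intro mult_left_mono add_right_mono) auto
    finally show ?thesis .
  qed
  then have "(\<lambda>k. D (y (r k)) g) \<longlonglongrightarrow> 0"
    using tendsto_sandwich[of "\<lambda>_. 0" "\<lambda>k. D (y (r k)) g" sequentially _ 0, OF _ _ _ lim] by simp
  moreover have "g \<in> T closure_of S"
    unfolding in_closure_of
  proof (intro conjI allI impI)
    show "g \<in> topspace T" using g by (simp add: topspace_qnorm_topology)
    fix U assume "g \<in> U \<and> openin T U"
    then obtain d where d: "d > 0" "{h \<in> Y. D h g < d} \<subseteq> U" unfolding openin_qnorm_topology by blast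
    have "eventually (\<lambda>k. D (x (r k)) g < d) sequentially"
      using d g(3) by (intro order_tendstoD) auto
    then obtain k where "D (x (r k)) g < d" by (auto simp: eventually_sequentially)
    then show "\<exists>h. h \<in> S \<and> h \<in> U" using x(1) S d by blast
  qed
  ultimately show "\<exists>g\<in>T closure_of S. \<exists>r. strict_mono r \<and> (\<lambda>n. D (y (r n)) g) \<longlonglongrightarrow> 0"
    using g(2) by blast
qed

end


section \<open>Tent spaces\<close>

lemma ennreal_tendsto_0_iff:
  fixes f :: "'a \<Rightarrow> ennreal"
  shows "(f \<longlongrightarrow> 0) F \<longleftrightarrow> (\<forall>e>0. eventually (\<lambda>x. f x < e) F)"
proof
  show "\<forall>e>0. eventually (\<lambda>x. f x < e) F" if "(f \<longlongrightarrow> 0) F"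
    using order_tendstoD(2)[OF that] by auto
qed (rule order_tendstoI, auto)

section \<open>Powers of extended nonnegative reals\<close>

lemma epow_0 [simp]: "epow 0 a = 0"
  by (simp add: epow_def)

lemma epow_ennreal [simp]: "x \<ge> 0 \<Longrightarrow> epow (ennreal x) a = ennreal (x powr a)"
  by (simp add: epow_def)

lemma epow_top [simp]: "epow top a = top"
  by (simp add: epow_def)

lemma epow_mono: "a \<ge> 0 \<Longrightarrow> x \<le> y \<Longrightarrow> epow x a \<le> epow y a"
  by (cases x; cases y) (auto intro!: powr_mono2 simp: top_unique)

lemma epow_epow: "a > 0 \<Longrightarrow> epow (epow x a) (1 / a) = x"
  by (cases x) (auto simp: powr_powr)

lemma epow_epow': "a > 0 \<Longrightarrow> epow (epow x (1 / a)) a = x"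
  by (cases x) (auto simp: powr_powr)

lemma epow_le_iff: "a > 0 \<Longrightarrow> epow x (1 / a) \<le> y \<longleftrightarrow> x \<le> epow y a"
  using epow_mono[of a "epow x (1 / a)" y] epow_mono[of "1 / a" x "epow y a"]
  by (auto simp: epow_epow epow_epow')

lemma epow_less_iff: "a > 0 \<Longrightarrow> epow x (1 / a) < y \<longleftrightarrow> x < epow y a"
proof -
  assume a: "a > 0"
  then have "y \<le> epow x (1 / a) \<longleftrightarrow> epow y a \<le> x"
    using epow_le_iff[of "1 / a" y x] by simp
  then show ?thesis by (simp add: not_le[symmetric])
qed

lemma epow_less_top_iff: "epow x a < \<infinity> \<longleftrightarrow> x < \<infinity>"
  by (cases x) (auto)

lemma epow_pos_iff: "epow x a > 0 \<longleftrightarrow> x > 0"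
  by (cases x) (auto)

lemma epow_cmult: "c > 0 \<Longrightarrow> epow (ennreal c * x) a = ennreal (c powr a) * epow x a"
  by (cases x) (auto simp: ennreal_mult[symmetric] powr_mult ennreal_mult_top)

lemma epow_tendsto_0:
  assumes "a > 0"
  shows "((\<lambda>x. epow (f x) a) \<longlongrightarrow> 0) F \<longleftrightarrow> (f \<longlongrightarrow> 0) F"
proof
  have *: "((\<lambda>x. epow (f x) (1 / a)) \<longlongrightarrow> 0) F" if "(f \<longlongrightarrow> 0) F" "a > 0" for a f
    using that unfolding ennreal_tendsto_0_iff by (auto simp: epow_less_iff epow_pos_iff)
  show "((\<lambda>x. epow (f x) a) \<longlongrightarrow> 0) F" if "(f \<longlongrightarrow> 0) F"
    using *[of f "1 / a"] that assms by simp
  show "(f \<longlongrightarrow> 0) F" if "((\<lambda>x. epow (f x) a) \<longlongrightarrow> 0) F"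
    using *[of "\<lambda>x. epow (f x) a" a] that assms by (simp add: epow_epow)
qed

section \<open>Carleson squares and removal of the essential supremum\<close>

lemma carleson_square_subset: "carleson_square a \<subseteq> disk"
  by (auto simp: carleson_square_def norm_mult) (metis abs_of_nonneg norm_ge_zero order_trans)

text \<open>The square is open only at the outer radius, hence a countable union of continuous
  images of compact rectangles.\<close>

lemma borel_carleson_square [measurable]: "norm a < 1 \<Longrightarrow> carleson_square a \<in> sets borel"
proof (cases "a = 0")
  case False
  assume "norm a < 1"
  define K where "K n = (\<lambda>p. of_real (fst p) * cis (snd p)) `
    ({norm a .. 1 - 1 / Suc n} \<times> {Arg a - (1 - norm a) / 2 .. Arg a + (1 - norm a) / 2})" for n :: nat
  have "compact (K n)" for n
    unfolding K_def by (intro compact_continuous_image continuous_intros compact_Times compact_Icc)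
  then have "K n \<in> sets borel" for n by (intro borel_closed compact_imp_closed)
  moreover have "carleson_square a = (\<Union>n. K n)"
  proof (rule set_eqI, rule iffI)
    fix z assume "z \<in> carleson_square a"
    then obtain \<rho> t where z: "z = of_real \<rho> * cis t" "norm a \<le> \<rho>" "\<rho> < 1" "\<bar>t - Arg a\<bar> \<le> (1 - norm a) / 2"
      using False by (auto simp: carleson_square_def)
    obtain n where "inverse (of_nat (Suc n)) < 1 - \<rho>" using reals_Archimedean[of "1 - \<rho>"] z by auto
    moreover have "Arg a - (1 - norm a) / 2 \<le> t" "t \<le> Arg a + (1 - norm a) / 2"
      using z(4) by linarith+
    ultimately have "z \<in> K n" unfolding K_def using z
      by (intro image_eqI[of _ _ "(\<rho>, t)"]) (auto simp: inverse_eq_divide)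
    then show "z \<in> (\<Union>n. K n)" by blast
  next
    fix z assume "z \<in> (\<Union>n. K n)"
    then obtain n \<rho> t where z: "z = of_real \<rho> * cis t" "norm a \<le> \<rho>" "\<rho> \<le> 1 - 1 / Suc n"
        "Arg a - (1 - norm a) / 2 \<le> t" "t \<le> Arg a + (1 - norm a) / 2"
      by (auto simp: K_def)
    then have "\<bar>t - Arg a\<bar> \<le> (1 - norm a) / 2" by linarith
    moreover have "\<rho> < 1" using z(3) by (rule le_less_trans) simp
    ultimately show "z \<in> carleson_square a" using False z(1,2) by (auto simp: carleson_square_def)
  qed
  ultimately show ?thesis by simp
qed (simp add: carleson_square_def)

text \<open>The \<open>q\<close>-th power of the quasi-norm in workable form, see
  \<open>tent_norm_eq\<close>; the origin is left out because no cone contains it.\<close>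

definition tent_sup :: "complex measure \<Rightarrow> real \<Rightarrow> (complex \<Rightarrow> complex) \<Rightarrow> ennreal" where
  "tent_sup \<mu> q f = (SUP a\<in>disk - {0}. carleson_mean \<mu> q f a)"

lemma cone_nonzero: "a \<in> cone \<xi> \<Longrightarrow> a \<in> disk - {0}"
  by (auto simp: cone_def)

lemma borel_measurable_epow [measurable]: "(\<lambda>x. epow x a) \<in> borel_measurable borel"
  unfolding epow_def by measurable

text \<open>No regularity of \<open>M\<close> is needed: \<open>a \<in> cone \<xi>\<close> is an
  open condition on \<open>\<xi>\<close>, so superlevel sets are relatively open.\<close>

lemma measurable_cone_SUP:
  fixes M :: "complex \<Rightarrow> ennreal"
  shows "(\<lambda>\<xi>. SUP a\<in>cone \<xi>. M a) \<in> borel_measurable arc_length"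
proof (rule borel_measurableI_greater)
  fix y
  have "{\<xi> \<in> space arc_length. y < (SUP a\<in>cone \<xi>. M a)}
      = sphere 0 1 \<inter> (\<Union>a\<in>{a \<in> disk. y < M a}. {\<xi>. norm (1 - cnj \<xi> * a) < 1 - (norm a)\<^sup>2})"
    by (auto simp: arc_length_def less_SUP_iff cone_def space_restrict_space)
  moreover have "open (\<Union>a\<in>{a \<in> disk. y < M a}. {\<xi>. norm (1 - cnj \<xi> * a) < 1 - (norm a)\<^sup>2})"
    by (intro open_UN ballI open_Collect_less continuous_intros)
  ultimately show "{\<xi> \<in> space arc_length. y < (SUP a\<in>cone \<xi>. M a)} \<in> sets arc_length"
    by (auto simp: arc_length_def sets_restrict_space intro!: image_eqI borel_open)
qed

text \<open>The directions whose cone contains \<open>a\<close> include an open arc around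
  \<open>a / norm a\<close>, which has positive length and so is not contained in a null
  set.\<close>

lemma AE_arc_length_cone:
  assumes "AE \<xi> in arc_length. P \<xi>" and a: "a \<in> disk" "a \<noteq> 0"
  shows "\<exists>\<xi>. a \<in> cone \<xi> \<and> P \<xi>"
proof (rule ccontr)
  assume no: "\<not> ?thesis"
  have "cis \<in> measurable (restrict_space lborel {0..<2*pi}) (restrict_space borel (sphere 0 1))"
    by (intro measurable_restrict_space2 measurable_restrict_space1)
      (auto intro!: borel_measurable_continuous_onI continuous_intros)
  from AE_distrD[OF this assms(1)[unfolded arc_length_def]]
  have "AE t in lborel. t \<in> {0..<2*pi} \<longrightarrow> P (cis t)"
    by (subst (asm) AE_restrict_space_iff) auto
  define \<alpha> where "\<alpha> = Arg2pi a"
  have aeq: "a = of_real (norm a) * cis \<alpha>" and \<alpha>: "0 \<le> \<alpha>" "\<alpha> < 2 * pi"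
    using Arg2pi[of a] by (auto simp: \<alpha>_def cis_conv_exp is_Arg_def)
  define V where "V = {t. norm (1 - cnj (cis t) * a) < 1 - (norm a)\<^sup>2}"
  have "open V" unfolding V_def by (intro open_Collect_less continuous_intros)
  moreover have "cnj (cis \<alpha>) * a = of_real (norm a)"
    by (subst aeq) (simp add: cis_cnj cis_mult)
  then have "\<alpha> \<in> V"
    using a norm_of_real[of "1 - norm a", where 'a = complex] by (auto simp: V_def power2_eq_square)
  ultimately obtain d where d: "d > 0" "ball \<alpha> d \<subseteq> V" by (meson openE)
  \<comment> \<open>Only angles to the right of \<open>\<alpha>\<close> are used, clipped at
    \<open>2 * pi\<close> to stay in the parameter interval of \<open>arc_length\<close>.\<close>
  define \<beta> where "\<beta> = min (\<alpha> + d) (2 * pi)"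
  have "\<alpha> < \<beta>" using d \<alpha> by (auto simp: \<beta>_def)
  have "AE t in lborel. t \<notin> {\<alpha><..<\<beta>}"
    using \<open>AE t in lborel. t \<in> {0..<2*pi} \<longrightarrow> P (cis t)\<close>
  proof eventually_elim
    case (elim t)
    show ?case
    proof
      assume t: "t \<in> {\<alpha><..<\<beta>}"
      then have "t \<in> V" using d by (intro subsetD[OF d(2)]) (auto simp: \<beta>_def dist_real_def)
      then have "a \<in> cone (cis t)" using a by (simp add: V_def cone_def)
      moreover have "P (cis t)" using elim t \<alpha> by (auto simp: \<beta>_def)
      ultimately show False using no by blast
    qed
  qed
  then have "emeasure lborel {\<alpha><..<\<beta>} = 0"
    by (subst (asm) AE_iff_measurable[of "{\<alpha><..<\<beta>}"]) auto
  then show False using \<open>\<alpha> < \<beta>\<close> by simp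
qed

text \<open>Every cone supremum is below the full supremum. Conversely an essential bound holds at
  some direction whose cone contains a given \<open>a\<close>, hence it bounds the mean at
  \<open>a\<close>.\<close>

lemma tent_norm_eq:
  assumes "q > 0"
  shows "tent_norm \<mu> q f = epow (tent_sup \<mu> q f) (1 / q)"
proof -
  define \<phi> where "\<phi> \<xi> = epow (SUP a\<in>cone \<xi>. carleson_mean \<mu> q f a) (1 / q)" for \<xi>
  have "\<phi> \<in> borel_measurable arc_length"
    unfolding \<phi>_def by (intro measurable_compose[OF measurable_cone_SUP]) measurable
  then have eq: "tent_norm \<mu> q f = Inf {z. AE \<xi> in arc_length. \<phi> \<xi> \<le> z}"
    unfolding tent_norm_def \<phi>_def by (rule esssup_eq_AE)
  show ?thesis
  proof (rule antisym)
    have "\<phi> \<xi> \<le> epow (tent_sup \<mu> q f) (1 / q)" for \<xi>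
      unfolding \<phi>_def tent_sup_def using assms cone_nonzero
      by (intro epow_mono SUP_subset_mono) auto
    then show "tent_norm \<mu> q f \<le> epow (tent_sup \<mu> q f) (1 / q)"
      unfolding eq by (intro Inf_lower) auto
    show "epow (tent_sup \<mu> q f) (1 / q) \<le> tent_norm \<mu> q f"
      unfolding eq
    proof (rule Inf_greatest, safe)
      fix z assume z: "AE \<xi> in arc_length. \<phi> \<xi> \<le> z"
      have "carleson_mean \<mu> q f a \<le> epow z q" if a: "a \<in> disk - {0}" for a
      proof -
        obtain \<xi> where \<xi>: "a \<in> cone \<xi>" "\<phi> \<xi> \<le> z" using AE_arc_length_cone[OF z, of a] a by auto
        have "carleson_mean \<mu> q f a \<le> (SUP a\<in>cone \<xi>. carleson_mean \<mu> q f a)" using \<xi> by (intro SUP_upper)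
        also have "\<dots> \<le> epow z q" using \<xi>(2) assms by (simp add: \<phi>_def epow_le_iff)
        finally show ?thesis .
      qed
      then show "epow (tent_sup \<mu> q f) (1 / q) \<le> z"
        using assms by (simp add: epow_le_iff tent_sup_def SUP_le_iff)
    qed
  qed
qed


section \<open>Quasi-triangle inequality and Fatou property of Carleson means\<close>

lemma borel_subset_disk:
  assumes "sets \<mu> = sets (restrict_space borel disk)" "A \<in> sets borel" "A \<subseteq> disk"
  shows "A \<in> sets \<mu>"
  unfolding assms(1) sets_restrict_space using assms(2,3) by (intro image_eqI[of _ _ A]) auto

lemma carleson_square_in_sets:
  assumes "sets \<mu> = sets (restrict_space borel disk)" "norm a < 1"
  shows "carleson_square a \<in> sets \<mu>"
  by (rule borel_subset_disk[OF assms(1) borel_carleson_square[OF assms(2)] carleson_square_subset])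

lemma space_eq_disk: "sets \<mu> = sets (restrict_space borel disk) \<Longrightarrow> space \<mu> = disk"
  using sets_eq_imp_space_eq[of \<mu> "restrict_space borel disk"] by (simp add: space_restrict_space)

lemma holomorphic_measurable:
  assumes "sets \<mu> = sets (restrict_space borel disk)" "f holomorphic_on disk"
  shows "f \<in> borel_measurable \<mu>"
  using borel_measurable_continuous_on_restrict[OF holomorphic_on_imp_continuous_on[OF assms(2)]]
  by (simp add: measurable_cong_sets[OF assms(1) refl])

text \<open>Passing to the completion and dividing under the integral makes additivity and Fatou
  available for all members of the tent space, not only for Borel functions.\<close>

lemma carleson_mean_completion:
  "carleson_mean \<mu> q f a
    = (\<integral>\<^sup>+z. ennreal (norm (f z) powr q) * indicator (carleson_square a) z / ennreal (1 - norm a) \<partial>completion \<mu>)"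
  if "sets \<mu> = sets (restrict_space borel disk)" "norm a < 1" "f \<in> borel_measurable (completion \<mu>)"
proof -
  have [measurable]: "carleson_square a \<in> sets (completion \<mu>)" "f \<in> borel_measurable (completion \<mu>)"
    using carleson_square_in_sets[of \<mu> a] that by auto
  show ?thesis
    unfolding carleson_mean_def by (subst nn_integral_divide) (auto simp: nn_integral_completion)
qed

text \<open>Bounding a sum by twice the maximum gives a constant that works for every
  \<open>q > 0\<close>, below and above \<open>1\<close> alike.\<close>

lemma carleson_mean_add:
  assumes \<mu>: "sets \<mu> = sets (restrict_space borel disk)" and a: "norm a < 1" and q: "q > 0"
    and [measurable]: "f \<in> borel_measurable (completion \<mu>)" "g \<in> borel_measurable (completion \<mu>)"
  shows "carleson_mean \<mu> q (\<lambda>z. f z + g z) a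
    \<le> ennreal (2 powr q) * (carleson_mean \<mu> q f a + carleson_mean \<mu> q g a)"
proof -
  have [measurable]: "carleson_square a \<in> sets (completion \<mu>)"
    using carleson_square_in_sets[of \<mu> a] \<mu> a by auto
  have pt: "ennreal (norm (x + y) powr q) \<le> ennreal (2 powr q) * (ennreal (norm x powr q) + ennreal (norm y powr q))"
    for x y :: complex
  proof -
    have "norm (x + y) powr q \<le> (2 * max (norm x) (norm y)) powr q"
      using norm_triangle_ineq[of x y] q by (intro powr_mono2) auto
    also have "\<dots> = 2 powr q * max (norm x) (norm y) powr q"
      by (rule powr_mult)
    also have "\<dots> \<le> 2 powr q * (norm x powr q + norm y powr q)"
      by (intro mult_left_mono) (auto simp: max_def)
    finally show ?thesis
      by (subst ennreal_plus[symmetric]) (auto simp: ennreal_mult[symmetric] simp del: ennreal_plus)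
  qed
  have "carleson_mean \<mu> q (\<lambda>z. f z + g z) a
    \<le> (\<integral>\<^sup>+z. ennreal (2 powr q) * (ennreal (norm (f z) powr q) * indicator (carleson_square a) z / ennreal (1 - norm a)
        + ennreal (norm (g z) powr q) * indicator (carleson_square a) z / ennreal (1 - norm a)) \<partial>completion \<mu>)"
    using \<mu> a pt
    by (subst carleson_mean_completion) (auto intro!: nn_integral_mono divide_right_mono_ennreal
        split: split_indicator simp: add_divide_distrib_ennreal[symmetric] ennreal_times_divide)
  also have "\<dots> = ennreal (2 powr q) * (carleson_mean \<mu> q f a + carleson_mean \<mu> q g a)"
    using \<mu> a by (simp add: nn_integral_cmult nn_integral_add carleson_mean_completion)
  finally show ?thesis .
qed

lemma tent_sup_add:
  assumes "sets \<mu> = sets (restrict_space borel disk)" "q > 0"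
    "f \<in> borel_measurable (completion \<mu>)" "g \<in> borel_measurable (completion \<mu>)"
  shows "tent_sup \<mu> q (\<lambda>z. f z + g z) \<le> ennreal (2 powr q) * (tent_sup \<mu> q f + tent_sup \<mu> q g)"
  unfolding tent_sup_def[of _ _ "\<lambda>z. f z + g z"]
proof (rule SUP_least)
  fix a :: complex assume a: "a \<in> disk - {0}"
  have "carleson_mean \<mu> q (\<lambda>z. f z + g z) a \<le> ennreal (2 powr q) * (carleson_mean \<mu> q f a + carleson_mean \<mu> q g a)"
    using assms a by (intro carleson_mean_add) auto
  also have "\<dots> \<le> ennreal (2 powr q) * (tent_sup \<mu> q f + tent_sup \<mu> q g)"
    unfolding tent_sup_def using a by (intro mult_left_mono add_mono SUP_upper) auto
  finally show "carleson_mean \<mu> q (\<lambda>z. f z + g z) a \<le> ennreal (2 powr q) * (tent_sup \<mu> q f + tent_sup \<mu> q g)" .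
qed

lemma tent_sup_minus: "tent_sup \<mu> q (\<lambda>z. - f z) = tent_sup \<mu> q f"
  by (simp add: tent_sup_def carleson_mean_def)

text \<open>In the constant, \<open>2 powr q\<close> comes from \<open>tent_sup_add\<close> and
  another factor \<open>2\<close> from replacing a sum by a maximum, which commutes with the
  \<open>q\<close>-th root.\<close>

lemma quasi_gauge_tent_norm:
  assumes \<mu>: "sets \<mu> = sets (restrict_space borel disk)" and q: "q > 0" and Y: "Y \<subseteq> borel_measurable (completion \<mu>)"
  shows "quasi_gauge Y (tent_norm \<mu> q) (2 powr ((q + 1) / q))"
proof
  have "tent_sup \<mu> q (\<lambda>_. 0) = 0"
    unfolding tent_sup_def by (rule antisym, rule SUP_least) (auto simp: carleson_mean_def)
  then show "tent_norm \<mu> q (\<lambda>_. 0) = 0"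
    using q by (simp add: tent_norm_eq)
  show "tent_norm \<mu> q (\<lambda>z. f z - g z) = tent_norm \<mu> q (\<lambda>z. g z - f z)" for f g
    using q tent_sup_minus[of \<mu> q "\<lambda>z. f z - g z"] by (simp add: tent_norm_eq)
  show "1 \<le> 2 powr ((q + 1) / q)" using q by (intro ge_one_powr_ge_zero) auto
  fix f g h assume fgh: "f \<in> Y" "g \<in> Y" "h \<in> Y"
  let ?A = "tent_sup \<mu> q (\<lambda>z. f z - g z)" and ?B = "tent_sup \<mu> q (\<lambda>z. g z - h z)"
  have [measurable]: "f \<in> borel_measurable (completion \<mu>)" "g \<in> borel_measurable (completion \<mu>)" "h \<in> borel_measurable (completion \<mu>)"
    using fgh Y by auto
  have "tent_sup \<mu> q (\<lambda>z. f z - h z) = tent_sup \<mu> q (\<lambda>z. (f z - g z) + (g z - h z))" by simp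
  also have "\<dots> \<le> ennreal (2 powr q) * (?A + ?B)" using \<mu> q by (intro tent_sup_add) auto
  also have "\<dots> \<le> ennreal (2 powr q) * (ennreal 2 * max ?A ?B)"
    by (intro mult_left_mono) (auto simp: mult_2 intro!: add_mono)
  also have "\<dots> = ennreal (2 powr (q + 1)) * max ?A ?B"
    by (simp add: powr_add ennreal_mult mult.assoc)
  finally have "tent_norm \<mu> q (\<lambda>z. f z - h z) \<le> epow (ennreal (2 powr (q + 1)) * max ?A ?B) (1 / q)"
    using q by (simp add: tent_norm_eq epow_mono)
  also have "\<dots> = ennreal (2 powr ((q + 1) / q)) * epow (max ?A ?B) (1 / q)"
    by (subst epow_cmult) (auto simp: powr_powr)
  also have "\<dots> \<le> ennreal (2 powr ((q + 1) / q)) * (epow ?A (1 / q) + epow ?B (1 / q))"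
    by (intro mult_left_mono) (auto simp: max_def)
  finally show "tent_norm \<mu> q (\<lambda>z. f z - h z) \<le> ennreal (2 powr ((q + 1) / q)) *
      (tent_norm \<mu> q (\<lambda>z. f z - g z) + tent_norm \<mu> q (\<lambda>z. g z - h z))"
    using q by (simp add: tent_norm_eq)
qed

text \<open>Lower semicontinuity under pointwise convergence. It identifies norm limits with
  pointwise ones here, and later keeps locally uniform limits inside the tent space.\<close>

lemma carleson_mean_fatou:
  assumes \<mu>: "sets \<mu> = sets (restrict_space borel disk)" and q: "q > 0" and a: "norm a < 1"
    and [measurable]: "\<And>n. x n \<in> borel_measurable (completion \<mu>)" "y \<in> borel_measurable (completion \<mu>)"
    and lim: "\<And>z. z \<in> disk \<Longrightarrow> (\<lambda>n. x n z) \<longlonglongrightarrow> y z"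
    and b: "\<And>n. carleson_mean \<mu> q (x n) a \<le> b n" "b \<longlonglongrightarrow> B"
  shows "carleson_mean \<mu> q y a \<le> B"
proof -
  have [measurable]: "carleson_square a \<in> sets (completion \<mu>)"
    using carleson_square_in_sets[of \<mu> a] \<mu> a by auto
  define F where "F f z = ennreal (norm (f z) powr q) * indicator (carleson_square a) z / ennreal (1 - norm a)"
    for f :: "complex \<Rightarrow> complex" and z
  have Fm [measurable]: "F (x n) \<in> borel_measurable (completion \<mu>)" for n unfolding F_def by measurable
  have "carleson_mean \<mu> q y a = (\<integral>\<^sup>+z. F y z \<partial>completion \<mu>)"
    unfolding F_def using \<mu> a by (intro carleson_mean_completion) auto
  also have "\<dots> = (\<integral>\<^sup>+z. liminf (\<lambda>n. F (x n) z) \<partial>completion \<mu>)"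
  proof (rule nn_integral_cong)
    fix z assume "z \<in> space (completion \<mu>)"
    then have "z \<in> disk" using space_eq_disk[OF \<mu>] by simp
    then have "(\<lambda>n. ennreal (norm (x n z) powr q)) \<longlonglongrightarrow> ennreal (norm (y z) powr q)"
      using q by (intro tendsto_ennrealI tendsto_powr2 tendsto_norm lim tendsto_const) auto
    then have "(\<lambda>n. F (x n) z) \<longlonglongrightarrow> F y z"
      unfolding F_def divide_ennreal_def using a
      by (intro tendsto_mult_ennreal tendsto_const) (auto simp: indicator_def)
    then show "F y z = liminf (\<lambda>n. F (x n) z)" by (intro lim_imp_Liminf[symmetric]) auto
  qed
  also have "\<dots> \<le> liminf (\<lambda>n. \<integral>\<^sup>+z. F (x n) z \<partial>completion \<mu>)"
    by (rule nn_integral_liminf) measurable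
  also have "\<dots> = liminf (\<lambda>n. carleson_mean \<mu> q (x n) a)"
    unfolding F_def using \<mu> a by (subst carleson_mean_completion) auto
  also have "\<dots> \<le> liminf b" using b(1) by (intro Liminf_mono) auto
  also have "\<dots> = B" using b(2) by (intro lim_imp_Liminf) auto
  finally show ?thesis .
qed

text \<open>Compactness yields a gauge limit \<open>g\<close> of a subsequence. Pointwise
  convergence to zero cannot show \<open>g = 0\<close>, but it shows that \<open>g\<close> has gauge
  zero, which is enough.\<close>

lemma compact_embedding_null:
  assumes ce: "compact_embedding X NX Y (tent_norm \<mu> q)"
    and \<mu>: "sets \<mu> = sets (restrict_space borel disk)" and q: "q > 0" and Y: "Y \<subseteq> borel_measurable (completion \<mu>)"
    and x: "\<And>n. x n \<in> X" "\<And>n. NX (x n) \<le> M" "M < \<infinity>"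
    and lim: "\<And>z. z \<in> disk \<Longrightarrow> (\<lambda>n. x n z) \<longlonglongrightarrow> 0"
  shows "\<exists>r. strict_mono (r :: nat \<Rightarrow> nat) \<and> (\<lambda>n. tent_sup \<mu> q (x (r n))) \<longlonglongrightarrow> 0"
proof -
  interpret quasi_gauge Y "tent_norm \<mu> q" "2 powr ((q + 1) / q)"
    by (rule quasi_gauge_tent_norm[OF \<mu> q Y])
  have XY: "X \<subseteq> Y" using ce by (simp add: compact_embedding_def)
  have "range x \<subseteq> X" "\<exists>M<\<infinity>. \<forall>f\<in>range x. NX f \<le> M" using x by auto
  then have "compactin T (T closure_of (range x))"
    using ce unfolding compact_embedding_def by blast
  moreover have "x n \<in> T closure_of (range x)" for n
    using closure_of_subset[of "range x" T] x XY by (auto simp: topspace_qnorm_topology)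
  ultimately obtain g r where g: "g \<in> T closure_of (range x)" "strict_mono (r::nat\<Rightarrow>nat)"
      "(\<lambda>n. D (x (r n)) g) \<longlonglongrightarrow> 0"
    by (rule compactin_imp_seq)
  then have gY: "g \<in> Y"
    using closure_of_subset_topspace[of T "range x"] by (auto simp: topspace_qnorm_topology)
  have [measurable]: "g \<in> borel_measurable (completion \<mu>)" "x n \<in> borel_measurable (completion \<mu>)" for n
    using gY Y XY x(1) by auto
  define b where "b n = tent_sup \<mu> q (\<lambda>z. x (r n) z - g z)" for n
  have b: "b \<longlonglongrightarrow> 0"
    using g(3) q epow_tendsto_0[of "1 / q" b] by (simp add: tent_norm_eq b_def[symmetric])
  \<comment> \<open>The differences \<open>x (r n) - g\<close> tend to \<open>- g\<close> pointwise
    while their gauge tends to zero, so Fatou applies to them.\<close>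
  have "tent_sup \<mu> q (\<lambda>z. - g z) = 0"
    unfolding tent_sup_def
  proof (rule SUP_eq_const)
    have "(1/2 :: complex) \<in> disk - {0}" by simp
    then show "disk - {0::complex} \<noteq> {}" by blast
    fix a :: complex assume a: "a \<in> disk - {0}"
    have "carleson_mean \<mu> q (\<lambda>z. - g z) a \<le> 0"
    proof (rule carleson_mean_fatou[OF \<mu> q, where x = "\<lambda>n z. x (r n) z - g z" and b = b])
      show "carleson_mean \<mu> q (\<lambda>z. x (r n) z - g z) a \<le> b n" for n
        unfolding b_def tent_sup_def using a by (intro SUP_upper)
      show "(\<lambda>n. x (r n) z - g z) \<longlonglongrightarrow> - g z" if "z \<in> disk" for z
        using tendsto_diff[OF LIMSEQ_subseq_LIMSEQ[OF lim[OF that] g(2)] tendsto_const[of "g z"]] by (simp add: o_def)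
    qed (use a b in auto)
    then show "carleson_mean \<mu> q (\<lambda>z. - g z) a = 0" by simp
  qed
  then have g0: "tent_sup \<mu> q g = 0" by (simp add: tent_sup_minus)
  have "tent_sup \<mu> q (x (r n)) \<le> ennreal (2 powr q) * b n" for n
    using tent_sup_add[OF \<mu> q, of "\<lambda>z. x (r n) z - g z" g] by (simp add: g0 b_def)
  moreover have "(\<lambda>n. ennreal (2 powr q) * b n) \<longlonglongrightarrow> 0"
    using ennreal_tendsto_cmult[OF _ b, of "ennreal (2 powr q)"] by simp
  ultimately have "(\<lambda>n. tent_sup \<mu> q (x (r n))) \<longlonglongrightarrow> 0"
    using tendsto_sandwich[of "\<lambda>_. 0" "\<lambda>n. tent_sup \<mu> q (x (r n))" sequentially "\<lambda>n. ennreal (2 powr q) * b n" 0] by simp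
  then show ?thesis using g(2) by blast
qed


section \<open>Carleson squares and circular neighbourhoods\<close>

lemma half_le_sin: "0 \<le> x \<Longrightarrow> x \<le> pi / 2 \<Longrightarrow> x / 2 \<le> sin x"
proof -
  assume x: "0 \<le> x" "x \<le> pi / 2"
  have "\<bar>sin x - (\<Sum>m<3. sin_coeff m * x ^ m)\<bar> \<le> inverse (fact 3) * \<bar>x\<bar> ^ 3"
    by (rule Maclaurin_sin_bound)
  then have "\<bar>sin x - x\<bar> \<le> x ^ 3 / 6"
    using x by (simp add: sin_coeff_def numeral_eq_Suc fact_reduce)
  then have "x - sin x \<le> x ^ 3 / 6" by linarith
  moreover have "x ^ 3 / 6 \<le> x / 2"
  proof -
    have "x \<le> 1.6" using x pi_approx by simp
    then have "x * x \<le> 1.6 * 1.6" using x by (intro mult_mono) auto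
    then have "x * (x * x) \<le> x * 3" using x by (intro mult_left_mono) auto
    then show ?thesis by (simp add: power3_eq_cube mult.assoc)
  qed
  ultimately show ?thesis by simp
qed

lemma norm_cis_minus_1: "norm (cis t - 1) = 2 * \<bar>sin (t/2)\<bar>"
proof -
  have "cis t - 1 = cis (t/2) * (cis (t/2) - cis (- t/2))"
    by (simp add: algebra_simps cis_mult)
  also have "cis (t/2) - cis (- t/2) = 2 * \<i> * of_real (sin (t/2))"
    by (simp add: complex_eq_iff)
  finally show ?thesis by (simp add: norm_mult)
qed

lemma norm_cis_minus_1_upper: "norm (cis t - 1) \<le> \<bar>t\<bar>"
  using abs_sin_x_le_abs_x[of "t/2"] by (simp add: norm_cis_minus_1)

lemma norm_cis_minus_1_lower:
  assumes "\<bar>t\<bar> \<le> pi"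
  shows "\<bar>t\<bar> / 2 \<le> norm (cis t - 1)"
proof -
  have "\<bar>sin (t/2)\<bar> = sin (\<bar>t\<bar>/2)"
    using assms sin_ge_zero[of "t/2"] sin_ge_zero[of "- t/2"] by (cases "t \<ge> 0") auto
  then show ?thesis using half_le_sin[of "\<bar>t\<bar>/2"] assms by (simp add: norm_cis_minus_1)
qed

lemma carleson_squareI:
  "b \<noteq> 0 \<Longrightarrow> norm b \<le> \<rho> \<Longrightarrow> \<rho> < 1 \<Longrightarrow> \<bar>t - Arg b\<bar> \<le> (1 - norm b) / 2 \<Longrightarrow> of_real \<rho> * cis t \<in> carleson_square b"
  by (auto simp: carleson_square_def)

text \<open>Radial projection to the circle, the centre of the balls that replace Carleson squares.
  Any unit vector would do at the origin; \<open>norm_apex_diff\<close> then holds there as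
  well.\<close>

definition apex :: "complex \<Rightarrow> complex" where
  "apex a = (if a = 0 then 1 else sgn a)"

lemma norm_apex [simp]: "norm (apex a) = 1"
  by (simp add: apex_def norm_sgn)

lemma norm_apex_diff: "norm a < 1 \<Longrightarrow> norm (apex a - a) = 1 - norm a"
proof (cases "a = 0")
  case False
  assume "norm a < 1"
  have "apex a - a = sgn a * of_real (1 - norm a)"
    using False by (simp add: apex_def sgn_eq field_simps)
  then have "norm (apex a - a) = \<bar>1 - norm a\<bar>"
    using False norm_of_real[of "1 - norm a", where 'a = complex] by (simp add: norm_mult norm_sgn)
  then show ?thesis using \<open>norm a < 1\<close> by simp
qed (simp add: apex_def)

lemma norm_one_minus_cnj_commute: "norm (1 - cnj a * z) = norm (1 - cnj z * a)"
  by (metis complex_cnj_cnj complex_cnj_diff complex_cnj_mult complex_cnj_one complex_mod_cnj mult.commute)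

lemma one_minus_norm_le: "norm z \<le> 1 \<Longrightarrow> 1 - norm a \<le> norm (1 - cnj a * z)"
proof -
  assume z: "norm z \<le> 1"
  have "norm (cnj a * z) \<le> norm a * 1" unfolding norm_mult complex_mod_cnj using z by (intro mult_left_mono) auto
  then show ?thesis using norm_triangle_ineq2[of 1 "cnj a * z"] by simp
qed

lemma one_minus_cnj_pos: "norm z \<le> 1 \<Longrightarrow> norm a < 1 \<Longrightarrow> 0 < norm (1 - cnj a * z)"
  by (rule less_le_trans[OF _ one_minus_norm_le]) auto

lemma norm_one_minus_cnj_le:
  assumes "norm a < 1"
  shows "norm (1 - cnj a * z) \<le> 2 * (1 - norm a) + norm (a - z)"
proof -
  have "1 - cnj a * z = of_real (1 - (norm a)\<^sup>2) + cnj a * (a - z)"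
    using complex_norm_square[of a] by (simp add: algebra_simps)
  then have "norm (1 - cnj a * z) \<le> norm (of_real (1 - (norm a)\<^sup>2) :: complex) + norm (cnj a * (a - z))"
    by (metis norm_triangle_ineq)
  also have "norm (of_real (1 - (norm a)\<^sup>2) :: complex) = (1 - norm a) * (1 + norm a)"
    unfolding norm_of_real using assms by (simp add: power2_eq_square algebra_simps abs_of_nonneg mult_le_one)
  also have "\<dots> \<le> (1 - norm a) * 2" using assms by (intro mult_left_mono) auto
  also have "norm (cnj a * (a - z)) \<le> 1 * norm (a - z)"
    using assms by (simp add: norm_mult mult_left_le_one_le)
  finally show ?thesis by simp
qed

lemma apex_mult_cnj: "norm z \<le> 1 \<Longrightarrow> norm a < 1 \<Longrightarrow> norm (z - apex a) \<le> 2 * norm (1 - cnj a * z)"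
proof -
  assume z: "norm z \<le> 1" and a: "norm a < 1"
  have "norm (z - apex a) = norm (1 - cnj (apex a) * z)"
    using norm_one_minus_cnj_mult_sphere[of "apex a" z]
    by (simp add: norm_minus_commute norm_one_minus_cnj_commute)
  also have "1 - cnj (apex a) * z = (1 - cnj a * z) - cnj (apex a - a) * z" by (simp add: algebra_simps)
  also have "norm \<dots> \<le> norm (1 - cnj a * z) + norm (cnj (apex a - a) * z)" by (rule norm_triangle_ineq4)
  also have "norm (cnj (apex a - a) * z) \<le> (1 - norm a) * 1"
    unfolding norm_mult complex_mod_cnj norm_apex_diff[OF a] using z a by (intro mult_left_mono) auto
  also have "1 - norm a \<le> norm (1 - cnj a * z)" by (rule one_minus_norm_le[OF z])
  finally show ?thesis by simp
qed

text \<open>By \<open>apex_mult_cnj\<close> the quotient decays like the inverse distance from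
  \<open>apex a\<close>, so on the \<open>k\<close>-th dyadic shell it is at most \<open>2\<close>
  to the power \<open>- k\<close>.\<close>

lemma nn_integral_dyadic:
  assumes \<nu>: "sets \<nu> = sets (restrict_space borel disk)" and a: "norm a < 1" and s: "s \<ge> 0"
  shows "(\<integral>\<^sup>+z. ennreal (((1 - norm a) / norm (1 - cnj a * z)) powr s) \<partial>\<nu>)
    \<le> (\<Sum>k. ennreal ((1 / 2 powr s) ^ k) * emeasure \<nu> (disk \<inter> ball (apex a) (2 ^ (k + 2) * (1 - norm a))))"
proof -
  let ?h = "1 - norm a"
  have sp: "space \<nu> = disk" using sets_eq_imp_space_eq[OF \<nu>] by (simp add: space_restrict_space)
  have B[measurable]: "disk \<inter> ball c r \<in> sets \<nu>" for c r
    unfolding \<nu> by (auto simp: sets_restrict_space)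
  define G where "G k z = ennreal ((1 / 2 powr s) ^ k) * indicator (disk \<inter> ball (apex a) (2 ^ (k + 2) * ?h)) z"
    for k z
  have "ennreal ((?h / norm (1 - cnj a * z)) powr s) \<le> (\<Sum>k. G k z)"
    if z: "z \<in> disk" for z
  proof -
    have h: "?h > 0" using a by simp
    have "\<exists>k. norm (z - apex a) < 2 ^ (k + 2) * ?h"
    proof -
      obtain k where "norm (z - apex a) / ?h < 2 ^ k" using real_arch_pow[of 2 "norm (z - apex a) / ?h"] by auto
      then have "norm (z - apex a) < 2 ^ k * ?h" using h by (simp add: divide_less_eq)
      also have "\<dots> \<le> 2 ^ (k + 2) * ?h" using h by (intro mult_right_mono power_increasing) auto
      finally show ?thesis by blast
    qed
    \<comment> \<open>The least such \<open>k\<close>: failure of the bound for \<open>k - 1\<close>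
      bounds the distance from below, and the offset \<open>2\<close> in the radius absorbs the
      factor \<open>2\<close> of \<open>apex_mult_cnj\<close>.\<close>
    then obtain k where k: "norm (z - apex a) < 2 ^ (k + 2) * ?h"
        "\<And>j. j < k \<Longrightarrow> \<not> norm (z - apex a) < 2 ^ (j + 2) * ?h"
      using exists_least_iff[of "\<lambda>k. norm (z - apex a) < 2 ^ (k + 2) * ?h"] by blast
    have "(?h / norm (1 - cnj a * z)) \<le> (1 / 2) ^ k"
    proof (cases k)
      case 0
      have "?h \<le> norm (1 - cnj a * z)" using one_minus_norm_le[of z a] z by simp
      then show ?thesis using 0 h by (simp add: divide_le_eq)
    next
      case (Suc j)
      then have "2 ^ (k + 1) * ?h \<le> norm (z - apex a)" using k(2)[of j] by simp
      also have "\<dots> \<le> 2 * norm (1 - cnj a * z)" using apex_mult_cnj[of z a] z a by simp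
      finally have "2 ^ k * ?h \<le> norm (1 - cnj a * z)" by simp
      moreover have "norm (1 - cnj a * z) > 0" using one_minus_cnj_pos[of z a] z a by simp
      ultimately show ?thesis by (simp add: field_simps power_divide)
    qed
    then have "(?h / norm (1 - cnj a * z)) powr s \<le> ((1 / 2) ^ k) powr s"
      using s h by (intro powr_mono2) auto
    also have "\<dots> = (1 / 2 powr s) ^ k"
      by (simp add: powr_realpow[symmetric] powr_powr powr_divide mult.commute power_divide)
    finally have "ennreal ((?h / norm (1 - cnj a * z)) powr s)
      \<le> G k z"
      using k(1) z by (simp add: G_def dist_norm norm_minus_commute ennreal_leI)
    also have "\<dots> \<le> (\<Sum>k. G k z)"
      using sum_le_suminf[of "\<lambda>k. G k z" "{k}"] by simp
    finally show ?thesis .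
  qed
  then have "(\<integral>\<^sup>+z. ennreal ((?h / norm (1 - cnj a * z)) powr s) \<partial>\<nu>)
      \<le> (\<integral>\<^sup>+z. (\<Sum>k. G k z) \<partial>\<nu>)"
    using sp by (intro nn_integral_mono) auto
  also have "\<dots> = (\<Sum>k. ennreal ((1 / 2 powr s) ^ k) * emeasure \<nu> (disk \<inter> ball (apex a) (2 ^ (k + 2) * ?h)))"
    unfolding G_def by (subst nn_integral_suminf) (auto simp: nn_integral_cmult_indicator)
  finally show ?thesis .
qed

text \<open>The condition \<open>2 * B \<le> 2 powr s\<close> makes the ratio of the series at most
  \<open>1 / 2\<close>, so its sum is at most \<open>2\<close>; \<open>B\<^sup>2\<close> is the
  price of the offset \<open>k + 2\<close>.\<close>

lemma nn_integral_dyadic_geometric: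
  assumes \<nu>: "sets \<nu> = sets (restrict_space borel disk)" and a: "norm a < 1" and s: "s \<ge> 0"
    and A: "\<And>k. emeasure \<nu> (disk \<inter> ball (apex a) (2 ^ k * (1 - norm a))) \<le> A * ennreal (B ^ k)"
    and B: "B \<ge> 0" "2 * B \<le> 2 powr s"
  shows "(\<integral>\<^sup>+z. ennreal (((1 - norm a) / norm (1 - cnj a * z)) powr s) \<partial>\<nu>) \<le> A * ennreal (2 * B\<^sup>2)"
proof -
  let ?x = "B / 2 powr s"
  have x: "0 \<le> ?x" "?x \<le> 1 / 2" using B by (auto simp: field_simps)
  have "(\<integral>\<^sup>+z. ennreal (((1 - norm a) / norm (1 - cnj a * z)) powr s) \<partial>\<nu>)
      \<le> (\<Sum>k. ennreal ((1 / 2 powr s) ^ k) * emeasure \<nu> (disk \<inter> ball (apex a) (2 ^ (k + 2) * (1 - norm a))))"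
    by (rule nn_integral_dyadic[OF \<nu> a s])
  also have "\<dots> \<le> (\<Sum>k. ennreal ((1 / 2 powr s) ^ k) * (A * ennreal (B ^ (k + 2))))"
    by (intro suminf_le mult_left_mono A) auto
  also have "\<dots> = (\<Sum>k. A * ennreal (B\<^sup>2) * ennreal (?x ^ k))"
  proof (rule suminf_cong)
    fix k
    have "(1 / 2 powr s) ^ k * B ^ (k + 2) = B\<^sup>2 * ?x ^ k"
      by (simp add: power_divide power_add) (simp add: power2_eq_square)
    then have "ennreal ((1 / 2 powr s) ^ k) * ennreal (B ^ (k + 2)) = ennreal (B\<^sup>2) * ennreal (?x ^ k)"
      using B(1) by (subst (1 2) ennreal_mult[symmetric]) auto
    then show "ennreal ((1 / 2 powr s) ^ k) * (A * ennreal (B ^ (k + 2))) = A * ennreal (B\<^sup>2) * ennreal (?x ^ k)"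
      by (metis mult.assoc mult.commute)
  qed
  also have "\<dots> = A * ennreal (B\<^sup>2) * ennreal (1 / (1 - ?x))"
  proof -
    have "(\<Sum>k. ennreal (?x ^ k)) = ennreal (1 / (1 - ?x))"
    proof (intro suminf_ennreal_eq geometric_sums zero_le_power x(1))
      show "norm ?x < 1" using x unfolding real_norm_def by linarith
    qed
    then show ?thesis by (subst ennreal_suminf_cmult) simp
  qed
  also have "\<dots> \<le> A * ennreal (B\<^sup>2) * ennreal 2"
    using frac_le[of 1 1 "1 / 2" "1 - ?x"] x by (intro mult_left_mono ennreal_leI) simp_all
  also have "\<dots> = A * ennreal (2 * B\<^sup>2)"
    by (simp add: ennreal_mult' mult_ac)
  finally show ?thesis .
qed

text \<open>The radial defect is at most \<open>1 - norm b\<close> and the angular one at most half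
  of that.\<close>

lemma carleson_square_subset_ball:
  assumes "b \<noteq> 0" "norm b < 1"
  shows "carleson_square b \<subseteq> disk \<inter> ball (apex b) (2 * (1 - norm b))"
proof
  fix z assume "z \<in> carleson_square b"
  then obtain \<rho> t where z: "z = of_real \<rho> * cis t" "norm b \<le> \<rho>" "\<rho> < 1" "\<bar>t - Arg b\<bar> \<le> (1 - norm b) / 2"
    using assms by (auto simp: carleson_square_def)
  have \<rho>: "\<rho> \<ge> 0" using z norm_ge_zero[of b] by linarith
  have ap: "apex b = cis (Arg b)" using assms by (simp add: apex_def cis_Arg)
  have "z - apex b = of_real (\<rho> - 1) * cis t + cis (Arg b) * (cis (t - Arg b) - 1)"
    by (simp add: z ap algebra_simps cis_mult)
  then have "norm (z - apex b) \<le> norm (of_real (\<rho> - 1) * cis t) + norm (cis (Arg b) * (cis (t - Arg b) - 1))"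
    by (metis norm_triangle_ineq)
  also have "\<dots> \<le> \<bar>\<rho> - 1\<bar> + \<bar>t - Arg b\<bar>"
    using norm_cis_minus_1_upper[of "t - Arg b"] norm_of_real[of "\<rho> - 1", where 'a = complex] by (simp add: norm_mult)
  also have "\<dots> < 2 * (1 - norm b)" using z assms by auto
  finally show "z \<in> disk \<inter> ball (apex b) (2 * (1 - norm b))"
    using z \<rho> by (auto simp: dist_norm norm_minus_commute norm_mult)
qed

text \<open>A small ball fits into one square, whereas a large one is covered by \<open>13\<close>
  sectors of mass at most \<open>A\<close>, and \<open>13 \<le> 104 * h\<close> once
  \<open>h \<ge> 1 / 8\<close>. The origin is removed because no square with nonzero apex contains
  it.\<close>

lemma emeasure_ball_le:
  assumes \<nu>: "sets \<nu> = sets (restrict_space borel disk)"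
    and sq: "\<And>b. b \<in> disk - {0} \<Longrightarrow> emeasure \<nu> (carleson_square b) \<le> A * ennreal (1 - norm b)"
    and S: "\<And>b. b \<in> disk - {0} \<Longrightarrow> carleson_square b \<in> sets \<nu>"
    and \<zeta>: "norm \<zeta> = 1" and h: "h > 0"
  shows "emeasure \<nu> (disk \<inter> ball \<zeta> h - {0}) \<le> A * ennreal (104 * h)"
proof (cases "h < 1 / 8")
  case True
  \<comment> \<open>At height \<open>8 * h\<close> the angular half-width is \<open>4 * h\<close>,
    exactly the bound obtained for \<open>\<tau>\<close> from a chord shorter than
    \<open>2 * h\<close>.\<close>
  define b where "b = of_real (1 - 8 * h) * \<zeta>"
  have nb: "norm b = 1 - 8 * h" using True h \<zeta> by (simp add: b_def norm_mult del: of_real_diff)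
  have bd: "b \<in> disk - {0}" using nb True h by (auto simp del: norm_eq_zero simp flip: norm_le_zero_iff)
  have Ab: "cis (Arg b) = \<zeta>"
    using True nb bd by (simp add: cis_Arg sgn_eq) (simp add: b_def)
  have "disk \<inter> ball \<zeta> h - {0} \<subseteq> carleson_square b"
  proof
    fix z assume z: "z \<in> disk \<inter> ball \<zeta> h - {0}"
    define \<tau> where "\<tau> = Arg (z / \<zeta>)"
    have \<zeta>0: "\<zeta> \<noteq> 0" using \<zeta> by auto
    have zn: "1 - h < norm z" using norm_triangle_ineq2[of \<zeta> z] z \<zeta> by (auto simp: dist_norm)
    have "z / \<zeta> = of_real (norm z) * cis \<tau>"
      unfolding \<tau>_def using rcis_cmod_Arg[of "z / \<zeta>"] \<zeta> by (simp add: rcis_def norm_divide)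
    then have zeq: "z = of_real (norm z) * cis \<tau> * \<zeta>" using \<zeta>0 by (simp add: field_simps)
    have "\<zeta> * (cis \<tau> - 1) = (z - \<zeta>) + of_real (1 - norm z) * (cis \<tau> * \<zeta>)"
      by (subst (1) zeq) (simp add: algebra_simps)
    then have "norm (\<zeta> * (cis \<tau> - 1)) \<le> norm (z - \<zeta>) + norm (of_real (1 - norm z) * (cis \<tau> * \<zeta>))"
      by (metis norm_triangle_ineq)
    also have "\<dots> < h + h"
      using z zn \<zeta> norm_of_real[of "1 - norm z", where 'a = complex]
      by (intro add_strict_mono) (auto simp: dist_norm norm_minus_commute norm_mult)
    finally have "norm (cis \<tau> - 1) < 2 * h" using \<zeta> by (simp add: norm_mult)
    moreover have "\<bar>\<tau>\<bar> \<le> pi" unfolding \<tau>_def using Arg_bounded[of "z / \<zeta>"] by auto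
    ultimately have "\<bar>\<tau>\<bar> < 4 * h" using norm_cis_minus_1_lower[of \<tau>] by linarith
    moreover have "z = of_real (norm z) * cis (Arg b + \<tau>)"
      using zeq Ab by (simp add: cis_mult[symmetric] mult_ac)
    ultimately show "z \<in> carleson_square b"
      using carleson_squareI[of b "norm z" "Arg b + \<tau>"] bd nb zn z h by auto
  qed
  then have "emeasure \<nu> (disk \<inter> ball \<zeta> h - {0}) \<le> emeasure \<nu> (carleson_square b)"
    using S bd by (intro emeasure_mono) auto
  also have "\<dots> \<le> A * ennreal (1 - norm b)" using sq bd by auto
  also have "\<dots> \<le> A * ennreal (104 * h)" using nb h by (intro mult_left_mono ennreal_leI) auto
  finally show ?thesis .
next
  case False
  \<comment> \<open>Directions \<open>j / 2\<close> with half-width at least \<open>1 / 4\<close>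
    cover all arguments when \<open>j\<close> runs over the roundings of \<open>2 * Arg z\<close>,
    which lie between \<open>-6\<close> and \<open>6\<close>. As \<open>n\<close> grows the apex
    slides to the origin along a fixed ray, so the squares increase to a punctured sector.\<close>
  define b where "b j n = of_real (1 / (real n + 2)) * cis (of_int j / 2)" for j :: int and n :: nat
  have nb: "norm (b j n) = 1 / (real n + 2)" for j n by (simp only: b_def norm_mult norm_of_real norm_cis) simp
  have bd: "b j n \<in> disk - {0}" for j n
  proof -
    have "b j n \<noteq> 0" using nb[of j n] by (metis norm_zero zero_neq_one divide_eq_0_iff of_nat_0_le_iff add_nonneg_eq_0_iff zero_le_numeral zero_neq_numeral)
    moreover have "norm (b j n) < 1" unfolding nb by simp
    ultimately show ?thesis by simp
  qed
  have Argb: "Arg (b j n) = of_int j / 2" if "j \<in> {-6..6}" for j n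
  proof -
    have "real_of_int j \<ge> -6" "real_of_int j \<le> 6" using that by auto
    then have "Arg (cis (of_int j / 2)) = of_int j / 2"
      using pi_gt3 by (intro cis_Arg_unique) (auto simp: sgn_eq)
    then show ?thesis by (simp add: b_def Arg_times_of_real del: of_real_divide)
  qed
  define E where "E j = (\<Union>n. carleson_square (b j n))" for j
  have E: "emeasure \<nu> (E j) \<le> A" if j: "j \<in> {-6..6}" for j
  proof -
    have "incseq (\<lambda>n. carleson_square (b j n))"
    proof (rule incseq_SucI, rule subsetI)
      fix n z assume "z \<in> carleson_square (b j n)"
      then obtain \<rho> t where z: "z = of_real \<rho> * cis t" "norm (b j n) \<le> \<rho>" "\<rho> < 1"
          "\<bar>t - Arg (b j n)\<bar> \<le> (1 - norm (b j n)) / 2"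
        using bd[of j n] by (auto simp: carleson_square_def)
      have le: "norm (b j (Suc n)) \<le> norm (b j n)" unfolding nb by (simp add: frac_le)
      have "Arg (b j (Suc n)) = Arg (b j n)" by (simp only: Argb[OF j])
      moreover have "(1 - norm (b j n)) / 2 \<le> (1 - norm (b j (Suc n))) / 2" using le by simp
      ultimately have "\<bar>t - Arg (b j (Suc n))\<bar> \<le> (1 - norm (b j (Suc n))) / 2" using z(4) by (metis order_trans)
      then show "z \<in> carleson_square (b j (Suc n))"
        using bd[of j "Suc n"] z(2,3) le unfolding z(1) by (intro carleson_squareI) simp_all
    qed
    then have "emeasure \<nu> (E j) = (SUP n. emeasure \<nu> (carleson_square (b j n)))"
      unfolding E_def using S bd by (intro SUP_emeasure_incseq[symmetric]) auto
    also have "\<dots> \<le> A"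
    proof (rule SUP_least)
      fix n
      have "emeasure \<nu> (carleson_square (b j n)) \<le> A * ennreal (1 - norm (b j n))" using sq bd by auto
      also have "\<dots> \<le> A * ennreal 1" by (intro mult_left_mono ennreal_leI) auto
      finally show "emeasure \<nu> (carleson_square (b j n)) \<le> A" by simp
    qed
    finally show ?thesis .
  qed
  have "disk \<inter> ball \<zeta> h - {0} \<subseteq> (\<Union>j\<in>{-6..6}. E j)"
  proof
    fix z assume z: "z \<in> disk \<inter> ball \<zeta> h - {0}"
    define j where "j = round (2 * Arg z)"
    have "\<bar>of_int j - 2 * Arg z\<bar> \<le> 1 / 2" unfolding j_def by (rule of_int_round_abs_le)
    then have j1: "\<bar>Arg z - of_int j / 2\<bar> \<le> 1 / 4" by (simp add: abs_if split: if_splits)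
    have "\<bar>Arg z\<bar> \<le> pi" using Arg_bounded[of z] by auto
    moreover have "pi \<le> 3.2" using pi_approx by simp
    ultimately have "\<bar>of_int j\<bar> < (7::real)" using j1 by linarith
    then have j: "j \<in> {-6..6}" by auto
    obtain n where "inverse (real (Suc n)) < norm z" using reals_Archimedean[of "norm z"] z by auto
    moreover have "norm (b j n) \<le> inverse (real (Suc n))" unfolding nb by (simp add: inverse_eq_divide frac_le)
    moreover have "1 / 4 \<le> (1 - norm (b j n)) / 2" unfolding nb by (simp add: field_simps)
    ultimately have "z \<in> carleson_square (b j n)"
      using carleson_squareI[of "b j n" "norm z" "Arg z"] bd[of j n] z j1 Argb[OF j, of n] rcis_cmod_Arg[of z]
      by (auto simp: rcis_def)
    then show "z \<in> (\<Union>j\<in>{-6..6}. E j)" using j by (auto simp: E_def)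
  qed
  then have "emeasure \<nu> (disk \<inter> ball \<zeta> h - {0}) \<le> emeasure \<nu> (\<Union>j\<in>{-6..6}. E j)"
    using S bd by (intro emeasure_mono) (auto simp: E_def)
  also have "\<dots> \<le> (\<Sum>j\<in>{-6..6}. emeasure \<nu> (E j))"
    using S bd by (intro emeasure_subadditive_finite) (auto simp: E_def)
  also have "\<dots> \<le> (\<Sum>j\<in>{-6..6::int}. A)" using E by (intro sum_mono)
  also have "\<dots> = A * ennreal 13" by (simp add: mult.commute)
  also have "\<dots> \<le> A * ennreal (104 * h)" using False by (intro mult_left_mono ennreal_leI) auto
  finally show ?thesis .
qed


section \<open>Radial weights\<close>

lemma radial_null_set:
  assumes [measurable]: "N \<in> sets borel" and "emeasure lborel N = 0"
  shows "emeasure lborel {z :: complex. norm z \<in> N} = 0"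
proof -
  have "AE \<rho> in lborel. \<rho> \<notin> N" using assms by (intro AE_not_in) (auto simp: null_sets_def)
  then have 0: "(\<integral>\<^sup>+\<rho>\<in>{0<..}. ennreal \<rho> * indicator N \<rho> \<partial>lborel) = 0"
    by (subst nn_integral_0_iff_AE) auto
  have "emeasure lborel {z :: complex. norm z \<in> N} = (\<integral>\<^sup>+z. indicator {z :: complex. norm z \<in> N} z \<partial>lborel)"
    by simp
  also have "\<dots> = (\<integral>\<^sup>+z. indicator N (norm z) \<partial>(lborel :: complex measure))"
    by (intro nn_integral_cong) (simp add: indicator_def)
  also have "\<dots> = (\<integral>\<^sup>+t\<in>{0..<2*pi}. (\<integral>\<^sup>+\<rho>\<in>{0<..}. ennreal \<rho> * indicator N \<rho> \<partial>lborel) \<partial>lborel)"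
    by (subst nn_integral_polar) (auto intro!: nn_integral_cong simp: norm_mult indicator_def)
  also have "\<dots> = 0" unfolding 0 by simp
  finally show ?thesis .
qed

lemma AE_imp_ex_interval:
  assumes "AE t in lborel. P t" "a < (b::real)"
  shows "\<exists>t. a < t \<and> t < b \<and> P t"
proof (rule ccontr)
  assume "\<not> ?thesis"
  then have "AE t in lborel. t \<notin> {a<..<b}" using assms(1) by (auto elim!: eventually_mono)
  then have "emeasure lborel {a<..<b} = 0" by (subst (asm) AE_iff_measurable[of "{a<..<b}"]) auto
  then show False using assms(2) by simp
qed

text \<open>By Fubini in polar coordinates almost every ray meets a null set in a null set, and a radial
  function is determined by its values on a single ray.\<close>

lemma radial_weight_borel:
  assumes "radial_weight \<omega>"
  obtains g where "g \<in> borel_measurable borel" "\<And>s. 0 \<le> g s"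
    "AE s in lborel. 0 < s \<and> s < 1 \<longrightarrow> \<omega> (of_real s) = g s"
    "AE z in lborel. z \<in> disk \<longrightarrow> \<omega> z = g (norm z)"
proof -
  have nn: "0 \<le> \<omega> z" and rad: "\<omega> z = \<omega> (of_real (norm z))" if "z \<in> disk" for z
    using assms that unfolding radial_weight_def by blast+
  have "(\<lambda>z. indicator disk z *\<^sub>R \<omega> z) \<in> borel_measurable (completion lborel)"
    using assms by (auto simp: radial_weight_def set_integrable_def)
  from completion_ex_borel_measurable_real[OF this] obtain f :: "complex \<Rightarrow> real"
    where [measurable]: "f \<in> borel_measurable borel" and f: "AE z in lborel. indicator disk z *\<^sub>R \<omega> z = f z"
    by auto
  from AE_E[OF f] obtain N
    where "{z \<in> space lborel. \<not> indicator disk z *\<^sub>R \<omega> z = f z} \<subseteq> N" "emeasure lborel N = 0" "N \<in> sets lborel" .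
  then have N: "{z. indicator disk z *\<^sub>R \<omega> z \<noteq> f z} \<subseteq> N" "emeasure lborel N = 0" "N \<in> sets borel" by simp_all
  note [measurable] = N(3)
  have "0 = (\<integral>\<^sup>+z. indicator N z \<partial>lborel)" using N by simp
  also have "\<dots> = (\<integral>\<^sup>+t\<in>{0..<2*pi}. (\<integral>\<^sup>+\<rho>\<in>{0<..}. ennreal \<rho> * indicator N (of_real \<rho> * cis t) \<partial>lborel) \<partial>lborel)"
    by (rule nn_integral_polar) simp
  finally have "AE t in lborel. (\<integral>\<^sup>+\<rho>\<in>{0<..}. ennreal \<rho> * indicator N (of_real \<rho> * cis t) \<partial>lborel) * indicator {0..<2*pi} t = 0"
    by (subst nn_integral_0_iff_AE[symmetric]) auto
  from AE_imp_ex_interval[OF this, of 0 "2*pi"] obtain t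
    where "(\<integral>\<^sup>+\<rho>\<in>{0<..}. ennreal \<rho> * indicator N (of_real \<rho> * cis t) \<partial>lborel) = 0" by auto
  then have "AE \<rho> in lborel. ennreal \<rho> * indicator N (of_real \<rho> * cis t) * indicator {0<..} \<rho> = 0"
    by (subst nn_integral_0_iff_AE[symmetric]) auto
  then have tN: "AE \<rho> in lborel. 0 < \<rho> \<longrightarrow> of_real \<rho> * cis t \<notin> N"
    by (auto elim!: eventually_mono split: split_indicator_asm)
  \<comment> \<open>The Borel representative \<open>f\<close> may be negative on a null set; the
    maximum makes \<open>g\<close> nonnegative everywhere.\<close>
  define g where "g s = max 0 (f (of_real s * cis t))" for s
  have gm [measurable]: "g \<in> borel_measurable borel" unfolding g_def by measurable
  have 1: "AE s in lborel. 0 < s \<and> s < 1 \<longrightarrow> \<omega> (of_real s) = g s"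
    using tN
  proof eventually_elim
    case (elim s)
    show ?case
    proof
      assume s: "0 < s \<and> s < 1"
      then have "of_real s * cis t \<in> disk" "of_real s * cis t \<notin> N" using elim by (auto simp: norm_mult)
      moreover from this(2) have "indicator disk (of_real s * cis t) *\<^sub>R \<omega> (of_real s * cis t) = f (of_real s * cis t)"
        using N(1) by blast
      ultimately have "f (of_real s * cis t) = \<omega> (of_real s * cis t)" by simp
      moreover have "\<omega> (of_real s * cis t) = \<omega> (of_real s)"
        using s rad[of "of_real s * cis t"] by (simp add: norm_mult)
      ultimately show "\<omega> (of_real s) = g s" using nn[of "of_real s"] s by (simp add: g_def)
    qed
  qed
  from AE_E[OF 1] obtain N'
    where "{s \<in> space lborel. \<not> (0 < s \<and> s < 1 \<longrightarrow> \<omega> (of_real s) = g s)} \<subseteq> N'" "emeasure lborel N' = 0" "N' \<in> sets lborel" .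
  then have N': "{s. \<not> (0 < s \<and> s < 1 \<longrightarrow> \<omega> (of_real s) = g s)} \<subseteq> N'" "emeasure lborel N' = 0" "N' \<in> sets borel"
    by simp_all
  note [measurable] = N'(3)
  have "AE z in lborel. (z::complex) \<notin> {z. norm z \<in> N'}"
    using radial_null_set[OF N'(3,2)] by (intro AE_not_in) (auto simp: null_sets_def)
  then have "AE z in lborel. z \<in> disk \<longrightarrow> \<omega> z = g (norm z)"
    using AE_lborel_singleton[of 0]
  proof eventually_elim
    case (elim z)
    show ?case
    proof
      assume z: "z \<in> disk"
      then have "0 < norm z" "norm z < 1" using elim by auto
      then have "\<omega> (of_real (norm z)) = g (norm z)" using N'(1) elim(1) by blast
      with rad[OF z] show "\<omega> z = g (norm z)" by (rule trans)
    qed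
  qed
  then show thesis using that[OF gm _ 1] by (simp add: g_def)
qed

lemma weight_hat_borel:
  assumes [measurable]: "g \<in> borel_measurable borel" and ae: "AE s in lborel. 0 < s \<and> s < 1 \<longrightarrow> \<omega> (of_real s) = g s"
  shows "weight_hat \<omega> z = (\<integral>\<^sup>+s\<in>{norm z..<1}. ennreal (g s) \<partial>lborel)"
proof -
  show ?thesis
    unfolding weight_hat_def nn_integral_completion
  proof (intro nn_integral_cong_AE, use ae AE_lborel_singleton[of "0::real"] in eventually_elim)
    case (elim s)
    have "0 < s" if "norm z \<le> s" using that elim(2) norm_ge_zero[of z] by linarith
    then show ?case using elim(1) by (auto split: split_indicator)
  qed
qed

text \<open>The Borel counterpart of \<open>weight_measure\<close>. Its sigma-algebra is the one
  assumed for \<open>\<mu>\<close>, so all lemmas on measures over the disk apply to both.\<close>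

definition radial_measure :: "(real \<Rightarrow> real) \<Rightarrow> complex measure" where
  "radial_measure g = restrict_space (density lborel (\<lambda>z. ennreal (g (norm z)))) disk"

lemma sets_radial_measure: "sets (radial_measure g) = sets (restrict_space borel disk)"
  by (simp add: radial_measure_def sets_restrict_space)

lemma nn_integral_weight_measure:
  assumes [measurable]: "g \<in> borel_measurable borel" and \<omega>: "radial_weight \<omega>"
    and ae: "AE z in lborel. z \<in> disk \<longrightarrow> \<omega> z = g (norm z)"
    and F: "F \<in> borel_measurable (restrict_space borel disk)"
  shows "(\<integral>\<^sup>+z. F z \<partial>weight_measure \<omega>) = (\<integral>\<^sup>+z. F z \<partial>radial_measure g)"
proof -
  have Fi [measurable]: "(\<lambda>z. F z * indicator disk z) \<in> borel_measurable borel"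
    using F by (simp add: borel_measurable_restrict_space_iff_ennreal)
  have sub: "sets (restrict_space borel disk) \<subseteq> sets (restrict_space lebesgue (disk::complex set))"
    unfolding sets_restrict_space by (intro image_mono subsetI) simp
  have F': "F \<in> borel_measurable (restrict_space lebesgue disk)"
    using F measurable_mono[OF order_refl refl sub] by (auto simp: space_restrict_space)
  have "(\<lambda>z. indicator disk z *\<^sub>R \<omega> z) \<in> borel_measurable lebesgue"
    using \<omega> by (auto simp: radial_weight_def set_integrable_def)
  then have w': "\<omega> \<in> borel_measurable (restrict_space lebesgue disk)"
    by (subst borel_measurable_restrict_space_iff) (auto simp: mult.commute)
  have "(\<integral>\<^sup>+z. F z \<partial>weight_measure \<omega>) = (\<integral>\<^sup>+z. ennreal (\<omega> z) * F z \<partial>restrict_space lebesgue disk)"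
    unfolding weight_measure_def using F' w' by (intro nn_integral_density) auto
  also have "\<dots> = (\<integral>\<^sup>+z. ennreal (\<omega> z) * F z * indicator disk z \<partial>lborel)"
    by (subst nn_integral_restrict_space) (auto simp: nn_integral_completion)
  also have "\<dots> = (\<integral>\<^sup>+z. ennreal (g (norm z)) * (F z * indicator disk z) \<partial>lborel)"
    using ae by (intro nn_integral_cong_AE) (auto elim!: eventually_mono split: split_indicator)
  also have "\<dots> = (\<integral>\<^sup>+z. F z \<partial>radial_measure g)"
    unfolding radial_measure_def by (subst nn_integral_restrict_space) (auto simp: nn_integral_density)
  finally show ?thesis .
qed

text \<open>The radius is the outer variable: the weight is constant on each circle, and the Poisson
  inequality can be inserted circle by circle.\<close>

lemma nn_integral_radial_measure:
  assumes [measurable]: "g \<in> borel_measurable borel"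
    and F: "F \<in> borel_measurable (restrict_space borel disk)"
  shows "(\<integral>\<^sup>+z. F z \<partial>radial_measure g)
    = (\<integral>\<^sup>+\<rho>\<in>{0<..<1}. ennreal \<rho> * ennreal (g \<rho>) * (\<integral>\<^sup>+t\<in>{0..<2*pi}. F (of_real \<rho> * cis t) \<partial>lborel) \<partial>lborel)"
proof -
  define G where "G z = F z * indicator disk z" for z
  have [measurable]: "G \<in> borel_measurable borel"
    using F unfolding G_def by (simp add: borel_measurable_restrict_space_iff_ennreal)
  have "(\<integral>\<^sup>+z. F z \<partial>radial_measure g) = (\<integral>\<^sup>+z. ennreal (g (norm z)) * G z \<partial>lborel)"
    unfolding radial_measure_def G_def by (subst nn_integral_restrict_space) (auto simp: nn_integral_density G_def[symmetric])
  also have "\<dots> = (\<integral>\<^sup>+t\<in>{0..<2*pi}. (\<integral>\<^sup>+\<rho>\<in>{0<..}. ennreal \<rho> * (ennreal (g (norm (of_real \<rho> * cis t))) * G (of_real \<rho> * cis t)) \<partial>lborel) \<partial>lborel)"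
    by (subst nn_integral_polar) auto
  also have "\<dots> = (\<integral>\<^sup>+t. (\<integral>\<^sup>+\<rho>. ennreal \<rho> * (ennreal (g \<rho>) * G (of_real \<rho> * cis t)) * indicator {0<..<1} \<rho> * indicator {0..<2*pi} t \<partial>lborel) \<partial>lborel)"
  proof (rule nn_integral_cong, subst nn_integral_multc[symmetric], measurable, rule nn_integral_cong)
    fix t \<rho> :: real
    show "ennreal \<rho> * (ennreal (g (norm (of_real \<rho> * cis t))) * G (of_real \<rho> * cis t)) * indicator {0<..} \<rho> * indicator {0..<2*pi} t
      = ennreal \<rho> * (ennreal (g \<rho>) * G (of_real \<rho> * cis t)) * indicator {0<..<1} \<rho> * indicator {0..<2*pi} t"
      by (auto simp: norm_mult G_def split: split_indicator)
  qed
  also have "\<dots> = (\<integral>\<^sup>+\<rho>. (\<integral>\<^sup>+t. ennreal \<rho> * (ennreal (g \<rho>) * G (of_real \<rho> * cis t)) * indicator {0<..<1} \<rho> * indicator {0..<2*pi} t \<partial>lborel) \<partial>lborel)"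
    by (rule lborel_pair.Fubini') measurable
  also have "\<dots> = (\<integral>\<^sup>+\<rho>\<in>{0<..<1}. ennreal \<rho> * ennreal (g \<rho>) * (\<integral>\<^sup>+t\<in>{0..<2*pi}. G (of_real \<rho> * cis t) \<partial>lborel) \<partial>lborel)"
    by (intro nn_integral_cong) (auto simp: nn_integral_cmult[symmetric] mult_ac intro!: nn_integral_cong split: split_indicator)
  also have "\<dots> = (\<integral>\<^sup>+\<rho>\<in>{0<..<1}. ennreal \<rho> * ennreal (g \<rho>) * (\<integral>\<^sup>+t\<in>{0..<2*pi}. F (of_real \<rho> * cis t) \<partial>lborel) \<partial>lborel)"
    by (intro nn_integral_cong) (auto simp: G_def norm_mult split: split_indicator)
  finally show ?thesis .
qed


section \<open>Doubling weights\<close>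

text \<open>A chord below \<open>s\<close> means an angle below \<open>2 * s\<close>. As
  \<open>\<alpha>\<close> lies in \<open>{-pi<..pi}\<close> but \<open>t\<close> in
  \<open>{0..<2*pi}\<close>, two intervals one period apart are needed, each of length
  \<open>4 * s\<close>.\<close>

lemma emeasure_arc_le:
  assumes "norm \<zeta> = 1" "s > 0"
  shows "(\<integral>\<^sup>+t\<in>{0..<2*pi}. indicator {t. norm (cis t - \<zeta>) < s} t \<partial>lborel) \<le> ennreal (8 * s)"
proof -
  define \<alpha> where "\<alpha> = Arg \<zeta>"
  have "\<zeta> \<noteq> 0" using assms by auto
  then have \<zeta>: "\<zeta> = cis \<alpha>" using assms cis_Arg[of \<zeta>] by (auto simp: \<alpha>_def sgn_eq)
  have \<alpha>: "-pi < \<alpha>" "\<alpha> \<le> pi" using Arg_bounded[of \<zeta>] by (auto simp: \<alpha>_def)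
  have sub: "t \<in> {\<alpha> - 2 * s..\<alpha> + 2 * s} \<union> {\<alpha> + 2 * pi - 2 * s..\<alpha> + 2 * pi + 2 * s}"
    if t: "t \<in> {0..<2*pi}" "norm (cis t - \<zeta>) < s" for t
  proof -
    have "norm (cis t - \<zeta>) = norm (cis \<alpha> * (cis (t - \<alpha>) - 1))" by (simp add: \<zeta> algebra_simps cis_mult)
    then have n: "norm (cis (t - \<alpha>) - 1) < s" using t by (simp add: norm_mult)
    show ?thesis
    proof (cases "t - \<alpha> \<le> pi")
      case True
      then have "\<bar>t - \<alpha>\<bar> \<le> pi" using t \<alpha> by auto
      then have "\<bar>t - \<alpha>\<bar> / 2 < s" by (intro le_less_trans[OF norm_cis_minus_1_lower n])
      then show ?thesis by auto
    next
      case False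
      have "cis (t - \<alpha> - 2 * pi) = cis (t - \<alpha>)" using cis_add_2pi[of "t - \<alpha> - 2 * pi"] by simp
      moreover have "\<bar>t - \<alpha> - 2 * pi\<bar> \<le> pi" using t \<alpha> False by auto
      ultimately have "\<bar>t - \<alpha> - 2 * pi\<bar> < 2 * s" using norm_cis_minus_1_lower[of "t - \<alpha> - 2 * pi"] n by simp
      then show ?thesis by auto
    qed
  qed
  have "(\<integral>\<^sup>+t\<in>{0..<2*pi}. indicator {t. norm (cis t - \<zeta>) < s} t \<partial>lborel)
    \<le> (\<integral>\<^sup>+t. indicator ({\<alpha> - 2 * s..\<alpha> + 2 * s} \<union> {\<alpha> + 2 * pi - 2 * s..\<alpha> + 2 * pi + 2 * s}) t \<partial>lborel)"
    using sub by (intro nn_integral_mono) (auto split: split_indicator)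
  also have "\<dots> = emeasure lborel ({\<alpha> - 2 * s..\<alpha> + 2 * s} \<union> {\<alpha> + 2 * pi - 2 * s..\<alpha> + 2 * pi + 2 * s})"
    by (rule nn_integral_indicator) auto
  also have "\<dots> \<le> emeasure lborel {\<alpha> - 2 * s..\<alpha> + 2 * s} + emeasure lborel {\<alpha> + 2 * pi - 2 * s..\<alpha> + 2 * pi + 2 * s}"
    by (rule emeasure_subadditive) auto
  also have "\<dots> = ennreal (8 * s)"
    using assms by (simp add: ennreal_plus[symmetric] del: ennreal_plus)
  finally show ?thesis .
qed

text \<open>Since \<open>w\<close> is at distance at least half the height from \<open>z\<close>,
  \<open>norm (w - z)\<close> is comparable with \<open>norm (1 - cnj z * w)\<close> up to the
  factor \<open>5\<close>; the numerator contributes \<open>2\<close>, and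
  \<open>50 = 2 * 25\<close>.\<close>

lemma poisson_kernel_le:
  assumes z: "norm z < 1" and w: "1 - (1 - norm z) / 2 \<le> norm w" "norm w < 1"
  shows "((norm w)\<^sup>2 - (norm z)\<^sup>2) / (norm (w - z))\<^sup>2 \<le> 50 * ((1 - norm z) / (norm (1 - cnj z * w))\<^sup>2)"
proof -
  let ?h = "1 - norm z"
  have h: "?h > 0" using z by simp
  have "norm w - norm z \<le> norm (w - z)" by (rule norm_triangle_ineq2)
  then have wz: "?h / 2 \<le> norm (w - z)" using w by (simp add: field_simps)
  have "norm (1 - cnj z * w) \<le> 2 * ?h + norm (w - z)"
    using norm_one_minus_cnj_le[OF z, of w] by (simp add: norm_minus_commute)
  then have five: "norm (1 - cnj z * w) \<le> 5 * norm (w - z)" using wz by simp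
  have pos: "norm (1 - cnj z * w) > 0" using one_minus_cnj_pos[of w z] w z by simp
  have "(norm w)\<^sup>2 - (norm z)\<^sup>2 = (norm w - norm z) * (norm w + norm z)" by (simp add: power2_eq_square algebra_simps)
  also have "\<dots> \<le> ?h * 2" using w z by (intro mult_mono) auto
  finally have num: "(norm w)\<^sup>2 - (norm z)\<^sup>2 \<le> 2 * ?h" by simp
  have "(norm (1 - cnj z * w))\<^sup>2 \<le> (5 * norm (w - z))\<^sup>2" using five by (intro power_mono) auto
  then have sq: "(norm (1 - cnj z * w))\<^sup>2 / 25 \<le> (norm (w - z))\<^sup>2" by (simp add: power_mult_distrib)
  have "((norm w)\<^sup>2 - (norm z)\<^sup>2) / (norm (w - z))\<^sup>2 \<le> 2 * ?h / (norm (w - z))\<^sup>2"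
    using num by (intro divide_right_mono) auto
  also have "\<dots> \<le> 2 * ?h / ((norm (1 - cnj z * w))\<^sup>2 / 25)"
    using sq h pos by (intro divide_left_mono) (auto intro!: mult_pos_pos)
  also have "\<dots> = 50 * (?h / (norm (1 - cnj z * w))\<^sup>2)" by simp
  finally show ?thesis .
qed

text \<open>The two class conditions in terms of the height \<open>h = 1 - r\<close>:
  \<open>D\<close> is the constant of \<open>D_hat\<close>, while \<open>\<kappa>\<close> is the
  reciprocal of the constant of \<open>D_check\<close>.\<close>

locale doubling_weight =
  fixes g :: "real \<Rightarrow> real" and D K \<kappa> :: real
  assumes g_measurable [measurable]: "g \<in> borel_measurable borel"
    and g_nonneg: "0 \<le> g s"
    and finite_mass: "(\<integral>\<^sup>+s\<in>{0..<1}. ennreal (g s) \<partial>lborel) < \<infinity>"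
    and positive_tail: "0 < h \<Longrightarrow> h \<le> 1 \<Longrightarrow> 0 < (\<integral>\<^sup>+s\<in>{1 - h..<1}. ennreal (g s) \<partial>lborel)"
    and doubling: "0 < h \<Longrightarrow> h \<le> 1 / 2 \<Longrightarrow>
      (\<integral>\<^sup>+s\<in>{1 - 2 * h..<1}. ennreal (g s) \<partial>lborel) \<le> ennreal D * (\<integral>\<^sup>+s\<in>{1 - h..<1}. ennreal (g s) \<partial>lborel)"
    and reverse_doubling: "0 < h \<Longrightarrow> h \<le> 1 \<Longrightarrow>
      (\<integral>\<^sup>+s\<in>{1 - h / K..<1}. ennreal (g s) \<partial>lborel) \<le> ennreal \<kappa> * (\<integral>\<^sup>+s\<in>{1 - h..<1}. ennreal (g s) \<partial>lborel)"
    and D: "D \<ge> 1" and K: "K > 1" and \<kappa>: "0 \<le> \<kappa>" "\<kappa> < 1"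
begin

text \<open>Capping the height at \<open>1\<close> makes monotonicity and doubling hold for all
  \<open>h > 0\<close>, so dyadic balls larger than the disk need no special treatment.\<close>

definition H :: "real \<Rightarrow> real" where
  "H h = enn2real (\<integral>\<^sup>+s\<in>{1 - min h 1..<1}. ennreal (g s) \<partial>lborel)"

abbreviation "W \<equiv> radial_measure g"

lemma tail_finite: "h \<le> 1 \<Longrightarrow> (\<integral>\<^sup>+s\<in>{1 - h..<1}. ennreal (g s) \<partial>lborel) < \<infinity>"
  by (rule le_less_trans[OF nn_integral_mono finite_mass]) (auto split: split_indicator)

lemma ennreal_H: "h > 0 \<Longrightarrow> ennreal (H h) = (\<integral>\<^sup>+s\<in>{1 - min h 1..<1}. ennreal (g s) \<partial>lborel)"
  unfolding H_def using tail_finite[of "min h 1"] by simp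

lemma H_pos: "h > 0 \<Longrightarrow> H h > 0"
  using positive_tail[of "min h 1"] ennreal_H[of h] by (metis ennreal_eq_0_iff linorder_not_le min.bounded_iff min.cobounded2 min_less_iff_conj zero_less_one not_gr_zero)

lemma H_mono: "0 < h \<Longrightarrow> h \<le> h' \<Longrightarrow> H h \<le> H h'"
proof -
  assume h: "0 < h" "h \<le> h'"
  then have "ennreal (H h) \<le> ennreal (H h')"
    by (subst (1 2) ennreal_H) (auto intro!: nn_integral_mono split: split_indicator)
  then show ?thesis using H_pos[of h'] h by simp
qed

lemma H_double: "h > 0 \<Longrightarrow> H (2 * h) \<le> D * H h"
proof (cases "h \<le> 1 / 2")
  case True
  assume "h > 0"
  then have "ennreal (H (2 * h)) \<le> ennreal (D * H h)"
    using doubling[of h] True D H_pos[of h] by (simp add: ennreal_H ennreal_mult')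
  then show ?thesis using H_pos[OF \<open>h > 0\<close>] D by (simp add: ennreal_le_iff)
next
  case False
  assume "h > 0"
  \<comment> \<open>Both arguments are at least \<open>1\<close>, where \<open>H\<close> is
    constant.\<close>
  have "H (2 * h) = H (2 * (1 / 2))" using False by (simp add: H_def)
  also have "ennreal \<dots> \<le> ennreal (D * H (1 / 2))"
    using doubling[of "1 / 2"] D H_pos[of "1 / 2"] by (simp add: ennreal_H ennreal_mult')
  then have "H (2 * (1 / 2)) \<le> D * H (1 / 2)" using H_pos[of "1/2"] D by (simp add: ennreal_le_iff)
  also have "D * H (1 / 2) \<le> D * H h" using H_mono[of "1 / 2" h] False D by (intro mult_left_mono) auto
  finally show ?thesis .
qed

lemma H_power: "h > 0 \<Longrightarrow> H (2 ^ k * h) \<le> D ^ k * H h"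
proof (induction k)
  case (Suc k)
  have "H (2 ^ Suc k * h) \<le> D * H (2 ^ k * h)" using H_double[of "2 ^ k * h"] Suc.prems by (simp add: mult_ac)
  also have "\<dots> \<le> D * (D ^ k * H h)" using Suc D by (intro mult_left_mono) auto
  finally show ?case by (simp add: mult_ac)
qed simp

lemma H_shrink: "0 < h \<Longrightarrow> h \<le> 1 \<Longrightarrow> H (h / K) \<le> \<kappa> * H h"
proof -
  assume h: "0 < h" "h \<le> 1"
  then have hK: "h / K \<le> 1" "h / K > 0" using K by (auto simp: divide_le_eq)
  have "ennreal (H (h / K)) \<le> ennreal (\<kappa> * H h)"
    using reverse_doubling[OF h] h hK \<kappa> H_pos[of h] by (simp add: ennreal_H ennreal_mult')
  then show ?thesis using \<kappa> H_pos[of h] h by (simp add: ennreal_le_iff)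
qed

text \<open>The ball lies in the annulus of height \<open>h\<close> over directions within
  \<open>2 * h\<close> of \<open>\<zeta>\<close>, and those have length at most
  \<open>8 * (2 * h)\<close>.\<close>

lemma emeasure_W_ball:
  assumes \<zeta>: "norm \<zeta> = 1" and h: "h > 0"
  shows "emeasure W (disk \<inter> ball \<zeta> h) \<le> ennreal (16 * h * H h)"
proof -
  have B: "disk \<inter> ball \<zeta> h \<in> sets (restrict_space borel disk)" by (auto simp: sets_restrict_space)
  have "emeasure W (disk \<inter> ball \<zeta> h) = (\<integral>\<^sup>+z. indicator (disk \<inter> ball \<zeta> h) z \<partial>W)"
    using B by (simp add: sets_radial_measure)
  also have "\<dots> = (\<integral>\<^sup>+\<rho>\<in>{0<..<1}. ennreal \<rho> * ennreal (g \<rho>) * (\<integral>\<^sup>+t\<in>{0..<2*pi}. indicator (disk \<inter> ball \<zeta> h) (of_real \<rho> * cis t) \<partial>lborel) \<partial>lborel)"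
    using B by (intro nn_integral_radial_measure) auto
  also have "\<dots> \<le> (\<integral>\<^sup>+\<rho>. ennreal (g \<rho>) * indicator {1 - min h 1..<1} \<rho> * ennreal (16 * h) \<partial>lborel)"
  proof (rule nn_integral_mono)
    fix \<rho> :: real
    let ?I = "\<integral>\<^sup>+t\<in>{0..<2*pi}. indicator (disk \<inter> ball \<zeta> h) (of_real \<rho> * cis t) \<partial>lborel"
    show "ennreal \<rho> * ennreal (g \<rho>) * ?I * indicator {0<..<1} \<rho> \<le> ennreal (g \<rho>) * indicator {1 - min h 1..<1} \<rho> * ennreal (16 * h)"
    proof (cases "\<rho> \<in> {0<..<1}")
      case True
      have sub: "1 - h < \<rho> \<and> norm (cis t - \<zeta>) < 2 * h" if "of_real \<rho> * cis t \<in> ball \<zeta> h" for t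
      proof -
        have d: "norm (\<zeta> - of_real \<rho> * cis t) < h" using that by (simp add: dist_norm)
        have "norm \<zeta> - norm (of_real \<rho> * cis t) \<le> norm (\<zeta> - of_real \<rho> * cis t)" by (rule norm_triangle_ineq2)
        then have 1: "1 - h < \<rho>" using d \<zeta> True by (simp add: norm_mult)
        have "cis t - \<zeta> = of_real (1 - \<rho>) * cis t - (\<zeta> - of_real \<rho> * cis t)" by (simp add: algebra_simps)
        then have "norm (cis t - \<zeta>) \<le> norm (of_real (1 - \<rho>) * cis t) + norm (\<zeta> - of_real \<rho> * cis t)"
          by (metis norm_triangle_ineq4)
        also have "norm (of_real (1 - \<rho>) * cis t) = 1 - \<rho>"
          using True unfolding norm_mult norm_of_real by simp
        finally show ?thesis using 1 d by simp
      qed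
      show ?thesis
      proof (cases "1 - h < \<rho>")
        case hr: True
        have "?I \<le> (\<integral>\<^sup>+t\<in>{0..<2*pi}. indicator {t. norm (cis t - \<zeta>) < 2 * h} t \<partial>lborel)"
          using sub by (intro nn_integral_mono) (auto split: split_indicator)
        also have "\<dots> \<le> ennreal (16 * h)" using emeasure_arc_le[OF \<zeta>, of "2 * h"] h by simp
        finally have "ennreal \<rho> * ennreal (g \<rho>) * ?I \<le> 1 * ennreal (g \<rho>) * ennreal (16 * h)"
          using True by (intro mult_mono) (auto simp: ennreal_le_1)
        moreover have "\<rho> \<in> {1 - min h 1..<1}" using True hr by (auto simp: min_def)
        ultimately show ?thesis using True by simp
      next
        case False
        then have "?I = (\<integral>\<^sup>+(t::real). 0 \<partial>lborel)" using sub by (intro nn_integral_cong) (auto split: split_indicator)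
        then show ?thesis by simp
      qed
    qed simp
  qed
  also have "\<dots> = ennreal (H h) * ennreal (16 * h)"
    by (subst nn_integral_multc) (auto simp: ennreal_H[OF h])
  also have "\<dots> = ennreal (16 * h * H h)" using H_pos[OF h] h by (simp add: ennreal_mult[symmetric] mult_ac)
  finally show ?thesis .
qed

text \<open>In the constant, \<open>50\<close> comes from the Poisson kernel,
  \<open>1 - \<kappa>\<close> is the share of the annulus in the tail at height
  \<open>h / 2\<close>, and \<open>D\<close> relates that tail to the one at height
  \<open>h\<close>.\<close>

lemma pointwise_estimate:
  assumes f: "f holomorphic_on disk" and z: "norm z < 1" and p: "p > 0"
  defines "h \<equiv> 1 - norm z"
  shows "ennreal (norm (f z) powr p * H h) \<le> ennreal (50 * D / (1 - \<kappa>)) *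
    (\<integral>\<^sup>+w. ennreal (h / (norm (1 - cnj z * w))\<^sup>2 * norm (f w) powr p)
        * indicator {w. h / (2 * K) \<le> 1 - norm w \<and> 1 - norm w \<le> h / 2} w \<partial>W)"
\<comment> \<open>The identically vanishing function is set aside because the Poisson inequality
  needs circles free of zeros.\<close>
proof (cases "f constant_on disk \<and> f 0 = 0")
  case True
  then have "f z = 0" using z by (auto simp: constant_on_def)
  then show ?thesis by simp
next
  case nz: False
  have h: "0 < h" "h \<le> 1" and zr: "norm z = 1 - h" using z by (auto simp: h_def)
  define I where "I = {1 - h / 2..1 - h / (2 * K)}"
  have hK: "0 < h / (2 * K)" "h / (2 * K) < h / 2" using h K by (auto simp: field_simps)
  define \<Phi> where "\<Phi> w = ennreal (h / (norm (1 - cnj z * w))\<^sup>2 * norm (f w) powr p)" for w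
  define A where "A = {w :: complex. h / (2 * K) \<le> 1 - norm w \<and> 1 - norm w \<le> h / 2}"
  have Im [measurable]: "I \<in> sets borel" by (simp add: I_def)
  have "closed A" unfolding A_def by (intro closed_Collect_conj closed_Collect_le continuous_intros)
  then have Am [measurable]: "A \<in> sets borel" by (rule borel_closed)
  have \<Phi>m: "\<Phi> \<in> borel_measurable (restrict_space borel disk)"
  proof -
    have "norm (1 - cnj z * w) \<noteq> 0" if "w \<in> disk" for w
      using one_minus_cnj_pos[of w z] that z by simp
    then have "continuous_on disk (\<lambda>w. h / (norm (1 - cnj z * w))\<^sup>2 * norm (f w) powr p)"
      using p holomorphic_on_imp_continuous_on[OF f]
      by (intro continuous_intros continuous_on_powr') auto
    from borel_measurable_continuous_on_restrict[OF this] show ?thesis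
      unfolding \<Phi>_def by measurable
  qed
  \<comment> \<open>Finitely many zeros spoil finitely many radii only, a null set for the
    integration in \<open>\<rho>\<close>.\<close>
  have fin: "finite {w \<in> cball 0 (1 - h / (2 * K)). f w = 0}"
  proof (cases "f constant_on disk")
    case True
    then obtain c where c: "\<And>w. w \<in> disk \<Longrightarrow> f w = c" by (auto simp: constant_on_def)
    have "c \<noteq> 0" using nz True c[of 0] by auto
    have "f w \<noteq> 0" if "norm w \<le> 1 - h / (2 * K)" for w using c[of w] \<open>c \<noteq> 0\<close> that hK by auto
    then have "{w \<in> cball 0 (1 - h / (2 * K)). f w = 0} = {}" by auto
    then show ?thesis by (simp only: finite.emptyI)
  next
    case False
    then show ?thesis using hK f by (intro holomorphic_compact_finite_zeros[of f disk]) auto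
  qed
  have ae: "AE \<rho> in lborel. \<rho> \<notin> norm ` {w \<in> cball 0 (1 - h / (2 * K)). f w = 0}"
    using fin by (intro AE_not_in) (auto intro: finite_imp_null_set_lborel)
  let ?J = "\<lambda>\<rho>. \<integral>\<^sup>+t\<in>{0..<2*pi}. \<Phi> (of_real \<rho> * cis t) \<partial>lborel"
  have main: "AE \<rho> in lborel. ennreal (norm (f z) powr p) * (ennreal (g \<rho>) * indicator I \<rho>)
      \<le> ennreal 50 * (ennreal \<rho> * ennreal (g \<rho>) * (\<integral>\<^sup>+t\<in>{0..<2*pi}. \<Phi> (of_real \<rho> * cis t) * indicator A (of_real \<rho> * cis t) \<partial>lborel) * indicator {0<..<1} \<rho>)"
    using ae
  proof eventually_elim
    case (elim \<rho>)
    show ?case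
    proof (cases "\<rho> \<in> I")
      case True
      then have \<rho>: "1 / 2 \<le> \<rho>" "\<rho> < 1" "1 - h / 2 \<le> \<rho>" "\<rho> \<le> 1 - h / (2 * K)" "norm z < \<rho>"
        using h hK zr by (auto simp: I_def)
      have "ennreal (2 * pi * norm (f z) powr p)
          \<le> (\<integral>\<^sup>+t\<in>{0..<2*pi}. ennreal ((\<rho>\<^sup>2 - (norm z)\<^sup>2) / (norm (of_real \<rho> * cis t - z))\<^sup>2 * norm (f (of_real \<rho> * cis t)) powr p) \<partial>lborel)"
        using elim \<rho> p by (intro poisson_submean[OF f]) auto
      also have "\<dots> \<le> (\<integral>\<^sup>+t. ennreal 50 * (\<Phi> (of_real \<rho> * cis t) * indicator A (of_real \<rho> * cis t) * indicator {0..<2*pi} t) \<partial>lborel)"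
      proof (rule nn_integral_mono)
        fix t
        have "(\<rho>\<^sup>2 - (norm z)\<^sup>2) / (norm (of_real \<rho> * cis t - z))\<^sup>2 \<le> 50 * (h / (norm (1 - cnj z * (of_real \<rho> * cis t)))\<^sup>2)"
          using poisson_kernel_le[OF z, of "of_real \<rho> * cis t"] \<rho> by (simp add: norm_mult h_def)
        then have "(\<rho>\<^sup>2 - (norm z)\<^sup>2) / (norm (of_real \<rho> * cis t - z))\<^sup>2 * norm (f (of_real \<rho> * cis t)) powr p
            \<le> 50 * (h / (norm (1 - cnj z * (of_real \<rho> * cis t)))\<^sup>2) * norm (f (of_real \<rho> * cis t)) powr p"
          by (rule mult_right_mono) simp
        moreover have "of_real \<rho> * cis t \<in> A" using \<rho> by (simp add: A_def norm_mult)
        ultimately show "ennreal ((\<rho>\<^sup>2 - (norm z)\<^sup>2) / (norm (of_real \<rho> * cis t - z))\<^sup>2 * norm (f (of_real \<rho> * cis t)) powr p) * indicator {0..<2*pi} t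
            \<le> ennreal 50 * (\<Phi> (of_real \<rho> * cis t) * indicator A (of_real \<rho> * cis t) * indicator {0..<2*pi} t)"
          using h ennreal_mult[of 50 "h / (norm (1 - cnj z * (of_real \<rho> * cis t)))\<^sup>2 * norm (f (of_real \<rho> * cis t)) powr p", symmetric]
          by (auto simp: \<Phi>_def mult.assoc intro!: ennreal_leI split: split_indicator)
      qed
      also have "\<dots> = ennreal 50 * (\<integral>\<^sup>+t\<in>{0..<2*pi}. \<Phi> (of_real \<rho> * cis t) * indicator A (of_real \<rho> * cis t) \<partial>lborel)" (is "_ = _ * ?J")
      proof (rule nn_integral_cmult)
        have "(\<lambda>t. of_real \<rho> * cis t) \<in> measurable borel (restrict_space borel disk)"
          using \<rho> by (intro measurable_restrict_space2) (auto simp: norm_mult)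
        from measurable_compose[OF this \<Phi>m] show "(\<lambda>t. \<Phi> (of_real \<rho> * cis t) * indicator A (of_real \<rho> * cis t) * indicator {0..<2*pi} t) \<in> borel_measurable lborel"
          by simp
      qed
      \<comment> \<open>Of the factor \<open>2 * pi\<close> only \<open>2\<close> is kept; with
        \<open>\<rho> \<ge> 1 / 2\<close> it pays for the polar density
        \<open>\<rho>\<close>.\<close>
      finally have "ennreal (norm (f z) powr p * 2) \<le> ennreal 50 * ?J"
      proof (rule order_trans[rotated], intro ennreal_leI)
        have "norm (f z) powr p * 2 \<le> norm (f z) powr p * (2 * pi)"
          using pi_gt3 by (intro mult_left_mono) auto
        then show "norm (f z) powr p * 2 \<le> 2 * pi * norm (f z) powr p" by (simp add: mult_ac)
      qed
      then have "ennreal (\<rho> * g \<rho>) * ennreal (norm (f z) powr p * 2) \<le> ennreal (\<rho> * g \<rho>) * (ennreal 50 * ?J)"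
        by (intro mult_left_mono) auto
      moreover have "ennreal (norm (f z) powr p) * ennreal (g \<rho>) \<le> ennreal (\<rho> * g \<rho>) * ennreal (norm (f z) powr p * 2)"
      proof -
        have "(norm (f z) powr p * g \<rho>) * 1 \<le> (norm (f z) powr p * g \<rho>) * (2 * \<rho>)"
          using \<rho> g_nonneg by (intro mult_left_mono) auto
        then show ?thesis using \<rho> g_nonneg by (subst (1 2) ennreal_mult[symmetric]) (auto intro!: ennreal_leI simp: mult_ac)
      qed
      ultimately have "ennreal (norm (f z) powr p) * ennreal (g \<rho>) \<le> ennreal (\<rho> * g \<rho>) * (ennreal 50 * ?J)"
        by (rule order_trans[rotated])
      also have "\<dots> = ennreal 50 * (ennreal \<rho> * ennreal (g \<rho>) * ?J)"
        using \<rho> g_nonneg by (simp add: ennreal_mult mult_ac)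
      finally show ?thesis using True \<rho> by simp
    qed simp
  qed
  have "ennreal (norm (f z) powr p) * ennreal ((1 - \<kappa>) / D * H h) \<le> ennreal (norm (f z) powr p) * (\<integral>\<^sup>+\<rho>\<in>I. ennreal (g \<rho>) \<partial>lborel)"
  proof (rule mult_left_mono)
    \<comment> \<open>The tail at height \<open>h / 2\<close> is split at \<open>h / 2 / K\<close>.
      The remaining tail is at most \<open>\<kappa>\<close> times the whole, so \<open>I\<close>
      carries at least the share \<open>1 - \<kappa>\<close>.\<close>
    have a: "ennreal (H (h / 2)) \<le> (\<integral>\<^sup>+\<rho>\<in>I. ennreal (g \<rho>) \<partial>lborel) + ennreal (H (h / 2 / K))"
    proof -
      have "ennreal (H (h / 2)) = (\<integral>\<^sup>+s\<in>{1 - h / 2..<1}. ennreal (g s) \<partial>lborel)" using ennreal_H[of "h / 2"] h by simp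
      also have "\<dots> \<le> (\<integral>\<^sup>+s. ennreal (g s) * indicator I s + ennreal (g s) * indicator {1 - h / 2 / K..<1} s \<partial>lborel)"
        by (intro nn_integral_mono) (auto simp: I_def split: split_indicator)
      also have "\<dots> = (\<integral>\<^sup>+s\<in>I. ennreal (g s) \<partial>lborel) + (\<integral>\<^sup>+s\<in>{1 - h / 2 / K..<1}. ennreal (g s) \<partial>lborel)"
        by (rule nn_integral_add) auto
      also have "(\<integral>\<^sup>+s\<in>{1 - h / 2 / K..<1}. ennreal (g s) \<partial>lborel) = ennreal (H (h / 2 / K))"
        using ennreal_H[of "h / 2 / K"] hK h by (simp add: min_def)
      finally show ?thesis .
    qed
    show "ennreal ((1 - \<kappa>) / D * H h) \<le> (\<integral>\<^sup>+\<rho>\<in>I. ennreal (g \<rho>) \<partial>lborel)"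
    proof (cases "\<integral>\<^sup>+\<rho>\<in>I. ennreal (g \<rho>) \<partial>lborel")
      case (real x)
      then have "H (h / 2) \<le> x + H (h / 2 / K)"
        using a H_pos[of "h/2/K"] hK by (simp add: ennreal_plus[symmetric] del: ennreal_plus)
      then have "(1 - \<kappa>) * H (h / 2) \<le> x" using H_shrink[of "h / 2"] h by (simp add: algebra_simps)
      moreover have "(1 - \<kappa>) / D * H h \<le> (1 - \<kappa>) / D * (D * H (h / 2))"
        using H_double[of "h / 2"] h \<kappa> D by (intro mult_left_mono) auto
      ultimately show ?thesis unfolding real(2) using D by (intro ennreal_leI) simp
    qed simp
  qed simp
  also have "\<dots> = (\<integral>\<^sup>+\<rho>. ennreal (norm (f z) powr p) * (ennreal (g \<rho>) * indicator I \<rho>) \<partial>lborel)"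
    by (rule nn_integral_cmult[symmetric]) simp
  also have "\<dots> \<le> (\<integral>\<^sup>+\<rho>. ennreal 50 * (ennreal \<rho> * ennreal (g \<rho>) * (\<integral>\<^sup>+t\<in>{0..<2*pi}. \<Phi> (of_real \<rho> * cis t) * indicator A (of_real \<rho> * cis t) \<partial>lborel) * indicator {0<..<1} \<rho>) \<partial>lborel)"
    by (rule nn_integral_mono_AE[OF main])
  also have "\<dots> = ennreal 50 * (\<integral>\<^sup>+w. \<Phi> w * indicator A w \<partial>W)"
  proof -
    define \<Psi> where "\<Psi> w = \<Phi> w * indicator A w * indicator disk w" for w
    have "(\<lambda>w. \<Phi> w * indicator A w) \<in> borel_measurable (restrict_space borel disk)"
      by (rule borel_measurable_times_ennreal[OF \<Phi>m measurable_restrict_space1[OF borel_measurable_indicator[OF Am]]])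
    then have [measurable]: "\<Psi> \<in> borel_measurable borel"
      unfolding \<Psi>_def by (simp add: borel_measurable_restrict_space_iff_ennreal)
    have "(\<integral>\<^sup>+w. \<Phi> w * indicator A w \<partial>W) = (\<integral>\<^sup>+w. \<Psi> w \<partial>W)"
      unfolding \<Psi>_def by (intro nn_integral_cong) (auto simp: radial_measure_def space_restrict_space)
    also have "\<dots> = (\<integral>\<^sup>+\<rho>\<in>{0<..<1}. ennreal \<rho> * ennreal (g \<rho>) * (\<integral>\<^sup>+t\<in>{0..<2*pi}. \<Psi> (of_real \<rho> * cis t) \<partial>lborel) \<partial>lborel)"
      by (intro nn_integral_radial_measure measurable_restrict_space1) auto
    finally have "ennreal 50 * (\<integral>\<^sup>+w. \<Phi> w * indicator A w \<partial>W)
        = (\<integral>\<^sup>+\<rho>. ennreal 50 * (ennreal \<rho> * ennreal (g \<rho>) * (\<integral>\<^sup>+t\<in>{0..<2*pi}. \<Psi> (of_real \<rho> * cis t) \<partial>lborel) * indicator {0<..<1} \<rho>) \<partial>lborel)"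
      by (simp add: nn_integral_cmult)
    also have "\<dots> = (\<integral>\<^sup>+\<rho>. ennreal 50 * (ennreal \<rho> * ennreal (g \<rho>) * (\<integral>\<^sup>+t\<in>{0..<2*pi}. \<Phi> (of_real \<rho> * cis t) * indicator A (of_real \<rho> * cis t) \<partial>lborel) * indicator {0<..<1} \<rho>) \<partial>lborel)"
      by (intro nn_integral_cong) (auto simp: \<Psi>_def norm_mult split: split_indicator)
    finally show ?thesis by simp
  qed
  finally have "ennreal (D / (1 - \<kappa>)) * (ennreal (norm (f z) powr p) * ennreal ((1 - \<kappa>) / D * H h))
      \<le> ennreal (D / (1 - \<kappa>)) * (ennreal 50 * (\<integral>\<^sup>+w. \<Phi> w * indicator A w \<partial>W))"
    by (rule mult_left_mono) simp
  moreover have "ennreal (D / (1 - \<kappa>)) * (ennreal (norm (f z) powr p) * ennreal ((1 - \<kappa>) / D * H h)) = ennreal (norm (f z) powr p * H h)"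
    using D \<kappa> H_pos[of h] h by (simp add: ennreal_mult[symmetric])
  moreover have "ennreal (D / (1 - \<kappa>)) * (ennreal 50 * X) = ennreal (50 * D / (1 - \<kappa>)) * X" for X
  proof -
    have "ennreal (50 * D / (1 - \<kappa>)) = ennreal (D / (1 - \<kappa>)) * ennreal 50"
      using D \<kappa> by (subst ennreal_mult[symmetric]) (auto simp: mult.commute)
    then show ?thesis by (simp only: mult.assoc)
  qed
  ultimately show ?thesis unfolding \<Phi>_def A_def by simp
qed

end


section \<open>The Carleson integral estimate\<close>

context doubling_weight
begin

definition pointwise_const :: real where "pointwise_const = 50 * D / (1 - \<kappa>)"

lemma pointwise_const_pos: "pointwise_const > 0" using D \<kappa> by (simp add: pointwise_const_def)

lemma W_origin: "emeasure W {0} = 0"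
  unfolding radial_measure_def
  by (subst emeasure_restrict_space) (auto simp: emeasure_density nn_integral_0_iff_AE intro!: nn_integral_null_set)

text \<open>The hypothesis says that \<open>norm (f w) powr p\<close> times \<open>W\<close> is a
  Carleson measure with constant \<open>M\<close>. Balls at the circle then have mass linear in the
  radius, and the squared kernel beats this growth dyadically.\<close>

lemma kernel_integral:
  assumes f: "f holomorphic_on disk" and M: "M \<ge> 0" and z: "norm z < 1"
    and tent: "\<And>b. b \<in> disk - {0} \<Longrightarrow>
      (\<integral>\<^sup>+w\<in>carleson_square b. ennreal (norm (f w) powr p) \<partial>W) \<le> ennreal (M * (1 - norm b))"
  shows "(\<integral>\<^sup>+w. ennreal (((1 - norm z) / norm (1 - cnj z * w))\<^sup>2) * ennreal (norm (f w) powr p) \<partial>W)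
    \<le> ennreal (832 * M * (1 - norm z))"
proof -
  have fm [measurable]: "f \<in> borel_measurable W"
    by (rule holomorphic_measurable[OF sets_radial_measure f])
  have idm [measurable]: "(\<lambda>w. w) \<in> borel_measurable W"
    by (rule holomorphic_measurable[OF sets_radial_measure holomorphic_on_ident])
  define \<nu> where "\<nu> = density W (\<lambda>w. ennreal (norm (f w) powr p))"
  have \<nu>: "sets \<nu> = sets (restrict_space borel disk)" by (simp add: \<nu>_def sets_radial_measure)
  have em: "emeasure \<nu> A = (\<integral>\<^sup>+w\<in>A. ennreal (norm (f w) powr p) \<partial>W)" if "A \<in> sets W" for A
    unfolding \<nu>_def using that by (intro emeasure_density) auto
  have 0: "{0} \<in> sets W" by (rule borel_subset_disk[OF sets_radial_measure]) auto
  have "emeasure \<nu> {0} = 0"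
    unfolding em[OF 0] using W_origin 0 by (intro nn_integral_null_set) (auto simp: null_sets_def)
  then have null: "{0} \<in> null_sets \<nu>" using 0 \<nu> by (simp add: null_sets_def sets_radial_measure)
  have ball: "emeasure \<nu> (disk \<inter> ball (apex z) s) \<le> ennreal M * ennreal (104 * s)" if s: "s > 0" for s
  proof -
    have "disk \<inter> ball (apex z) s \<in> sets \<nu>" unfolding \<nu> by (auto simp: sets_restrict_space)
    then have "emeasure \<nu> (disk \<inter> ball (apex z) s) = emeasure \<nu> (disk \<inter> ball (apex z) s - {0})"
      using null by (intro emeasure_Diff_null_set[symmetric]) auto
    also have "\<dots> \<le> ennreal M * ennreal (104 * s)"
    proof (rule emeasure_ball_le[OF \<nu>])
      fix b :: complex assume b: "b \<in> disk - {0}"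
      then show cs: "carleson_square b \<in> sets \<nu>" by (intro carleson_square_in_sets[OF \<nu>]) auto
      then show "emeasure \<nu> (carleson_square b) \<le> ennreal M * ennreal (1 - norm b)"
        using tent[OF b] em[of "carleson_square b"] M b by (simp add: \<nu> sets_radial_measure ennreal_mult)
    qed (use s in auto)
    finally show ?thesis .
  qed
  \<comment> \<open>Used with \<open>s = 2\<close> and \<open>B = 2\<close>, where
    \<open>2 * B = 2 powr s\<close> exactly; \<open>832 = 104 * 8\<close>.\<close>
  have "(\<integral>\<^sup>+w. ennreal (((1 - norm z) / norm (1 - cnj z * w)) powr 2) \<partial>\<nu>) \<le> ennreal (104 * M * (1 - norm z)) * ennreal (2 * 2\<^sup>2)"
  proof (rule nn_integral_dyadic_geometric[OF \<nu> z])
    fix k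
    have "emeasure \<nu> (disk \<inter> ball (apex z) (2 ^ k * (1 - norm z))) \<le> ennreal M * ennreal (104 * (2 ^ k * (1 - norm z)))"
      using z by (intro ball) auto
    also have "\<dots> = ennreal (104 * M * (1 - norm z)) * ennreal (2 ^ k)"
      using M z by (simp add: ennreal_mult[symmetric] mult_ac)
    finally show "emeasure \<nu> (disk \<inter> ball (apex z) (2 ^ k * (1 - norm z))) \<le> ennreal (104 * M * (1 - norm z)) * ennreal (2 ^ k)" .
  qed auto
  also have "\<dots> = ennreal (832 * M * (1 - norm z))"
    using M z by (subst ennreal_mult[symmetric]) auto
  also have "(\<integral>\<^sup>+w. ennreal (((1 - norm z) / norm (1 - cnj z * w)) powr 2) \<partial>\<nu>)
      = (\<integral>\<^sup>+w. ennreal (norm (f w) powr p) * ennreal (((1 - norm z) / norm (1 - cnj z * w)) powr 2) \<partial>W)"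
    unfolding \<nu>_def by (rule nn_integral_density) auto
  finally show ?thesis using z by (simp add: mult.commute powr_numeral)
qed

text \<open>Dropping the restriction to the annulus turns \<open>pointwise_estimate\<close> into a
  full kernel integral; the factor \<open>1 / (1 - norm z)\<close> left over cancels the height in
  \<open>kernel_integral\<close>.\<close>

lemma growth:
  assumes f: "f holomorphic_on disk" and p: "p > 0" and M: "M \<ge> 0" and z: "norm z < 1"
    and tent: "\<And>b. b \<in> disk - {0} \<Longrightarrow>
      (\<integral>\<^sup>+w\<in>carleson_square b. ennreal (norm (f w) powr p) \<partial>W) \<le> ennreal (M * (1 - norm b))"
  shows "norm (f z) powr p * H (1 - norm z) \<le> 832 * pointwise_const * M"
proof -
  let ?h = "1 - norm z"
  have h: "?h > 0" using z by simp
  have [measurable]: "f \<in> borel_measurable W" "(\<lambda>w. w) \<in> borel_measurable W"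
    by (rule holomorphic_measurable[OF sets_radial_measure f])
      (rule holomorphic_measurable[OF sets_radial_measure holomorphic_on_ident])
  have "ennreal (norm (f z) powr p * H ?h) \<le> ennreal pointwise_const *
    (\<integral>\<^sup>+w. ennreal (?h / (norm (1 - cnj z * w))\<^sup>2 * norm (f w) powr p)
        * indicator {w. ?h / (2 * K) \<le> 1 - norm w \<and> 1 - norm w \<le> ?h / 2} w \<partial>W)"
    unfolding pointwise_const_def by (rule pointwise_estimate[OF f z p])
  also have "\<dots> \<le> ennreal pointwise_const * (\<integral>\<^sup>+w. ennreal (1 / ?h) * (ennreal ((?h / norm (1 - cnj z * w))\<^sup>2) * ennreal (norm (f w) powr p)) \<partial>W)"
  proof (intro mult_left_mono nn_integral_mono)
    fix w
    have "?h / (norm (1 - cnj z * w))\<^sup>2 * norm (f w) powr p = 1 / ?h * ((?h / norm (1 - cnj z * w))\<^sup>2 * norm (f w) powr p)"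
    proof -
      have "h / n\<^sup>2 * x = 1 / h * ((h / n)\<^sup>2 * x)" if "h \<noteq> 0" for h n x :: real
        using that by (simp add: power_divide power2_eq_square)
      from this[of ?h] show ?thesis using h by simp
    qed
    moreover have "ennreal (1 / ?h) * (ennreal a * ennreal b) = ennreal (1 / ?h * (a * b))" if "a \<ge> 0" "b \<ge> 0" for a b
      using h that by (subst ennreal_mult) (auto simp: ennreal_mult)
    ultimately show "ennreal (?h / (norm (1 - cnj z * w))\<^sup>2 * norm (f w) powr p)
        * indicator {w. ?h / (2 * K) \<le> 1 - norm w \<and> 1 - norm w \<le> ?h / 2} w
      \<le> ennreal (1 / ?h) * (ennreal ((?h / norm (1 - cnj z * w))\<^sup>2) * ennreal (norm (f w) powr p))"
      by (simp only: zero_le_power2 powr_ge_zero) (simp split: split_indicator)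
  qed simp
  also have "\<dots> = ennreal pointwise_const * (ennreal (1 / ?h) * (\<integral>\<^sup>+w. ennreal ((?h / norm (1 - cnj z * w))\<^sup>2) * ennreal (norm (f w) powr p) \<partial>W))"
    by (subst nn_integral_cmult) auto
  also have "\<dots> \<le> ennreal pointwise_const * (ennreal (1 / ?h) * ennreal (832 * M * ?h))"
    by (intro mult_left_mono kernel_integral[OF f M z tent]) auto
  also have "\<dots> = ennreal (832 * pointwise_const * M)"
    using h pointwise_const_pos M by (simp add: ennreal_mult[symmetric])
  finally show ?thesis using pointwise_const_pos M by (simp add: ennreal_le_iff)
qed

text \<open>The number of doublings that takes scale \<open>h\<close> past \<open>3 * K * h\<close>,
  the largest height of a disk centre in \<open>annulus_mass\<close>.\<close>

definition doubling_exponent :: nat where "doubling_exponent = (LEAST m. 3 * K \<le> 2 ^ m)"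

lemma doubling_exponent: "3 * K \<le> 2 ^ doubling_exponent"
  unfolding doubling_exponent_def by (rule LeastI_ex) (metis real_arch_pow one_less_numeral_iff semiring_norm(76) less_imp_le)

text \<open>The height factor \<open>3 * K * h\<close> times the area factor
  \<open>24 * K * (2 + 3 * K) * h\<close>, divided by \<open>(\<delta> * h)\<^sup>2\<close>; the
  last factor compares \<open>H (3 * K * h)\<close> with \<open>H h\<close>.\<close>

definition annulus_const :: "real \<Rightarrow> real \<Rightarrow> real" where
  "annulus_const \<delta> \<gamma> = 72 * K\<^sup>2 * (2 + 3 * K) / \<delta>\<^sup>2 * (D ^ doubling_exponent) powr \<gamma>"

text \<open>Here \<open>1024 * K\<close> is \<open>2 * K\<close> from comparing heights times
  \<open>512\<close> from \<open>annulus_kernel_integral\<close>, and the power of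
  \<open>832 * pointwise_const\<close> stems from \<open>growth\<close>.\<close>

definition carleson_const :: "real \<Rightarrow> real \<Rightarrow> real" where
  "carleson_const \<delta> \<gamma> = 1024 * K * annulus_const \<delta> \<gamma> * (832 * pointwise_const) powr \<gamma>"

end

text \<open>The growth condition with constant \<open>\<epsilon>\<close> at heights below
  \<open>\<tau>\<close>, for Euclidean disks, which sit inside pseudo-hyperbolic ones and are easy
  to average over. Sigma-finiteness is there for Fubini.\<close>

locale vanishing_growth = doubling_weight g D K \<kappa> + sigma_finite_measure \<mu>
  for g D K \<kappa> and \<mu> :: "complex measure" +
  fixes p q \<delta> \<epsilon> \<tau> :: real
  assumes sets_\<mu>: "sets \<mu> = sets (restrict_space borel disk)"
    and p: "p > 0" and pq: "p \<le> q" and \<delta>: "0 < \<delta>" "\<delta> < 1" and \<epsilon>: "\<epsilon> \<ge> 0"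
    and mass: "norm u < 1 \<Longrightarrow> 1 - norm u < \<tau> \<Longrightarrow>
      emeasure \<mu> (disk \<inter> ball u (\<delta> * (1 - norm u))) \<le> ennreal (\<epsilon> * H (1 - norm u) powr (q / p) * (1 - norm u))"
begin

lemma space_\<mu>: "space \<mu> = disk" by (rule space_eq_disk[OF sets_\<mu>])

lemma id_measurable_\<mu> [measurable]: "(\<lambda>z. z) \<in> borel_measurable \<mu>"
  by (rule holomorphic_measurable[OF sets_\<mu> holomorphic_on_ident])

lemma annulus_const_pos: "annulus_const \<delta> \<gamma> > 0"
  using \<delta> K D by (auto simp: annulus_const_def intro!: mult_pos_pos divide_pos_pos)

text \<open>In polar coordinates the radial extent is at most \<open>3 * K * h\<close>. Pushing a
  point to the circle moves it by at most that much, so the directions stay within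
  \<open>(2 + 3 * K) * s\<close> of \<open>\<zeta>\<close>.\<close>

lemma area_le:
  assumes "h > 0" "s \<ge> h" "norm (\<zeta> :: complex) = 1"
  shows "emeasure lborel {u. norm u < 1 \<and> 1 - norm u \<le> 3 * K * h \<and> norm (u - \<zeta>) < 2 * s} \<le> ennreal (24 * K * (2 + 3 * K) * h * s)"
proof -
  define Z where "Z = {u :: complex. norm u < 1 \<and> 1 - norm u \<le> 3 * K * h \<and> norm (u - \<zeta>) < 2 * s}"
  have Zb [measurable]: "Z \<in> sets borel" unfolding Z_def by measurable
  let ?s = "(2 + 3 * K) * s"
  have s: "s > 0" using assms by simp
  then have s': "?s > 0" using K by simp
  have "emeasure lborel Z = (\<integral>\<^sup>+z. indicator Z z \<partial>lborel)" by simp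
  also have "\<dots> = (\<integral>\<^sup>+t\<in>{0..<2*pi}. (\<integral>\<^sup>+\<rho>\<in>{0<..}. ennreal \<rho> * indicator Z (of_real \<rho> * cis t) \<partial>lborel) \<partial>lborel)"
    by (rule nn_integral_polar) simp
  also have "\<dots> \<le> (\<integral>\<^sup>+t\<in>{0..<2*pi}. (indicator {t. norm (cis t - \<zeta>) < ?s} t * ennreal (3 * K * h)) \<partial>lborel)"
  proof (intro nn_integral_mono mult_right_mono)
    fix t
    have in_Z: "\<rho> \<in> {1 - 3 * K * h..1} \<and> norm (cis t - \<zeta>) < ?s" if "\<rho> > 0" "of_real \<rho> * cis t \<in> Z" for \<rho>
    proof -
      have r: "\<rho> < 1" "1 - \<rho> \<le> 3 * K * h" "norm (of_real \<rho> * cis t - \<zeta>) < 2 * s"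
        using that by (auto simp: Z_def norm_mult)
      have "cis t - \<zeta> = of_real (1 - \<rho>) * cis t + (of_real \<rho> * cis t - \<zeta>)" by (simp add: algebra_simps)
      then have "norm (cis t - \<zeta>) \<le> norm (of_real (1 - \<rho>) * cis t) + norm (of_real \<rho> * cis t - \<zeta>)"
        by (metis norm_triangle_ineq)
      also have "norm (of_real (1 - \<rho>) * cis t) = 1 - \<rho>"
        using r unfolding norm_mult norm_of_real by simp
      also have "1 - \<rho> + norm (of_real \<rho> * cis t - \<zeta>) < 3 * K * h + 2 * s" using r by simp
      also have "3 * K * h \<le> 3 * K * s" using assms K by (intro mult_left_mono) auto
      finally show ?thesis using r by (simp add: algebra_simps)
    qed
    have "(\<integral>\<^sup>+\<rho>\<in>{0<..}. ennreal \<rho> * indicator Z (of_real \<rho> * cis t) \<partial>lborel)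
        \<le> (\<integral>\<^sup>+\<rho>. indicator {t. norm (cis t - \<zeta>) < ?s} t * indicator {1 - 3 * K * h..1} \<rho> \<partial>lborel)"
      using in_Z by (intro nn_integral_mono) (auto split: split_indicator simp: ennreal_le_1)
    also have "\<dots> = indicator {t. norm (cis t - \<zeta>) < ?s} t * ennreal (3 * K * h)"
      using assms K by (subst nn_integral_cmult) auto
    finally show "(\<integral>\<^sup>+\<rho>\<in>{0<..}. ennreal \<rho> * indicator Z (of_real \<rho> * cis t) \<partial>lborel)
        \<le> indicator {t. norm (cis t - \<zeta>) < ?s} t * ennreal (3 * K * h)" .
  qed simp
  also have "\<dots> = (\<integral>\<^sup>+t. ennreal (3 * K * h) * (indicator {t. norm (cis t - \<zeta>) < ?s} t * indicator {0..<2*pi} t) \<partial>lborel)"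
    by (simp add: mult_ac)
  also have "\<dots> = ennreal (3 * K * h) * (\<integral>\<^sup>+t\<in>{0..<2*pi}. indicator {t. norm (cis t - \<zeta>) < ?s} t \<partial>lborel)"
    by (rule nn_integral_cmult) measurable
  also have "\<dots> \<le> ennreal (3 * K * h) * ennreal (8 * ?s)"
    by (intro mult_left_mono emeasure_arc_le assms s') simp
  also have "\<dots> = ennreal (24 * K * (2 + 3 * K) * h * s)"
    using assms K s by (subst ennreal_mult[symmetric]) (auto simp: mult_ac)
  finally show ?thesis unfolding Z_def .
qed

text \<open>Averaging over Lebesgue measure instead of covering by disks: every point of \<open>Z\<close> lies in the
  disk of radius \<open>\<delta> * h\<close> about each \<open>u\<close> in a set of area at least \<open>(\<delta> * h)\<^sup>2\<close>.\<close>

lemma annulus_mass: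
  assumes h: "h > 0" and s: "s \<ge> h" and \<zeta>: "norm (\<zeta> :: complex) = 1" and Z: "Z \<in> sets borel"
    and sub: "\<And>z. z \<in> Z \<Longrightarrow> norm z < 1 \<and> 2 * h \<le> 1 - norm z \<and> 1 - norm z \<le> 2 * K * h \<and> 1 - norm z < \<tau> / 2 \<and> norm (z - \<zeta>) < s"
  shows "emeasure \<mu> Z \<le> ennreal (annulus_const \<delta> (q / p) * \<epsilon> * H h powr (q / p) * s)"
proof -
  note [measurable] = Z
  let ?e = "\<delta> * h"
  have e: "?e > 0" "?e < h" using \<delta> h by auto
  define V where "V = {u :: complex. norm u < 1 \<and> 1 - norm u \<le> 3 * K * h \<and> norm (u - \<zeta>) < 2 * s}"
  have [measurable]: "V \<in> sets borel" unfolding V_def by measurable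
  \<comment> \<open>A common bound for the mass of all the averaging disks, since their centres have
    height at most \<open>3 * K * h\<close>.\<close>
  define B where "B = \<epsilon> * H (3 * K * h) powr (q / p) * (3 * K * h)"
  have B0: "B \<ge> 0" using \<epsilon> h K by (auto simp: B_def)
  have Zs: "Z \<subseteq> disk" using sub by auto
  then have [measurable]: "Z \<in> sets \<mu>" by (rule borel_subset_disk[OF sets_\<mu> Z])
  interpret P: pair_sigma_finite \<mu> "lborel :: complex measure" ..
  have "emeasure \<mu> Z * ennreal (?e\<^sup>2) = (\<integral>\<^sup>+z. indicator Z z * ennreal (?e\<^sup>2) \<partial>\<mu>)"
    by (simp add: nn_integral_multc)
  also have "\<dots> \<le> (\<integral>\<^sup>+z. (\<integral>\<^sup>+u. indicator Z z * indicator {u. dist z u < ?e} u \<partial>lborel) \<partial>\<mu>)"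
  proof (rule nn_integral_mono)
    fix z :: complex
    have "ennreal (?e\<^sup>2) \<le> emeasure lborel (ball z ?e)"
    proof -
      have "emeasure lborel (ball z ?e) = ennreal (pi * ?e\<^sup>2)"
        using e by (simp add: emeasure_ball unit_ball_vol_2)
      moreover have "1 * ?e\<^sup>2 \<le> pi * ?e\<^sup>2" using pi_gt3 by (intro mult_right_mono) auto
      ultimately show ?thesis by (simp add: ennreal_leI)
    qed
    then show "indicator Z z * ennreal (?e\<^sup>2) \<le> (\<integral>\<^sup>+u. indicator Z z * indicator {u. dist z u < ?e} u \<partial>lborel)"
      by (subst nn_integral_cmult) (auto simp: ball_def[symmetric] intro!: mult_left_mono)
  qed
  also have "\<dots> = (\<integral>\<^sup>+u. (\<integral>\<^sup>+z. indicator Z z * indicator {u. dist z u < ?e} u \<partial>\<mu>) \<partial>lborel)"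
    by (rule P.Fubini'[symmetric]) measurable
  also have "\<dots> \<le> (\<integral>\<^sup>+u. ennreal B * indicator V u \<partial>lborel)"
  proof (rule nn_integral_mono)
    fix u :: complex
    show "(\<integral>\<^sup>+z. indicator Z z * indicator {u. dist z u < ?e} u \<partial>\<mu>) \<le> ennreal B * indicator V u"
    proof (cases "\<exists>z\<in>Z. dist z u < ?e")
      case True
      then obtain z where z: "z \<in> Z" "dist z u < ?e" by blast
      \<comment> \<open>Heights of \<open>z\<close> and \<open>u\<close> differ by less than
        \<open>h\<close>. The lower bound \<open>2 * h\<close> on the height of \<open>z\<close>
        leaves \<open>u\<close> at least \<open>h\<close>, and \<open>\<tau> / 2\<close> keeps it
        below \<open>\<tau>\<close>, where \<open>mass\<close> applies.\<close>
      have n: "\<bar>norm z - norm u\<bar> < ?e" using norm_triangle_ineq3[of z u] z by (simp add: dist_norm)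
      have zz: "norm z < 1" "2 * h \<le> 1 - norm z" "1 - norm z \<le> 2 * K * h" "1 - norm z < \<tau> / 2" "norm (z - \<zeta>) < s"
        using sub[OF z(1)] by auto
      have hK: "h \<le> K * h" using K h by simp
      have u: "norm u < 1" "h \<le> 1 - norm u" "1 - norm u \<le> 3 * K * h" "1 - norm u < \<tau>"
        using n zz e hK by auto
      have "norm (u - \<zeta>) \<le> norm (z - \<zeta>) + dist z u"
        using norm_triangle_ineq[of "z - \<zeta>" "u - z"] by (simp add: dist_norm norm_minus_commute)
      then have V: "u \<in> V" using u zz z e s by (simp add: V_def)
      have "?e \<le> \<delta> * (1 - norm u)" using u \<delta> by (intro mult_left_mono) auto
      then have "(\<integral>\<^sup>+z. indicator Z z * indicator {u. dist z u < ?e} u \<partial>\<mu>)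
          \<le> (\<integral>\<^sup>+z. indicator (disk \<inter> ball u (\<delta> * (1 - norm u))) z \<partial>\<mu>)"
        by (intro nn_integral_mono) (auto split: split_indicator simp: space_\<mu> dist_commute)
      also have "\<dots> = emeasure \<mu> (disk \<inter> ball u (\<delta> * (1 - norm u)))"
        by (rule nn_integral_indicator) (auto simp: sets_\<mu> sets_restrict_space)
      also have "\<dots> \<le> ennreal (\<epsilon> * H (1 - norm u) powr (q / p) * (1 - norm u))"
        using u by (intro mass)
      also have "\<dots> \<le> ennreal B"
        unfolding B_def using u \<epsilon> p pq h H_pos[of "1 - norm u"] H_mono[of "1 - norm u" "3 * K * h"]
        by (intro ennreal_leI mult_mono powr_mono2 mult_left_mono mult_nonneg_nonneg) auto
      finally show ?thesis using V by simp
    next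
      case False
      then have "(\<integral>\<^sup>+z. indicator Z z * indicator {u. dist z u < ?e} u \<partial>\<mu>) = (\<integral>\<^sup>+z. 0 \<partial>\<mu>)"
        by (intro nn_integral_cong) (auto split: split_indicator)
      then show ?thesis by simp
    qed
  qed
  also have "\<dots> = ennreal B * emeasure lborel V" by (simp add: nn_integral_cmult)
  also have "\<dots> \<le> ennreal B * ennreal (24 * K * (2 + 3 * K) * h * s)"
    unfolding V_def using area_le[OF h s \<zeta>] by (intro mult_left_mono) auto
  also have "\<dots> = ennreal (B * (24 * K * (2 + 3 * K) * h * s))"
    using B0 K h s by (intro ennreal_mult[symmetric]) auto
  also have "\<dots> \<le> ennreal (annulus_const \<delta> (q / p) * \<epsilon> * H h powr (q / p) * s * ?e\<^sup>2)"
  proof (rule ennreal_leI)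
    have "H (3 * K * h) \<le> H (2 ^ doubling_exponent * h)" using doubling_exponent K h by (intro H_mono) auto
    also have "\<dots> \<le> D ^ doubling_exponent * H h" by (rule H_power[OF h])
    finally have "H (3 * K * h) powr (q / p) \<le> (D ^ doubling_exponent * H h) powr (q / p)"
      using H_pos[of "3 * K * h"] K h p pq by (intro powr_mono2) auto
    also have "\<dots> = (D ^ doubling_exponent) powr (q / p) * H h powr (q / p)" using D H_pos[OF h] by (intro powr_mult) 
    finally have "B \<le> \<epsilon> * ((D ^ doubling_exponent) powr (q / p) * H h powr (q / p)) * (3 * K * h)"
      unfolding B_def using \<epsilon> K h by (intro mult_right_mono mult_left_mono) auto
    then have "B * (24 * K * (2 + 3 * K) * h * s) \<le> \<epsilon> * ((D ^ doubling_exponent) powr (q / p) * H h powr (q / p)) * (3 * K * h) * (24 * K * (2 + 3 * K) * h * s)"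
      using K h s by (intro mult_right_mono) auto
    also have "\<dots> = annulus_const \<delta> (q / p) * \<epsilon> * H h powr (q / p) * s * ?e\<^sup>2"
      using \<delta> by (simp add: annulus_const_def power2_eq_square field_simps)
    finally show "B * (24 * K * (2 + 3 * K) * h * s) \<le> annulus_const \<delta> (q / p) * \<epsilon> * H h powr (q / p) * s * ?e\<^sup>2" .
  qed
  also have "\<dots> = ennreal (annulus_const \<delta> (q / p) * \<epsilon> * H h powr (q / p) * s) * ennreal (?e\<^sup>2)"
    using \<epsilon> h s by (intro ennreal_mult mult_nonneg_nonneg less_imp_le[OF annulus_const_pos]) auto
  finally have "ennreal (?e\<^sup>2) * emeasure \<mu> Z \<le> ennreal (?e\<^sup>2) * ennreal (annulus_const \<delta> (q / p) * \<epsilon> * H h powr (q / p) * s)"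
    by (simp only: mult.commute)
  moreover have "ennreal (?e\<^sup>2) \<noteq> 0" "ennreal (?e\<^sup>2) \<noteq> top" using e by auto
  ultimately show ?thesis
    using ennreal_mult_le_mult_iff[of "ennreal (?e\<^sup>2)" "emeasure \<mu> Z"] by blast
qed


text \<open>If \<open>w\<close> is far from \<open>carleson_square a\<close>, the kernel is essentially constant on \<open>Z\<close>; otherwise the
  quotient on the right is bounded below and a dyadic decomposition around \<open>w\<close> applies.\<close>

lemma annulus_kernel_integral:
  assumes w: "norm w < 1" and a: "a \<noteq> 0" "norm a < 1"
    and Z: "Z \<in> sets borel" "Z \<subseteq> carleson_square a"
    and sub: "\<And>z. z \<in> Z \<Longrightarrow> 2 * (1 - norm w) \<le> 1 - norm z \<and> 1 - norm z \<le> 2 * K * (1 - norm w) \<and> 1 - norm z < \<tau> / 2"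
  shows "(\<integral>\<^sup>+z\<in>Z. ennreal (((1 - norm w) / norm (1 - cnj w * z))\<^sup>2) \<partial>\<mu>)
    \<le> ennreal (512 * annulus_const \<delta> (q / p) * \<epsilon> * H (1 - norm w) powr (q / p) * (1 - norm w) * ((1 - norm a) / norm (1 - cnj a * w))\<^sup>2)"
proof -
  define h where "h = 1 - norm w"
  define k where "k = 1 - norm a"
  define X where "X = annulus_const \<delta> (q / p) * \<epsilon> * H h powr (q / p)"
  have h: "h > 0" and k: "k > 0" using w a by (auto simp: h_def k_def)
  have X: "X \<ge> 0" unfolding X_def using \<epsilon> by (intro mult_nonneg_nonneg less_imp_le[OF annulus_const_pos]) auto
  note [measurable] = Z(1)
  have Zd: "Z \<subseteq> disk" using Z(2) carleson_square_subset by blast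
  have [measurable]: "Z \<in> sets \<mu>" by (rule borel_subset_disk[OF sets_\<mu> Z(1) Zd])
  have Zball: "norm (z - apex a) < 2 * k" if "z \<in> Z" for z
    using carleson_square_subset_ball[OF a] Z(2) that by (auto simp: k_def dist_norm norm_minus_commute subset_iff)
  have sub': "2 * h \<le> 1 - norm z" "1 - norm z \<le> 2 * K * h" "1 - norm z < \<tau> / 2" "norm z < 1" if "z \<in> Z" for z
    using sub[OF that] Zd that by (auto simp: h_def)
  have pos: "norm (1 - cnj a * w) > 0" using one_minus_cnj_pos[of w a] w a by simp
  have "(\<integral>\<^sup>+z\<in>Z. ennreal ((h / norm (1 - cnj w * z))\<^sup>2) \<partial>\<mu>) \<le> ennreal (512 * X * h * (k / norm (1 - cnj a * w))\<^sup>2)"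
  \<comment> \<open>In the near case the quotient on the right exceeds \<open>1 / 8\<close>, so the
    dyadic constant \<open>8\<close> is absorbed by \<open>512 = 8 * 64\<close>.\<close>
  proof (cases "norm (1 - cnj a * w) < 8 * k")
    case True
    define \<nu> where "\<nu> = density \<mu> (indicator Z)"
    have \<nu>: "sets \<nu> = sets (restrict_space borel disk)" by (simp add: \<nu>_def sets_\<mu>)
    have "(\<integral>\<^sup>+z. ennreal (((1 - norm w) / norm (1 - cnj w * z)) powr 2) \<partial>\<nu>) \<le> ennreal (X * h) * ennreal (2 * 2\<^sup>2)"
    proof (rule nn_integral_dyadic_geometric[OF \<nu> w])
      fix j
      have le: "h \<le> 2 ^ j * h" using h by simp
      have "emeasure \<nu> (disk \<inter> ball (apex w) (2 ^ j * (1 - norm w))) = (\<integral>\<^sup>+z. indicator Z z * indicator (disk \<inter> ball (apex w) (2 ^ j * h)) z \<partial>\<mu>)"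
        unfolding \<nu>_def h_def by (rule emeasure_density) (auto simp: sets_\<mu> sets_restrict_space)
      also have "\<dots> = (\<integral>\<^sup>+z. indicator (Z \<inter> ball (apex w) (2 ^ j * h)) z \<partial>\<mu>)"
        using Zd by (intro nn_integral_cong) (auto split: split_indicator)
      also have "\<dots> = emeasure \<mu> (Z \<inter> ball (apex w) (2 ^ j * h))"
        using Zd Z(1) by (intro nn_integral_indicator borel_subset_disk[OF sets_\<mu>]) auto
      also have "\<dots> \<le> ennreal (annulus_const \<delta> (q / p) * \<epsilon> * H h powr (q / p) * (2 ^ j * h))"
        using sub' Z(1) le h by (intro annulus_mass[where \<zeta> = "apex w"]) (auto simp: dist_norm norm_minus_commute)
      also have "\<dots> = ennreal (X * h) * ennreal (2 ^ j)"
      proof -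
        have "annulus_const \<delta> (q / p) * \<epsilon> * H h powr (q / p) * (2 ^ j * h) = X * h * 2 ^ j" by (simp add: X_def mult_ac)
        moreover have "ennreal (X * h * 2 ^ j) = ennreal (X * h) * ennreal (2 ^ j)"
          using X h by (intro ennreal_mult) auto
        ultimately show ?thesis by (simp only:)
      qed
      finally show "emeasure \<nu> (disk \<inter> ball (apex w) (2 ^ j * (1 - norm w))) \<le> ennreal (X * h) * ennreal (2 ^ j)" .
    qed auto
    also have "(\<integral>\<^sup>+z. ennreal (((1 - norm w) / norm (1 - cnj w * z)) powr 2) \<partial>\<nu>)
        = (\<integral>\<^sup>+z. indicator Z z * ennreal ((h / norm (1 - cnj w * z))\<^sup>2) \<partial>\<mu>)"
      unfolding \<nu>_def using w by (subst nn_integral_density) (auto simp: h_def powr_numeral)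
    finally have "(\<integral>\<^sup>+z\<in>Z. ennreal ((h / norm (1 - cnj w * z))\<^sup>2) \<partial>\<mu>) \<le> ennreal (X * h) * ennreal 8"
      by (simp add: mult.commute)
    also have "\<dots> = ennreal (X * h * 8)" using X h by (intro ennreal_mult[symmetric]) auto
    also have "\<dots> \<le> ennreal (512 * X * h * (k / norm (1 - cnj a * w))\<^sup>2)"
    proof (rule ennreal_leI)
      have "1 / 8 \<le> k / norm (1 - cnj a * w)" using True pos k by (simp add: field_simps)
      then have "(1 / 8)\<^sup>2 \<le> (k / norm (1 - cnj a * w))\<^sup>2" by (intro power_mono) auto
      then have "512 * X * h * (1 / 8)\<^sup>2 \<le> 512 * X * h * (k / norm (1 - cnj a * w))\<^sup>2"
        using X h by (intro mult_left_mono) auto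
      then show "X * h * 8 \<le> 512 * X * h * (k / norm (1 - cnj a * w))\<^sup>2" by (simp add: power2_eq_square)
    qed
    finally show ?thesis .
  next
    case far: False
    show ?thesis
    proof (cases "Z = {}")
      case False
      then obtain z0 where z0: "z0 \<in> Z" by blast
      obtain \<rho> t where "z0 = of_real \<rho> * cis t" "norm a \<le> \<rho>"
        using z0 Z(2) a by (auto simp: carleson_square_def)
      then have "norm a \<le> norm z0" using norm_ge_zero[of a] by (auto simp: norm_mult simp del: norm_ge_zero)
      \<comment> \<open>A single point of \<open>Z\<close> in the square forces
        \<open>2 * h \<le> k\<close>. So \<open>2 * k\<close> is an admissible radius in
        \<open>annulus_mass\<close>, and one factor \<open>h\<close> may later be traded for
        \<open>k\<close>.\<close>
      then have hk: "h \<le> k" "h \<le> 2 * k" using sub'(1)[OF z0] h k by (auto simp: k_def)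
      define N where "N = norm (1 - cnj a * w)"
      \<comment> \<open>Replacing \<open>a\<close> by \<open>z\<close> changes the denominator by at
        most \<open>3 * k\<close>, which is less than half of \<open>N \<ge> 8 * k\<close>.\<close>
      have pt: "(h / norm (1 - cnj w * z))\<^sup>2 \<le> 4 * (h / N)\<^sup>2" if z: "z \<in> Z" for z
      proof -
        have "norm (z - a) \<le> norm (z - apex a) + norm (apex a - a)"
          using norm_triangle_ineq[of "z - apex a" "apex a - a"] by simp
        then have za: "norm (z - a) \<le> 3 * k" using Zball[OF z] norm_apex_diff[OF a(2)] by (simp add: k_def)
        have "1 - cnj a * w = (1 - cnj z * w) + cnj (z - a) * w" by (simp add: algebra_simps)
        then have "N \<le> norm (1 - cnj z * w) + norm (cnj (z - a) * w)"
          unfolding N_def by (metis norm_triangle_ineq)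
        also have "norm (cnj (z - a) * w) \<le> 3 * k * 1"
          unfolding norm_mult complex_mod_cnj using za w k by (intro mult_mono) auto
        also have "norm (1 - cnj z * w) = norm (1 - cnj w * z)" by (rule norm_one_minus_cnj_commute)
        finally have "N \<le> norm (1 - cnj w * z) + 3 * k * 1" by simp
        moreover have "8 * k \<le> N" using far unfolding N_def by simp
        ultimately have "N / 2 \<le> norm (1 - cnj w * z)" using k by linarith
        then have "h / norm (1 - cnj w * z) \<le> h / (N / 2)"
          using pos h by (intro divide_left_mono mult_pos_pos) (auto simp: N_def)
        then have "(h / norm (1 - cnj w * z))\<^sup>2 \<le> (h / (N / 2))\<^sup>2" using h by (intro power_mono) auto
        then show ?thesis by (simp add: power_divide mult.commute)
      qed
      have "(\<integral>\<^sup>+z\<in>Z. ennreal ((h / norm (1 - cnj w * z))\<^sup>2) \<partial>\<mu>) \<le> (\<integral>\<^sup>+z. ennreal (4 * (h / N)\<^sup>2) * indicator Z z \<partial>\<mu>)"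
        using pt by (intro nn_integral_mono) (auto intro!: ennreal_leI split: split_indicator)
      also have "\<dots> = ennreal (4 * (h / N)\<^sup>2) * emeasure \<mu> Z"
        by (rule nn_integral_cmult_indicator) simp
      also have "\<dots> \<le> ennreal (4 * (h / N)\<^sup>2) * ennreal (annulus_const \<delta> (q / p) * \<epsilon> * H h powr (q / p) * (2 * k))"
        using sub' Zball h hk Z(1) by (intro mult_left_mono annulus_mass[where \<zeta> = "apex a"]) auto
      also have "\<dots> = ennreal (4 * (h / N)\<^sup>2 * (X * (2 * k)))"
        unfolding X_def[symmetric] using X k by (intro ennreal_mult[symmetric]) auto
      also have "\<dots> \<le> ennreal (512 * X * h * (k / N)\<^sup>2)"
      proof (rule ennreal_leI)
        have "4 * (h / N)\<^sup>2 * (X * (2 * k)) = 8 * X * h * (1 / N)\<^sup>2 * (h * k)"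
          by (simp add: power2_eq_square)
        also have "\<dots> \<le> 8 * X * h * (1 / N)\<^sup>2 * (k * k)"
          using X h k hk by (intro mult_left_mono mult_right_mono) auto
        also have "\<dots> = 8 * (X * h * (k / N)\<^sup>2)" by (simp add: power2_eq_square)
        also have "\<dots> \<le> 512 * (X * h * (k / N)\<^sup>2)" using X h by (intro mult_right_mono) auto
        finally show "4 * (h / N)\<^sup>2 * (X * (2 * k)) \<le> 512 * X * h * (k / N)\<^sup>2" by (simp add: mult_ac)
      qed
      finally show ?thesis by (simp add: N_def)
    qed simp
  qed
  then show ?thesis by (simp add: h_def k_def X_def mult_ac)
qed

text \<open>Truncation at height \<open>\<tau> / 2\<close> keeps all averaging disks of
  \<open>annulus_mass\<close> in the range of the growth condition; what lies deeper is added in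
  \<open>tent_sup_le\<close>.\<close>

lemma carleson_integral_estimate:
  assumes f: "f holomorphic_on disk" and M: "M \<ge> 0" and a: "a \<in> disk - {0}"
    and tent: "\<And>b. b \<in> disk - {0} \<Longrightarrow>
      (\<integral>\<^sup>+w\<in>carleson_square b. ennreal (norm (f w) powr p) \<partial>W) \<le> ennreal (M * (1 - norm b))"
  shows "(\<integral>\<^sup>+z\<in>carleson_square a \<inter> {z. 1 - norm z < \<tau> / 2}. ennreal (norm (f z) powr q) \<partial>\<mu>)
    \<le> ennreal (carleson_const \<delta> (q / p) * \<epsilon> * M powr (q / p) * (1 - norm a))"
proof -
  define G where "G = 832 * pointwise_const * M"
  have G: "G \<ge> 0" using pointwise_const_pos M by (simp add: G_def)
  \<comment> \<open>Raising the growth bound \<open>norm (f z) powr p \<le> G / H\<close> to the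
    power \<open>(q - p) / p\<close> bounds \<open>norm (f z) powr (q - p)\<close>, with
    \<open>c\<close> as the constant part.\<close>
  define c where "c = G powr ((q - p) / p)"
  define E where "E = carleson_square a \<inter> {z. 1 - norm z < \<tau> / 2}"
  have Ed: "E \<subseteq> disk" using carleson_square_subset by (auto simp: E_def)
  have "{z :: complex. 1 - norm z < \<tau> / 2} \<in> sets borel" by measurable
  then have E [measurable]: "E \<in> sets borel" unfolding E_def using a by (intro sets.Int borel_carleson_square) auto
  have [measurable]: "E \<in> sets \<mu>" by (rule borel_subset_disk[OF sets_\<mu> E Ed])
  have fW [measurable]: "f \<in> borel_measurable W" and idW [measurable]: "(\<lambda>w. w) \<in> borel_measurable W"
    by (rule holomorphic_measurable[OF sets_radial_measure f])
      (rule holomorphic_measurable[OF sets_radial_measure holomorphic_on_ident])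
  have Wsp: "space W = disk" by (rule space_eq_disk[OF sets_radial_measure])
  \<comment> \<open>The annulus of \<open>pointwise_estimate\<close>, read as a relation so that it
    can be viewed from \<open>w\<close> after the exchange.\<close>
  define A where "A z w \<longleftrightarrow> (1 - norm z) / (2 * K) \<le> 1 - norm w \<and> 1 - norm w \<le> (1 - norm z) / 2" for z w :: complex
  \<comment> \<open>A majorant of the integrand in which every height is that of \<open>w\<close>:
    on \<open>A\<close> the height of \<open>z\<close> is the larger one, by a factor at most
    \<open>2 * K\<close>, and negative powers of \<open>H\<close> decrease. For the integral over
    \<open>z\<close> only the kernel remains.\<close>
  define \<Theta> where "\<Theta> z w = ennreal (2 * K * c * pointwise_const * (H (1 - norm w) powr (- q / p) / (1 - norm w))
      * ((1 - norm w) / norm (1 - cnj w * z))\<^sup>2 * norm (f w) powr p)" for z w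
  have Hm [measurable]: "H \<in> borel_measurable borel"
  proof -
    have "H = (\<lambda>h. enn2real (\<integral>\<^sup>+s. ennreal (g s) * (if 1 - min h 1 \<le> s \<and> s < 1 then 1 else 0) \<partial>lborel))"
      unfolding H_def fun_eq_iff by (intro allI arg_cong[where f = enn2real] nn_integral_cong) (auto split: split_indicator)
    then show ?thesis by simp
  qed
  \<comment> \<open>Finite total mass makes Fubini available; the ball of radius \<open>3\<close>
    about \<open>1\<close> contains the disk.\<close>
  have "emeasure W (space W) \<le> emeasure W (disk \<inter> ball 1 3)"
  proof (rule emeasure_mono)
    have "norm (1 - z) < 3" if "norm z < 1" for z :: complex
      using norm_triangle_ineq4[of 1 z] that by simp
    then show "space W \<subseteq> disk \<inter> ball 1 3" by (auto simp: Wsp dist_norm)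
  qed (auto simp: sets_radial_measure sets_restrict_space)
  also have "\<dots> \<le> ennreal (16 * 3 * H 3)" by (rule emeasure_W_ball) auto
  finally have "finite_measure W" by (intro finite_measureI) (auto simp: top_unique)
  then interpret Wf: finite_measure W .
  interpret P: pair_sigma_finite \<mu> W ..
  have "(\<integral>\<^sup>+z\<in>E. ennreal (norm (f z) powr q) \<partial>\<mu>)
      \<le> (\<integral>\<^sup>+z. (\<integral>\<^sup>+w. indicator E z * (\<Theta> z w * indicator {w. A z w} w) \<partial>W) \<partial>\<mu>)"
  proof (rule nn_integral_mono)
    fix z assume "z \<in> space \<mu>"
    then have z: "norm z < 1" by (simp add: space_\<mu>)
    let ?h = "1 - norm z"
    have h: "?h > 0" using z by simp
    have Hz: "H ?h > 0" by (rule H_pos[OF h])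
    have gr: "norm (f z) powr p * H ?h \<le> G"
      unfolding G_def by (rule growth[OF f p M z tent])
    have "norm (f z) powr (q - p) = (norm (f z) powr p) powr ((q - p) / p)"
      using p by (simp add: powr_powr)
    also have "\<dots> \<le> (G / H ?h) powr ((q - p) / p)"
      using gr Hz p pq by (intro powr_mono2) (auto simp: field_simps)
    also have "\<dots> = c * H ?h powr (1 - q / p)"
    proof -
      have "- ((q - p) / p) = 1 - q / p" using p by (simp add: field_simps)
      then show ?thesis using powr_divide[of G "H ?h" "(q - p) / p"] powr_minus_divide[of "H ?h" "(q - p) / p"] by (simp add: c_def)
    qed
    finally have "norm (f z) powr p * norm (f z) powr (q - p) \<le> norm (f z) powr p * (c * H ?h powr (1 - q / p))"
      by (rule mult_left_mono) simp
    moreover have "norm (f z) powr p * norm (f z) powr (q - p) = norm (f z) powr q"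
      by (simp flip: powr_add)
    moreover have "H ?h powr (1 - q / p) = H ?h * H ?h powr (- q / p)"
      using Hz by (simp add: powr_diff powr_minus_divide)
    ultimately have q1: "norm (f z) powr q \<le> c * H ?h powr (- q / p) * (norm (f z) powr p * H ?h)"
      by (simp add: mult_ac)
    have "ennreal (norm (f z) powr q) \<le> ennreal (c * H ?h powr (- q / p)) * ennreal (norm (f z) powr p * H ?h)"
      using ennreal_leI[OF q1] Hz by (subst ennreal_mult[symmetric]) (auto simp: c_def)
    also have "\<dots> \<le> ennreal (c * H ?h powr (- q / p)) * (ennreal pointwise_const *
      (\<integral>\<^sup>+w. ennreal (?h / (norm (1 - cnj z * w))\<^sup>2 * norm (f w) powr p) * indicator {w. A z w} w \<partial>W))"
      unfolding A_def pointwise_const_def by (intro mult_left_mono pointwise_estimate[OF f z p]) auto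
    also have "\<dots> = (\<integral>\<^sup>+w. ennreal (c * H ?h powr (- q / p)) * (ennreal pointwise_const *
      (ennreal (?h / (norm (1 - cnj z * w))\<^sup>2 * norm (f w) powr p) * indicator {w. A z w} w)) \<partial>W)"
      unfolding A_def by (simp add: nn_integral_cmult)
    also have "\<dots> \<le> (\<integral>\<^sup>+w. \<Theta> z w * indicator {w. A z w} w \<partial>W)"
    proof (rule nn_integral_mono)
      fix w assume "w \<in> space W"
      then have w: "1 - norm w > 0" by (simp add: Wsp)
      show "ennreal (c * H ?h powr (- q / p)) * (ennreal pointwise_const * (ennreal (?h / (norm (1 - cnj z * w))\<^sup>2 * norm (f w) powr p) * indicator {w. A z w} w))
        \<le> \<Theta> z w * indicator {w. A z w} w"
      proof (cases "A z w")
        case True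
        then have A: "?h \<le> 2 * K * (1 - norm w)" "1 - norm w \<le> ?h"
          using K w h by (auto simp: A_def field_simps)
        have i1: "H ?h powr (- q / p) \<le> H (1 - norm w) powr (- q / p)"
          using A w p pq H_pos[OF w] H_mono[of "1 - norm w" ?h] by (intro powr_mono2') auto
        have i2: "?h / (norm (1 - cnj z * w))\<^sup>2 \<le> 2 * K * (1 / (1 - norm w) * ((1 - norm w) / norm (1 - cnj w * z))\<^sup>2)"
        proof -
          have "?h / (norm (1 - cnj z * w))\<^sup>2 \<le> 2 * K * (1 - norm w) / (norm (1 - cnj z * w))\<^sup>2"
            using A by (intro divide_right_mono) auto
          also have "x / N\<^sup>2 = 1 / x * (x / N)\<^sup>2" if "x \<noteq> 0" for x N :: real
            using that by (simp add: power_divide power2_eq_square)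
          then have "2 * K * (1 - norm w) / (norm (1 - cnj z * w))\<^sup>2 = 2 * K * (1 / (1 - norm w) * ((1 - norm w) / norm (1 - cnj w * z))\<^sup>2)"
            using w norm_one_minus_cnj_commute[of w z] by (metis less_irrefl times_divide_eq_right)
          finally show ?thesis .
        qed
        have "c * H ?h powr (- q / p) * (pointwise_const * (?h / (norm (1 - cnj z * w))\<^sup>2 * norm (f w) powr p))
          \<le> c * H (1 - norm w) powr (- q / p) * (pointwise_const * (2 * K * (1 / (1 - norm w) * ((1 - norm w) / norm (1 - cnj w * z))\<^sup>2) * norm (f w) powr p))"
          using i1 i2 pointwise_const_pos h w K
          by (intro mult_mono mult_left_mono mult_right_mono mult_nonneg_nonneg) (auto simp: c_def)
        also have "\<dots> = 2 * K * c * pointwise_const * (H (1 - norm w) powr (- q / p) / (1 - norm w)) * ((1 - norm w) / norm (1 - cnj w * z))\<^sup>2 * norm (f w) powr p"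
          by (simp add: mult_ac)
        finally have "ennreal (c * H ?h powr (- q / p) * (pointwise_const * (?h / (norm (1 - cnj z * w))\<^sup>2 * norm (f w) powr p))) \<le> \<Theta> z w"
          unfolding \<Theta>_def by (rule ennreal_leI)
        moreover have "ennreal (c * H ?h powr (- q / p) * (pointwise_const * x)) = ennreal (c * H ?h powr (- q / p)) * (ennreal pointwise_const * ennreal x)" if "x \<ge> 0" for x
          using that pointwise_const_pos by (subst ennreal_mult) (auto simp: ennreal_mult c_def)
        moreover have "0 \<le> ?h / (norm (1 - cnj z * w))\<^sup>2 * norm (f w) powr p" using h by simp
        moreover have "indicator {w. A z w} w = (1 :: ennreal)" using True by simp
        ultimately show ?thesis by (simp only: mult_1_right)
      qed simp
    qed
    finally have "ennreal (norm (f z) powr q) \<le> (\<integral>\<^sup>+w. \<Theta> z w * indicator {w. A z w} w \<partial>W)" .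
    then show "ennreal (norm (f z) powr q) * indicator E z \<le> (\<integral>\<^sup>+w. indicator E z * (\<Theta> z w * indicator {w. A z w} w) \<partial>W)"
      by (cases "z \<in> E") auto
  qed
  also have "\<dots> = (\<integral>\<^sup>+w. (\<integral>\<^sup>+z. indicator E z * (\<Theta> z w * indicator {w. A z w} w) \<partial>\<mu>) \<partial>W)"
  proof (rule P.Fubini'[symmetric])
    show "(\<lambda>(z, w). indicator E z * (\<Theta> z w * indicator {w. A z w} w)) \<in> borel_measurable (\<mu> \<Otimes>\<^sub>M W)"
    proof -
      have [measurable]: "(\<lambda>x. f (snd x)) \<in> borel_measurable (\<mu> \<Otimes>\<^sub>M W)"
        and s [measurable]: "(\<lambda>x. snd x) \<in> borel_measurable (\<mu> \<Otimes>\<^sub>M W)"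
        and fs [measurable]: "(\<lambda>x. fst x) \<in> borel_measurable (\<mu> \<Otimes>\<^sub>M W)"
        by (rule measurable_compose[OF measurable_snd fW], rule measurable_compose[OF measurable_snd idW],
            rule measurable_compose[OF measurable_fst id_measurable_\<mu>])
      have "(\<lambda>x. H (1 - norm (snd x))) \<in> borel_measurable (\<mu> \<Otimes>\<^sub>M W)"
        by (rule measurable_compose[OF _ Hm]) measurable
      note [measurable] = this
      have [measurable]: "(\<lambda>x. indicator E (fst x) :: ennreal) \<in> borel_measurable (\<mu> \<Otimes>\<^sub>M W)"
        by (rule measurable_compose[OF measurable_fst]) simp
      have [measurable]: "Measurable.pred (\<mu> \<Otimes>\<^sub>M W) (\<lambda>x. A (fst x) (snd x))"
        unfolding A_def by measurable
      have 1: "(\<lambda>x. H (1 - norm (snd x)) powr (- q / p) / (1 - norm (snd x))) \<in> borel_measurable (\<mu> \<Otimes>\<^sub>M W)"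
        by (intro borel_measurable_divide powr_real_measurable) measurable
      have cnj: "cnj \<in> borel_measurable borel"
        by (intro borel_measurable_continuous_onI continuous_intros)
      have 2: "(\<lambda>x. ((1 - norm (snd x)) / norm (1 - cnj (snd x) * fst x))\<^sup>2) \<in> borel_measurable (\<mu> \<Otimes>\<^sub>M W)"
        by (intro borel_measurable_power borel_measurable_divide borel_measurable_diff borel_measurable_const
            borel_measurable_times measurable_compose[OF s cnj] s fs
            measurable_compose[OF s borel_measurable_norm] measurable_compose[OF _ borel_measurable_norm])
      have 3: "(\<lambda>x. norm (f (snd x)) powr p) \<in> borel_measurable (\<mu> \<Otimes>\<^sub>M W)"
        by (intro powr_real_measurable) measurable
      have "(\<lambda>x. \<Theta> (fst x) (snd x)) \<in> borel_measurable (\<mu> \<Otimes>\<^sub>M W)"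
        unfolding \<Theta>_def
        by (intro measurable_compose[OF _ measurable_ennreal] borel_measurable_times 1 2 3 borel_measurable_const)
      moreover have "(\<lambda>x. indicator {w. A (fst x) w} (snd x) :: ennreal) = (\<lambda>x. indicator {x. A (fst x) (snd x)} x)"
        by (auto simp: indicator_def fun_eq_iff)
      then have "(\<lambda>x. indicator {w. A (fst x) w} (snd x) :: ennreal) \<in> borel_measurable (\<mu> \<Otimes>\<^sub>M W)"
        by simp
      ultimately show ?thesis
        unfolding case_prod_beta by (intro borel_measurable_times_ennreal) auto
    qed
  qed
  also have "\<dots> \<le> (\<integral>\<^sup>+w. ennreal (1024 * K * annulus_const \<delta> (q / p) * \<epsilon> * c * pointwise_const) * (ennreal (((1 - norm a) / norm (1 - cnj a * w))\<^sup>2) * ennreal (norm (f w) powr p)) \<partial>W)"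
  proof (rule nn_integral_mono)
    fix w assume "w \<in> space W"
    then have w: "norm w < 1" by (simp add: Wsp)
    let ?h = "1 - norm w"
    define X where "X = 2 * K * c * pointwise_const * (H ?h powr (- q / p) / ?h) * norm (f w) powr p"
    have X: "X \<ge> 0" using w K pointwise_const_pos by (simp add: X_def c_def)
    define Z where "Z = E \<inter> {z. A z w}"
    have Zm [measurable]: "Z \<in> sets borel" unfolding Z_def A_def by measurable
    have [measurable]: "Z \<in> sets \<mu>" using Ed by (intro borel_subset_disk[OF sets_\<mu> Zm]) (auto simp: Z_def)
    have "(\<integral>\<^sup>+z. indicator E z * (\<Theta> z w * indicator {w. A z w} w) \<partial>\<mu>)
        = (\<integral>\<^sup>+z. ennreal X * (ennreal ((?h / norm (1 - cnj w * z))\<^sup>2) * indicator Z z) \<partial>\<mu>)"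
      using X by (intro nn_integral_cong) (auto simp: \<Theta>_def Z_def X_def ennreal_mult[symmetric] mult_ac split: split_indicator)
    also have "\<dots> = ennreal X * (\<integral>\<^sup>+z\<in>Z. ennreal ((?h / norm (1 - cnj w * z))\<^sup>2) \<partial>\<mu>)"
      by (rule nn_integral_cmult) measurable
    also have "\<dots> \<le> ennreal X * ennreal (512 * annulus_const \<delta> (q / p) * \<epsilon> * H ?h powr (q / p) * ?h * ((1 - norm a) / norm (1 - cnj a * w))\<^sup>2)"
    proof (intro mult_left_mono annulus_kernel_integral[OF w _ _ Zm])
      fix z assume "z \<in> Z"
      then have "A z w" "1 - norm z < \<tau> / 2" by (auto simp: Z_def E_def)
      then show "2 * ?h \<le> 1 - norm z \<and> 1 - norm z \<le> 2 * K * ?h \<and> 1 - norm z < \<tau> / 2"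
        using K by (auto simp: A_def field_simps)
    qed (use a in \<open>auto simp: Z_def E_def\<close>)
    also have "\<dots> = ennreal (X * (512 * annulus_const \<delta> (q / p) * \<epsilon> * H ?h powr (q / p) * ?h * ((1 - norm a) / norm (1 - cnj a * w))\<^sup>2))"
      using X \<epsilon> w less_imp_le[OF annulus_const_pos] by (intro ennreal_mult[symmetric] mult_nonneg_nonneg) auto
    \<comment> \<open>The powers of \<open>H\<close> and the heights cancel, which leaves the kernel
      with apex \<open>a\<close>, ready for \<open>kernel_integral\<close>.\<close>
    also have "X * (512 * annulus_const \<delta> (q / p) * \<epsilon> * H ?h powr (q / p) * ?h * ((1 - norm a) / norm (1 - cnj a * w))\<^sup>2)
        = 1024 * K * annulus_const \<delta> (q / p) * \<epsilon> * c * pointwise_const * (((1 - norm a) / norm (1 - cnj a * w))\<^sup>2 * norm (f w) powr p)"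
    proof -
      have "H ?h powr (- q / p) * H ?h powr (q / p) = 1"
        using H_pos[of ?h] w by (simp flip: powr_add)
      moreover have "2 * K * c * pointwise_const * (P / ?h) * F * (512 * C * \<epsilon> * P' * ?h * Y) = 1024 * K * C * \<epsilon> * c * pointwise_const * (Y * F) * (P * P')" for P P' F C Y
        using w by (simp add: field_simps)
      ultimately show ?thesis unfolding X_def by simp
    qed
    also have "ennreal \<dots> = ennreal (1024 * K * annulus_const \<delta> (q / p) * \<epsilon> * c * pointwise_const) * (ennreal (((1 - norm a) / norm (1 - cnj a * w))\<^sup>2) * ennreal (norm (f w) powr p))"
    proof -
      have "1024 * K * annulus_const \<delta> (q / p) * \<epsilon> * c * pointwise_const \<ge> 0"
        using K \<epsilon> pointwise_const_pos less_imp_le[OF annulus_const_pos] by (intro mult_nonneg_nonneg) (auto simp: c_def)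
      then show ?thesis by (subst ennreal_mult) (auto simp: ennreal_mult)
    qed
    finally show "(\<integral>\<^sup>+z. indicator E z * (\<Theta> z w * indicator {w. A z w} w) \<partial>\<mu>) \<le> \<dots>" .
  qed
  also have "\<dots> = ennreal (1024 * K * annulus_const \<delta> (q / p) * \<epsilon> * c * pointwise_const) * (\<integral>\<^sup>+w. ennreal (((1 - norm a) / norm (1 - cnj a * w))\<^sup>2) * ennreal (norm (f w) powr p) \<partial>W)"
    by (rule nn_integral_cmult) measurable
  also have "\<dots> \<le> ennreal (1024 * K * annulus_const \<delta> (q / p) * \<epsilon> * c * pointwise_const) * ennreal (832 * M * (1 - norm a))"
    using a by (intro mult_left_mono kernel_integral[OF f M _ tent]) auto
  also have "\<dots> = ennreal (carleson_const \<delta> (q / p) * \<epsilon> * M powr (q / p) * (1 - norm a))"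
  proof -
    have "c * G = G powr (q / p)"
    proof -
      have "c * G powr 1 = G powr ((q - p) / p + 1)" unfolding c_def by (rule powr_add[symmetric])
      also have "(q - p) / p + 1 = q / p" using p by (simp add: field_simps)
      finally show ?thesis using G by simp
    qed
    also have "\<dots> = (832 * pointwise_const) powr (q / p) * M powr (q / p)"
      unfolding G_def by (rule powr_mult)
    finally have cG: "c * (832 * pointwise_const * M) = (832 * pointwise_const) powr (q / p) * M powr (q / p)" by (simp add: G_def)
    have "1024 * K * annulus_const \<delta> (q / p) * \<epsilon> * c * pointwise_const * (832 * M * (1 - norm a))
      = 1024 * K * annulus_const \<delta> (q / p) * \<epsilon> * (1 - norm a) * (c * (832 * pointwise_const * M))" by (simp add: mult_ac)
    also have "\<dots> = carleson_const \<delta> (q / p) * \<epsilon> * M powr (q / p) * (1 - norm a)" unfolding cG carleson_const_def by (simp add: mult_ac)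
    finally have eq: "1024 * K * annulus_const \<delta> (q / p) * \<epsilon> * c * pointwise_const * (832 * M * (1 - norm a)) = carleson_const \<delta> (q / p) * \<epsilon> * M powr (q / p) * (1 - norm a)" .
    have "1024 * K * annulus_const \<delta> (q / p) * \<epsilon> * c * pointwise_const \<ge> 0"
      using K \<epsilon> pointwise_const_pos less_imp_le[OF annulus_const_pos] by (intro mult_nonneg_nonneg) (auto simp: c_def)
    then show ?thesis using M a by (subst ennreal_mult[symmetric]) (auto simp: eq)
  qed
  finally show ?thesis unfolding E_def .
qed

end

section \<open>Approach to the circle, pseudo-hyperbolic disks and bounds for Carleson means\<close>

lemma carleson_mean_le_iff:
  assumes "norm b < 1" "M \<ge> 0"
  shows "carleson_mean \<mu> q f b \<le> ennreal M \<longleftrightarrow>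
    (\<integral>\<^sup>+w\<in>carleson_square b. ennreal (norm (f w) powr q) \<partial>\<mu>) \<le> ennreal (M * (1 - norm b))"
proof -
  have "x / ennreal c \<le> ennreal M \<longleftrightarrow> x \<le> ennreal (M * c)" if "c > 0" for x c
    using that assms(2) by (cases x) (auto simp: divide_ennreal ennreal_top_divide pos_divide_le_eq ennreal_le_iff top_unique)
  then show ?thesis using assms(1) by (simp add: carleson_mean_def)
qed

lemma tent_sup_le_iff:
  assumes "M \<ge> 0"
  shows "tent_sup \<mu> q f \<le> ennreal M \<longleftrightarrow> (\<forall>b\<in>disk - {0}.
    (\<integral>\<^sup>+w\<in>carleson_square b. ennreal (norm (f w) powr q) \<partial>\<mu>) \<le> ennreal (M * (1 - norm b)))"
  using assms by (auto simp: tent_sup_def SUP_le_iff carleson_mean_le_iff)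

lemma eventually_to_circle: "eventually P to_circle \<longleftrightarrow> (\<exists>b<1. \<forall>z. b < norm z \<and> norm z < 1 \<longrightarrow> P z)"
proof
  assume "eventually P to_circle"
  then obtain Q where Q: "eventually Q (at_left (1::real))" "\<And>z. Q (norm z) \<Longrightarrow> P z"
    unfolding to_circle_def eventually_filtercomap by blast
  then obtain b where "b < 1" "\<And>y. b < y \<Longrightarrow> y < 1 \<Longrightarrow> Q y"
    using eventually_at_left[of 0 "1::real" Q] by auto
  then show "\<exists>b<1. \<forall>z. b < norm z \<and> norm z < 1 \<longrightarrow> P z" using Q(2) by blast
next
  assume "\<exists>b<1. \<forall>z. b < norm z \<and> norm z < 1 \<longrightarrow> P z"
  then obtain b where b: "b < 1" "\<And>z. b < norm z \<Longrightarrow> norm z < 1 \<Longrightarrow> P z" by blast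
  have "eventually (\<lambda>y. b < y \<and> y < 1) (at_left (1::real))"
    unfolding eventually_at_left[of b "1::real", OF b(1)] using b(1) by blast
  then show "eventually P to_circle"
    unfolding to_circle_def eventually_filtercomap using b(2) by (intro exI[of _ "\<lambda>y. b < y \<and> y < 1"]) auto
qed

lemma carleson_square_norm_ge: "z \<in> carleson_square a \<Longrightarrow> norm a \<le> norm z"
proof (cases "a = 0")
  case False
  assume "z \<in> carleson_square a"
  then obtain \<rho> t where "z = of_real \<rho> * cis t" "norm a \<le> \<rho>" using False by (auto simp: carleson_square_def)
  then show ?thesis using norm_ge_zero[of a] by (simp add: norm_mult del: norm_ge_zero)
qed simp

text \<open>With \<open>N = norm (1 - cnj a * z)\<close>, membership gives
  \<open>norm (a - z) < r * N\<close> and the triangle inequality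
  \<open>N \<le> 2 * (1 - norm a) + norm (a - z)\<close>; solving for \<open>N\<close> gives the
  rest. The origin is at pseudo-hyperbolic distance \<open>norm a\<close> from
  \<open>a\<close>.\<close>

lemma pseudo_hyp_disk_bounds:
  assumes a: "norm a < 1" and r: "0 < r" "r < 1" and z: "z \<in> pseudo_hyp_disk a r"
  shows "norm z < 1" "norm (1 - cnj a * z) \<le> 2 * (1 - norm a) / (1 - r)"
    "norm (z - apex a) < 3 * (1 - norm a) / (1 - r)" "r \<le> norm a \<Longrightarrow> z \<noteq> 0"
proof -
  let ?h = "1 - norm a"
  show z1: "norm z < 1" using z by (simp add: pseudo_hyp_disk_def)
  have h: "?h > 0" using a by simp
  have N: "norm (1 - a * cnj z) = norm (1 - cnj a * z)"
    by (subst norm_one_minus_cnj_commute) (simp add: mult.commute)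
  have pos: "norm (1 - cnj a * z) > 0" using one_minus_cnj_pos[of z a] z1 a by simp
  have az: "norm (a - z) < r * norm (1 - cnj a * z)"
  proof -
    have "norm (a - z) / norm (1 - cnj a * z) < r" using z N by (simp add: pseudo_hyp_disk_def norm_divide)
    then show ?thesis by (simp only: pos_divide_less_eq[OF pos])
  qed
  from norm_one_minus_cnj_le[OF a, of z]
  have "norm (1 - cnj a * z) * (1 - r) \<le> 2 * ?h" using az by (simp add: algebra_simps)
  then show le: "norm (1 - cnj a * z) \<le> 2 * ?h / (1 - r)" using r by (simp add: pos_le_divide_eq)
  have "norm (z - apex a) \<le> norm (z - a) + norm (a - apex a)"
    using norm_triangle_ineq[of "z - a" "a - apex a"] by simp
  also have "norm (a - apex a) = ?h" using norm_apex_diff[OF a] by (simp add: norm_minus_commute)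
  also have "norm (z - a) < r * (2 * ?h / (1 - r))"
    using less_le_trans[OF az mult_left_mono[OF le]] r by (simp add: norm_minus_commute)
  also have "r * (2 * ?h / (1 - r)) + ?h \<le> 3 * ?h / (1 - r)"
  proof -
    have "(r * (2 * ?h / (1 - r)) + ?h) * (1 - r) = ?h * (1 + r)" using r by (simp add: field_simps)
    also have "\<dots> \<le> ?h * 3" using h r by (intro mult_left_mono) auto
    finally have "(r * (2 * ?h / (1 - r)) + ?h) * (1 - r) \<le> 3 * ?h" by (simp only: mult.commute)
    then show ?thesis using r by (simp only: pos_le_divide_eq diff_gt_0_iff_gt)
  qed
  finally show "norm (z - apex a) < 3 * ?h / (1 - r)" by simp
  show "z \<noteq> 0" if "r \<le> norm a"
    using az that by auto
qed

lemma ball_subset_pseudo_hyp_disk: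
  assumes "norm u < 1"
  shows "disk \<inter> ball u (r * (1 - norm u)) \<subseteq> pseudo_hyp_disk u r"
proof
  fix z assume z: "z \<in> disk \<inter> ball u (r * (1 - norm u))"
  let ?h = "1 - norm u"
  have h: "?h > 0" using assms by simp
  have N: "norm (1 - u * cnj z) = norm (1 - cnj u * z)"
    by (subst norm_one_minus_cnj_commute) (simp add: mult.commute)
  have le: "?h \<le> norm (1 - cnj u * z)" using one_minus_norm_le[of z u] z by simp
  then have pos: "norm (1 - cnj u * z) > 0" using h by (rule less_le_trans[rotated])
  have d: "norm (u - z) < r * ?h" using z by (simp add: dist_norm)
  then have "r > 0" using h by (metis mult_pos_pos norm_ge_zero le_less_trans zero_less_mult_pos2)
  then have "norm (u - z) < r * norm (1 - cnj u * z)"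
    by (intro less_le_trans[OF d] mult_left_mono[OF le]) simp
  then have "norm (u - z) / norm (1 - cnj u * z) < r" by (simp only: pos_divide_less_eq[OF pos])
  then show "z \<in> pseudo_hyp_disk u r"
    using z N by (simp add: pseudo_hyp_disk_def norm_divide)
qed

lemma sets_pseudo_hyp_disk:
  assumes "sets \<mu> = sets (restrict_space borel disk)" "norm z < 1"
  shows "pseudo_hyp_disk z r \<in> sets \<mu>"
proof -
  have "norm (1 - z * cnj u) \<noteq> 0" if "u \<in> disk" for u
  proof -
    have "norm (1 - z * cnj u) = norm (1 - cnj u * z)" by (simp add: mult.commute)
    moreover have "1 - norm u \<le> \<dots>" using one_minus_norm_le[of z u] assms(2) by simp
    ultimately show ?thesis using that by auto
  qed
  then have "continuous_on disk (\<lambda>u. norm ((z - u) / (1 - z * cnj u)))"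
    by (intro continuous_intros) auto
  then have "open (disk \<inter> (\<lambda>u. norm ((z - u) / (1 - z * cnj u))) -` {..<r})"
    by (rule continuous_open_preimage) auto
  moreover have "disk \<inter> (\<lambda>u. norm ((z - u) / (1 - z * cnj u))) -` {..<r} = pseudo_hyp_disk z r"
    by (auto simp: pseudo_hyp_disk_def)
  ultimately have "pseudo_hyp_disk z r \<in> sets borel" by (metis borel_open)
  moreover have "pseudo_hyp_disk z r \<subseteq> disk" by (auto simp: pseudo_hyp_disk_def)
  ultimately show ?thesis by (rule borel_subset_disk[OF assms(1)])
qed

context vanishing_growth
begin

lemma carleson_mean_near_circle:
  assumes f: "f holomorphic_on disk" and M: "M \<ge> 0" and tent: "tent_sup W p f \<le> ennreal M"
    and a: "a \<in> disk - {0}" "1 - norm a < \<tau> / 2"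
  shows "carleson_mean \<mu> q f a \<le> ennreal (carleson_const \<delta> (q / p) * \<epsilon> * M powr (q / p))"
proof -
  have "carleson_square a \<inter> {z. 1 - norm z < \<tau> / 2} = carleson_square a"
    using carleson_square_norm_ge[of _ a] a(2) by fastforce
  moreover have "(\<integral>\<^sup>+z\<in>carleson_square a \<inter> {z. 1 - norm z < \<tau> / 2}. ennreal (norm (f z) powr q) \<partial>\<mu>)
    \<le> ennreal (carleson_const \<delta> (q / p) * \<epsilon> * M powr (q / p) * (1 - norm a))"
    using tent M by (intro carleson_integral_estimate[OF f M a(1)]) (simp add: tent_sup_le_iff)
  moreover have "carleson_const \<delta> (q / p) * \<epsilon> * M powr (q / p) \<ge> 0"
    using \<epsilon> K less_imp_le[OF annulus_const_pos] by (auto simp: carleson_const_def)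
  ultimately show ?thesis using a by (subst carleson_mean_le_iff) auto
qed

text \<open>A square that meets the compact core \<open>norm z \<le> 1 - \<tau> / 2\<close> has
  height at least \<open>\<tau> / 2\<close>, so dividing by its height costs a bounded factor there;
  outside the core the Carleson estimate applies.\<close>

lemma tent_sup_le:
  assumes f: "f holomorphic_on disk" and M: "M \<ge> 0" and tent: "tent_sup W p f \<le> ennreal M"
    and \<tau>: "\<tau> > 0" and B: "\<And>z. norm z \<le> 1 - \<tau> / 2 \<Longrightarrow> norm (f z) \<le> B"
  shows "tent_sup \<mu> q f \<le> ennreal (carleson_const \<delta> (q / p) * \<epsilon> * M powr (q / p))
    + ennreal (B powr q) * emeasure \<mu> {z. norm z \<le> 1 - \<tau> / 2} / ennreal (\<tau> / 2)"
  unfolding tent_sup_def[of \<mu>]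
proof (rule SUP_least)
  fix a :: complex assume a: "a \<in> disk - {0}"
  let ?R = "{z :: complex. norm z \<le> 1 - \<tau> / 2}"
  have Rs [measurable]: "?R \<in> sets \<mu>"
  proof -
    have "{z :: complex. norm z \<le> 1 - \<tau> / 2} \<in> sets borel" by measurable
    moreover have "?R \<subseteq> disk" using \<tau> by auto
    ultimately show ?thesis by (rule borel_subset_disk[OF sets_\<mu>])
  qed
  have [measurable]: "f \<in> borel_measurable \<mu>" by (rule holomorphic_measurable[OF sets_\<mu> f])
  have Sm [measurable]: "carleson_square a \<in> sets \<mu>" using a by (intro carleson_square_in_sets[OF sets_\<mu>]) auto
  have split: "(\<integral>\<^sup>+z\<in>carleson_square a. ennreal (norm (f z) powr q) \<partial>\<mu>)
      \<le> (\<integral>\<^sup>+z\<in>carleson_square a \<inter> {z. 1 - norm z < \<tau> / 2}. ennreal (norm (f z) powr q) \<partial>\<mu>)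
        + (\<integral>\<^sup>+z\<in>carleson_square a \<inter> ?R. ennreal (norm (f z) powr q) \<partial>\<mu>)"
  proof -
    have [measurable]: "carleson_square a \<inter> {z. 1 - norm z < \<tau> / 2} \<in> sets \<mu>"
    proof -
      have "carleson_square a \<inter> {z. 1 - norm z < \<tau> / 2} = carleson_square a - ?R" by auto
      then show ?thesis by simp
    qed
    show ?thesis
      by (subst nn_integral_add[symmetric]) (auto intro!: nn_integral_mono split: split_indicator)
  qed
  have C: "carleson_const \<delta> (q / p) * \<epsilon> * M powr (q / p) \<ge> 0"
    using \<epsilon> K less_imp_le[OF annulus_const_pos] by (auto simp: carleson_const_def)
  have 1: "(\<integral>\<^sup>+z\<in>carleson_square a \<inter> {z. 1 - norm z < \<tau> / 2}. ennreal (norm (f z) powr q) \<partial>\<mu>)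
    \<le> ennreal (carleson_const \<delta> (q / p) * \<epsilon> * M powr (q / p)) * ennreal (1 - norm a)"
    using carleson_integral_estimate[OF f M a] tent M a C by (simp add: tent_sup_le_iff ennreal_mult)
  have 2: "(\<integral>\<^sup>+z\<in>carleson_square a \<inter> ?R. ennreal (norm (f z) powr q) \<partial>\<mu>)
    \<le> ennreal (B powr q) * emeasure \<mu> ?R / ennreal (\<tau> / 2) * ennreal (1 - norm a)"
  proof (cases "norm a \<le> 1 - \<tau> / 2")
    case True
    have "(\<integral>\<^sup>+z\<in>carleson_square a \<inter> ?R. ennreal (norm (f z) powr q) \<partial>\<mu>) \<le> (\<integral>\<^sup>+z. ennreal (B powr q) * indicator ?R z \<partial>\<mu>)"
      using B p pq by (intro nn_integral_mono) (auto intro!: ennreal_leI powr_mono2 split: split_indicator)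
    also have "\<dots> = ennreal (B powr q) * emeasure \<mu> ?R * 1" by (simp add: nn_integral_cmult_indicator)
    also have "\<dots> \<le> ennreal (B powr q) * emeasure \<mu> ?R * (ennreal (1 - norm a) / ennreal (\<tau> / 2))"
    proof (rule mult_left_mono)
      have "1 \<le> (1 - norm a) / (\<tau> / 2)" using True \<tau> by (simp add: pos_le_divide_eq)
      then show "1 \<le> ennreal (1 - norm a) / ennreal (\<tau> / 2)"
        using \<tau> True by (subst divide_ennreal) (auto simp: ennreal_ge_1)
    qed simp
    finally show ?thesis by (simp add: divide_ennreal_def mult_ac)
  next
    case False
    then have "carleson_square a \<inter> ?R = {}" using carleson_square_norm_ge[of _ a] by fastforce
    then show ?thesis by simp
  qed
  have "carleson_mean \<mu> q f a \<le> (ennreal (carleson_const \<delta> (q / p) * \<epsilon> * M powr (q / p)) * ennreal (1 - norm a)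
      + ennreal (B powr q) * emeasure \<mu> ?R / ennreal (\<tau> / 2) * ennreal (1 - norm a)) / ennreal (1 - norm a)"
    unfolding carleson_mean_def by (intro divide_right_mono_ennreal order_trans[OF split] add_mono 1 2)
  also have "\<dots> = ennreal (carleson_const \<delta> (q / p) * \<epsilon> * M powr (q / p)) + ennreal (B powr q) * emeasure \<mu> ?R / ennreal (\<tau> / 2)"
    using a by (subst distrib_right[symmetric], subst ennreal_mult_divide_eq) auto
  finally show "carleson_mean \<mu> q f a \<le> ennreal (carleson_const \<delta> (q / p) * \<epsilon> * M powr (q / p))
    + ennreal (B powr q) * emeasure \<mu> {z. norm z \<le> 1 - \<tau> / 2} / ennreal (\<tau> / 2)" .
qed

end


section \<open>Test functions\<close>

context doubling_weight
begin

text \<open>Iterated reverse doubling gives geometric decay along the heights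
  \<open>1 / K ^ j\<close>, and \<open>H\<close> is monotone.\<close>

lemma H_tendsto_0:
  assumes "e > 0"
  shows "\<exists>h0>0. \<forall>h. 0 < h \<and> h < h0 \<longrightarrow> H h < e"
proof -
  have it: "H (1 / K ^ j) \<le> \<kappa> ^ j * H 1" for j
  proof (induction j)
    case (Suc j)
    have "H (1 / K ^ j / K) \<le> \<kappa> * H (1 / K ^ j)" using K by (intro H_shrink) (auto simp: one_le_power)
    also have "\<dots> \<le> \<kappa> * (\<kappa> ^ j * H 1)" using Suc \<kappa> by (intro mult_left_mono) auto
    finally show ?case by (simp add: mult_ac)
  qed simp
  have "(\<lambda>j. \<kappa> ^ j * H 1) \<longlonglongrightarrow> 0 * H 1"
    using \<kappa> by (intro tendsto_mult LIMSEQ_power_zero tendsto_const) auto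
  then have "eventually (\<lambda>j. \<kappa> ^ j * H 1 < e) sequentially" using assms by (intro order_tendstoD) auto
  then obtain j where j: "\<kappa> ^ j * H 1 < e" by (auto simp: eventually_sequentially)
  have "H h < e" if "0 < h" "h < 1 / K ^ j" for h
    using H_mono[of h "1 / K ^ j"] it[of j] j that by auto
  then show ?thesis using K by (intro exI[of _ "1 / K ^ j"]) auto
qed

lemma emeasure_W_square:
  assumes b: "b \<in> disk - {0}"
  shows "emeasure W (carleson_square b) \<le> ennreal (32 * D * (1 - norm b) * H (1 - norm b))"
proof -
  let ?h = "1 - norm b"
  have h: "?h > 0" using b by simp
  have "emeasure W (carleson_square b) \<le> emeasure W (disk \<inter> ball (apex b) (2 * ?h))"
    using carleson_square_subset_ball[of b] b by (intro emeasure_mono) (auto simp: sets_radial_measure sets_restrict_space)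
  also have "\<dots> \<le> ennreal (16 * (2 * ?h) * H (2 * ?h))" using h by (intro emeasure_W_ball) auto
  also have "\<dots> \<le> ennreal (16 * (2 * ?h) * (D * H ?h))"
    using h H_double[OF h] by (intro ennreal_leI mult_left_mono) auto
  finally show ?thesis by (simp add: mult_ac)
qed

text \<open>A bounded function has means of the order of \<open>H\<close>, which tends to zero; so a
  bounded function of finite norm lies in \<open>AT_zero\<close>.\<close>

lemma carleson_mean_bounded_function:
  assumes f: "f holomorphic_on disk" and B: "\<And>z. z \<in> disk \<Longrightarrow> norm (f z) \<le> B" and p: "p > 0" and b: "b \<in> disk - {0}"
  shows "carleson_mean W p f b \<le> ennreal (B powr p * 32 * D * H (1 - norm b))"
proof -
  let ?h = "1 - norm b"
  have h: "?h > 0" using b by simp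
  have S: "carleson_square b \<in> sets W" using b by (intro carleson_square_in_sets[OF sets_radial_measure]) auto
  have "(\<integral>\<^sup>+w\<in>carleson_square b. ennreal (norm (f w) powr p) \<partial>W) \<le> (\<integral>\<^sup>+w. ennreal (B powr p) * indicator (carleson_square b) w \<partial>W)"
    using B p carleson_square_subset[of b] by (intro nn_integral_mono) (auto intro!: ennreal_leI powr_mono2 split: split_indicator)
  also have "\<dots> = ennreal (B powr p) * emeasure W (carleson_square b)" using S by (rule nn_integral_cmult_indicator)
  also have "\<dots> \<le> ennreal (B powr p) * ennreal (32 * D * ?h * H ?h)" by (intro mult_left_mono emeasure_W_square b) auto
  also have "\<dots> = ennreal (B powr p * 32 * D * H ?h * ?h)"
    using D h H_pos[OF h] by (subst ennreal_mult[symmetric]) (auto simp: mult_ac)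
  finally show ?thesis using b D H_pos[OF h] by (subst carleson_mean_le_iff) auto
qed

lemma bounded_function_vanishing:
  assumes f: "f holomorphic_on disk" and B: "\<And>z. z \<in> disk \<Longrightarrow> norm (f z) \<le> B" and p: "p > 0"
  shows "(carleson_mean W p f \<longlongrightarrow> 0) to_circle"
  unfolding ennreal_tendsto_0_iff
proof (intro allI impI)
  fix e :: ennreal assume e: "e > 0"
  obtain e' where e': "e' > 0" "ennreal e' \<le> e"
    using e by (cases e) (auto intro: that[of 1])
  define c where "c = B powr p * 32 * D + 1"
  have c: "c > 0" using D by (auto simp: c_def intro: add_nonneg_pos)
  obtain h0 where h0: "h0 > 0" "\<And>h. 0 < h \<Longrightarrow> h < h0 \<Longrightarrow> H h < e' / c"
    using H_tendsto_0[of "e' / c"] e' c by auto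
  show "eventually (\<lambda>a. carleson_mean W p f a < e) to_circle"
    unfolding eventually_to_circle
  proof (intro exI[of _ "max 0 (1 - h0)"] conjI allI impI)
    fix a :: complex assume a: "max 0 (1 - h0) < norm a \<and> norm a < 1"
    then have h: "0 < 1 - norm a" "1 - norm a < h0" by auto
    have "carleson_mean W p f a \<le> ennreal (B powr p * 32 * D * H (1 - norm a))"
      using a by (intro carleson_mean_bounded_function[OF f B p]) auto
    also have "\<dots> < ennreal e'"
    proof (rule ennreal_lessI[OF e'(1)])
      have "B powr p * 32 * D * H (1 - norm a) \<le> c * H (1 - norm a)"
        using H_pos[OF h(1)] by (intro mult_right_mono) (auto simp: c_def)
      also have "\<dots> < e'" using h0(2)[OF h] c by (simp add: pos_less_divide_eq mult.commute)
      finally show "B powr p * 32 * D * H (1 - norm a) < e'" .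
    qed
    finally show "carleson_mean W p f a < e" using e' by auto
  qed (use h0 in auto)
qed

text \<open>Normalized so that \<open>norm (test_fun p n a z) powr p\<close> is at most
  \<open>1 / H (1 - norm a)\<close> on the disk and comparable to it on
  \<open>pseudo_hyp_disk a r\<close>; \<open>n\<close> is chosen later against the doubling
  constant.\<close>

definition test_fun :: "real \<Rightarrow> nat \<Rightarrow> complex \<Rightarrow> complex \<Rightarrow> complex" where
  "test_fun p n a z = of_real (H (1 - norm a) powr (- 1 / p)) * (of_real (1 - norm a) / (1 - cnj a * z)) ^ n"

lemma test_fun_holomorphic: "norm a < 1 \<Longrightarrow> test_fun p n a holomorphic_on disk"
  unfolding test_fun_def using one_minus_cnj_pos[of _ a] by (intro holomorphic_intros) force

lemma norm_test_fun:
  assumes "norm a < 1" "p > 0" "n > 0"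
  shows "norm (test_fun p n a z) powr s
    = H (1 - norm a) powr (- s / p) * ((1 - norm a) / norm (1 - cnj a * z)) powr (n * s)"
proof -
  have "norm (test_fun p n a z) = H (1 - norm a) powr (- 1 / p) * ((1 - norm a) / norm (1 - cnj a * z)) ^ n"
    using assms norm_of_real[of "1 - norm a", where 'a = complex]
    by (simp add: test_fun_def norm_mult norm_power norm_divide)
  also have "((1 - norm a) / norm (1 - cnj a * z)) ^ n = ((1 - norm a) / norm (1 - cnj a * z)) powr n"
    using assms by (cases "norm (1 - cnj a * z) = 0") (auto simp: powr_realpow zero_power)
  finally show ?thesis
    by (simp add: powr_mult powr_powr)
qed

text \<open>Ball masses grow at most like \<open>(2 * D) ^ j\<close>, hence the condition on
  \<open>n\<close>. For squares at least as high as \<open>1 - norm a\<close> the integral over the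
  whole disk is already small enough; for lower ones the trivial bound \<open>1 / H\<close>
  suffices.\<close>

lemma test_fun_tent_sup:
  assumes a: "norm a < 1" and p: "p > 0" and n: "n > 0" "4 * D \<le> 2 powr (n * p)"
  shows "tent_sup W p (test_fun p n a) \<le> ennreal (128 * D\<^sup>2)"
proof -
  let ?k = "1 - norm a"
  have k: "?k > 0" using a by simp
  have Hk: "H ?k > 0" by (rule H_pos[OF k])
  have idm [measurable]: "(\<lambda>w. w) \<in> borel_measurable W"
    by (rule holomorphic_measurable[OF sets_radial_measure holomorphic_on_ident])
  have eq: "ennreal (norm (test_fun p n a z) powr p) = ennreal (1 / H ?k) * ennreal ((?k / norm (1 - cnj a * z)) powr (n * p))" for z
    using p a n Hk by (subst norm_test_fun, simp, simp, simp, subst ennreal_mult[symmetric]) (auto simp: powr_minus_divide)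
  have "(\<integral>\<^sup>+w\<in>carleson_square b. ennreal (norm (test_fun p n a w) powr p) \<partial>W) \<le> ennreal (128 * D\<^sup>2 * (1 - norm b))"
    if b: "b \<in> disk - {0}" for b
  proof (cases "?k \<le> 1 - norm b")
    case True
    have "(\<integral>\<^sup>+w\<in>carleson_square b. ennreal (norm (test_fun p n a w) powr p) \<partial>W)
        \<le> (\<integral>\<^sup>+w. ennreal (1 / H ?k) * ennreal ((?k / norm (1 - cnj a * w)) powr (n * p)) \<partial>W)"
      unfolding eq by (intro nn_integral_mono) (auto split: split_indicator)
    also have "\<dots> = ennreal (1 / H ?k) * (\<integral>\<^sup>+w. ennreal ((?k / norm (1 - cnj a * w)) powr (n * p)) \<partial>W)"
      by (rule nn_integral_cmult) measurable
    also have "\<dots> \<le> ennreal (1 / H ?k) * (ennreal (16 * ?k * H ?k) * ennreal (2 * (2 * D)\<^sup>2))"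
    proof (intro mult_left_mono nn_integral_dyadic_geometric[OF sets_radial_measure a])
      fix j
      have "emeasure W (disk \<inter> ball (apex a) (2 ^ j * ?k)) \<le> ennreal (16 * (2 ^ j * ?k) * H (2 ^ j * ?k))"
        using k by (intro emeasure_W_ball) auto
      also have "\<dots> \<le> ennreal (16 * (2 ^ j * ?k) * (D ^ j * H ?k))"
        using k H_power[OF k] by (intro ennreal_leI mult_left_mono) auto
      also have "\<dots> = ennreal (16 * ?k * H ?k) * ennreal ((2 * D) ^ j)"
        using k Hk D by (subst ennreal_mult[symmetric]) (auto simp: power_mult_distrib mult_ac)
      finally show "emeasure W (disk \<inter> ball (apex a) (2 ^ j * ?k)) \<le> ennreal (16 * ?k * H ?k) * ennreal ((2 * D) ^ j)" .
    qed (use D n p in auto)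
    also have "\<dots> = ennreal (1 / H ?k * (16 * ?k * H ?k * (2 * (2 * D)\<^sup>2)))"
    proof -
      have "0 \<le> 16 * ?k * H ?k" "0 \<le> 2 * (2 * D)\<^sup>2" "0 \<le> 1 / H ?k" using k Hk by auto
      then show ?thesis by (simp only: ennreal_mult mult_nonneg_nonneg)
    qed
    also have "1 / H ?k * (16 * ?k * H ?k * (2 * (2 * D)\<^sup>2)) = 128 * D\<^sup>2 * ?k"
      using Hk by (simp add: power_mult_distrib)
    also have "\<dots> \<le> ennreal (128 * D\<^sup>2 * (1 - norm b))" using True by (intro ennreal_leI mult_left_mono) auto
    finally show ?thesis .
  next
    case False
    let ?h = "1 - norm b"
    have h: "?h > 0" using b by simp
    have S: "carleson_square b \<in> sets W" using b by (intro carleson_square_in_sets[OF sets_radial_measure]) auto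
    have "(\<integral>\<^sup>+w\<in>carleson_square b. ennreal (norm (test_fun p n a w) powr p) \<partial>W)
        \<le> (\<integral>\<^sup>+w. ennreal (1 / H ?k) * indicator (carleson_square b) w \<partial>W)"
    proof (rule nn_integral_mono)
      fix w
      show "ennreal (norm (test_fun p n a w) powr p) * indicator (carleson_square b) w \<le> ennreal (1 / H ?k) * indicator (carleson_square b) w"
      proof (cases "w \<in> carleson_square b")
        case True
        then have w: "norm w < 1" using carleson_square_subset[of b] by auto
        then have le: "?k \<le> norm (1 - cnj a * w)" using one_minus_norm_le[of w a] by simp
        then have "norm (1 - cnj a * w) > 0" using k by (rule less_le_trans[rotated])
        then have "?k / norm (1 - cnj a * w) \<le> 1" using le by (simp only: pos_divide_le_eq mult_1_left)
        then have "(?k / norm (1 - cnj a * w)) powr (n * p) \<le> 1 powr (n * p)"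
          using p k by (intro powr_mono2) auto
        then have "ennreal (1 / H ?k) * ennreal ((?k / norm (1 - cnj a * w)) powr (n * p)) \<le> ennreal (1 / H ?k) * ennreal 1"
          by (intro mult_left_mono ennreal_leI) auto
        then show ?thesis unfolding eq using True by simp
      qed simp
    qed
    also have "\<dots> = ennreal (1 / H ?k) * emeasure W (carleson_square b)" using S by (rule nn_integral_cmult_indicator)
    also have "\<dots> \<le> ennreal (1 / H ?k) * ennreal (32 * D * ?h * H ?h)" by (intro mult_left_mono emeasure_W_square b) auto
    also have "\<dots> = ennreal (1 / H ?k * (32 * D * ?h * H ?h))"
      using D h Hk H_pos[OF h] by (intro ennreal_mult[symmetric]) auto
    also have "\<dots> \<le> ennreal (128 * D\<^sup>2 * ?h)"
    proof (rule ennreal_leI)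
      have "1 / H ?k * (32 * D * ?h * H ?h) = 32 * D * ?h * (H ?h / H ?k)" by simp
      also have "\<dots> \<le> 32 * D * ?h * 1"
        using H_mono[OF h, of ?k] False Hk D h by (intro mult_left_mono) (auto simp: divide_le_eq)
      also have "\<dots> \<le> 128 * (D * D) * ?h"
      proof -
        have "32 * D \<le> 128 * (D * D)" using D mult_left_mono[of 1 D D] by simp
        then show ?thesis using h by (simp only: mult_1_right) (intro mult_right_mono, auto)
      qed
      finally show "1 / H ?k * (32 * D * ?h * H ?h) \<le> 128 * D\<^sup>2 * ?h" by (simp add: power2_eq_square)
    qed
    finally show ?thesis .
  qed
  then show ?thesis by (subst tent_sup_le_iff) auto
qed

lemma test_fun_bounded:
  assumes a: "norm a < 1" and z: "z \<in> disk"
  shows "norm (test_fun p n a z) \<le> H (1 - norm a) powr (- 1 / p)"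
proof -
  have le: "1 - norm a \<le> norm (1 - cnj a * z)" using one_minus_norm_le[of z a] z by simp
  moreover have pos: "norm (1 - cnj a * z) > 0" using a by (intro less_le_trans[OF _ le]) simp
  ultimately have "(1 - norm a) / norm (1 - cnj a * z) \<le> 1" by (simp only: pos_divide_le_eq mult_1_left)
  then have "((1 - norm a) / norm (1 - cnj a * z)) ^ n \<le> 1"
    using a by (intro power_le_one) auto
  then have "H (1 - norm a) powr (- 1 / p) * ((1 - norm a) / norm (1 - cnj a * z)) ^ n \<le> H (1 - norm a) powr (- 1 / p) * 1"
    by (intro mult_left_mono) auto
  then show ?thesis
    using a norm_of_real[of "1 - norm a", where 'a = complex]
    by (simp add: test_fun_def norm_mult norm_power norm_divide)
qed

text \<open>Doubling bounds \<open>H h\<close> from below by a power of \<open>h\<close>; the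
  condition on \<open>s\<close> leaves a spare factor \<open>4\<close> per doubling, which becomes
  \<open>h\<^sup>2\<close>.\<close>

lemma power_over_H:
  assumes h: "0 < h" "h \<le> 1" and s: "4 * D \<le> 2 powr s" "s \<ge> 0"
  shows "h powr s / H h \<le> 4 * h\<^sup>2 / H (1 / 2)"
proof -
  have "\<exists>k. 1 / 2 < 2 ^ k * h"
  proof -
    obtain k where "1 / (2 * h) < 2 ^ k" using real_arch_pow[of 2 "1 / (2 * h)"] by auto
    then show ?thesis using h by (auto simp: field_simps intro!: exI[of _ k])
  qed
  \<comment> \<open>The least \<open>k\<close> places \<open>2 ^ k * h\<close> between
    \<open>1 / 2\<close> and \<open>1\<close>: large enough to compare with
    \<open>H (1 / 2)\<close>, small enough for its power to be harmless.\<close>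
  then obtain k where k: "1 / 2 < 2 ^ k * h" "\<And>j. j < k \<Longrightarrow> \<not> 1 / 2 < 2 ^ j * h"
    using exists_least_iff[of "\<lambda>k. 1 / 2 < 2 ^ k * h"] by blast
  have k1: "2 ^ k * h \<le> 1"
  proof (cases k)
    case (Suc j)
    then show ?thesis using k(2)[of j] by simp
  qed (use h in simp)
  have H2: "H (1 / 2) > 0" by (rule H_pos) simp
  have "H (1 / 2) \<le> H (2 ^ k * h)" using k by (intro H_mono) auto
  also have "\<dots> \<le> D ^ k * H h" by (rule H_power[OF h(1)])
  finally have "H (1 / 2) / H h \<le> D ^ k" using H_pos[OF h(1)] by (simp add: divide_le_eq)
  then have "h powr s * (H (1 / 2) / H h) \<le> h powr s * D ^ k" by (intro mult_left_mono) auto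
  also have "\<dots> \<le> h powr s * (2 powr s / 4) ^ k"
    using s D by (intro mult_left_mono power_mono) auto
  also have "\<dots> = (2 ^ k * h) powr s * (1 / 4) ^ k"
    using h by (simp add: powr_mult power_divide powr_realpow[symmetric] powr_powr mult_ac)
  also have "\<dots> \<le> 1 * (1 / 4) ^ k"
  proof (intro mult_right_mono)
    have "(2 ^ k * h) powr s \<le> 1 powr s" using k1 h s by (intro powr_mono2) auto
    then show "(2 ^ k * h) powr s \<le> 1" by simp
  qed simp
  also have "\<dots> = ((1 / 2) ^ k)\<^sup>2" by (simp add: power2_eq_square power_mult_distrib[symmetric])
  also have "\<dots> \<le> (2 * h)\<^sup>2"
  proof (rule power_mono)
    have "(1 / 2 :: real) ^ k = 1 / 2 ^ k" by (simp add: power_divide)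
    also have "\<dots> \<le> 2 * h" using k(1) by (simp add: divide_le_eq mult_ac)
    finally show "(1 / 2) ^ k \<le> 2 * h" .
  qed simp
  finally have "h powr s * (H (1 / 2) / H h) \<le> 4 * h\<^sup>2" by (simp add: power_mult_distrib)
  then show ?thesis using H2 H_pos[OF h(1)] by (simp add: field_simps)
qed

lemma test_fun_tendsto_0:
  assumes a: "\<And>j. norm (a j) < 1" "(\<lambda>j. norm (a j)) \<longlonglongrightarrow> 1" and p: "p > 0" and n: "n > 0" "4 * D \<le> 2 powr (n * p)"
    and z: "z \<in> disk"
  shows "(\<lambda>j. test_fun p n (a j) z) \<longlonglongrightarrow> 0"
proof -
  let ?s = "n * p"
  define c where "c = 4 / H (1 / 2) / (1 - norm z) powr ?s"
  have H2: "H (1 / 2) > 0" by (rule H_pos) simp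
  have z1: "1 - norm z > 0" using z by simp
  have le: "norm (test_fun p n (a j) z) powr p \<le> c * (1 - norm (a j))\<^sup>2" for j
  proof -
    let ?h = "1 - norm (a j)"
    have h: "0 < ?h" "?h \<le> 1" using a(1)[of j] by auto
    have zl: "1 - norm z \<le> norm (1 - cnj (a j) * z)"
      using one_minus_norm_le[of "a j" z] a(1)[of j] norm_one_minus_cnj_commute[of "a j" z] by simp
    have "norm (test_fun p n (a j) z) powr p = 1 / H ?h * (?h / norm (1 - cnj (a j) * z)) powr ?s"
      using norm_test_fun[OF a(1) p n(1), of j z p] p H_pos[OF h(1)] by (simp add: powr_minus_divide)
    also have "\<dots> \<le> 1 / H ?h * (?h / (1 - norm z)) powr ?s"
      using zl z1 h H_pos[OF h(1)] p by (intro mult_left_mono powr_mono2 divide_left_mono) (auto intro!: mult_pos_pos less_le_trans[OF z1 zl])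
    also have "\<dots> = ?h powr ?s / H ?h / (1 - norm z) powr ?s"
      using h z1 by (simp add: powr_divide)
    also have "\<dots> \<le> (4 * ?h\<^sup>2 / H (1 / 2)) / (1 - norm z) powr ?s"
      using h n p by (intro divide_right_mono power_over_H) auto
    also have "\<dots> = c * ?h\<^sup>2" by (simp add: c_def)
    finally show ?thesis .
  qed
  have "(\<lambda>j. c * (1 - norm (a j))\<^sup>2) \<longlonglongrightarrow> c * (1 - 1)\<^sup>2"
    by (intro tendsto_intros a(2))
  then have "(\<lambda>j. c * (1 - norm (a j))\<^sup>2) \<longlonglongrightarrow> 0" by simp
  then have "(\<lambda>j. norm (test_fun p n (a j) z) powr p) \<longlonglongrightarrow> 0"
    using tendsto_sandwich[of "\<lambda>_. 0" "\<lambda>j. norm (test_fun p n (a j) z) powr p" sequentially "\<lambda>j. c * (1 - norm (a j))\<^sup>2" 0] le by simp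
  then have "(\<lambda>j. (norm (test_fun p n (a j) z) powr p) powr (1 / p)) \<longlonglongrightarrow> 0 powr (1 / p)"
    using p by (intro tendsto_powr2 tendsto_const) auto
  then have "(\<lambda>j. norm (test_fun p n (a j) z)) \<longlonglongrightarrow> 0"
    using p by (simp add: powr_powr)
  then show ?thesis by (rule tendsto_norm_zero_cancel)
qed

text \<open>On the disk the quotient in the test function is at least \<open>(1 - r) / 2\<close>,
  and the disk lies in a ball of radius \<open>3 * (1 - norm a) / (1 - r)\<close> about the apex;
  \<open>312 = 3 * 104\<close>. The condition \<open>r \<le> norm a\<close> keeps out the origin,
  about which squares say nothing.\<close>

lemma test_fun_lower_bound:
  assumes \<mu>: "sets \<mu> = sets (restrict_space borel disk)" and p: "p > 0" and q: "q > 0" and n: "n > 0"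
    and r: "0 < r" "r < 1" and a: "norm a < 1" "r \<le> norm a"
  shows "emeasure \<mu> (pseudo_hyp_disk a r) / ennreal (H (1 - norm a) powr (q / p) * (1 - norm a))
    \<le> ennreal ((2 / (1 - r)) powr (n * q) * (312 / (1 - r))) * tent_sup \<mu> q (test_fun p n a)"
proof -
  let ?h = "1 - norm a" and ?f = "test_fun p n a"
  let ?\<Delta> = "pseudo_hyp_disk a r"
  have h: "?h > 0" using a by simp
  have [measurable]: "?f \<in> borel_measurable \<mu>"
    by (rule holomorphic_measurable[OF \<mu> test_fun_holomorphic[OF a(1)]])
  have \<Delta>m [measurable]: "?\<Delta> \<in> sets \<mu>" by (rule sets_pseudo_hyp_disk[OF \<mu> a(1)])
  define \<nu> where "\<nu> = density \<mu> (\<lambda>z. ennreal (norm (?f z) powr q))"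
  have \<nu>: "sets \<nu> = sets (restrict_space borel disk)" by (simp add: \<nu>_def \<mu>)
  define s where "s = 3 * ?h / (1 - r)"
  have s: "s > 0" using h r by (simp add: s_def)
  define c where "c = H ?h powr (- q / p) * ((1 - r) / 2) powr (n * q)"
  have Hh: "H ?h > 0" by (rule H_pos[OF h])
  have "ennreal c * emeasure \<mu> ?\<Delta> = (\<integral>\<^sup>+z. ennreal c * indicator ?\<Delta> z \<partial>\<mu>)"
    by (rule nn_integral_cmult_indicator[symmetric]) simp
  also have "\<dots> \<le> (\<integral>\<^sup>+z. ennreal (norm (?f z) powr q) * indicator ?\<Delta> z \<partial>\<mu>)"
  proof (rule nn_integral_mono)
    fix z
    show "ennreal c * indicator ?\<Delta> z \<le> ennreal (norm (?f z) powr q) * indicator ?\<Delta> z"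
    proof (cases "z \<in> ?\<Delta>")
      case True
      note b = pseudo_hyp_disk_bounds[OF a(1) r True]
      have pos: "norm (1 - cnj a * z) > 0"
        using one_minus_cnj_pos[of z a] b(1) a by simp
      have "norm (1 - cnj a * z) * (1 - r) \<le> 2 * ?h" using b(2) r by (simp add: pos_le_divide_eq)
      then have "(1 - r) / 2 \<le> ?h / norm (1 - cnj a * z)"
        using pos by (simp only: pos_le_divide_eq) (simp add: mult_ac)
      then have "((1 - r) / 2) powr (n * q) \<le> (?h / norm (1 - cnj a * z)) powr (n * q)"
        using r q by (intro powr_mono2) auto
      then have "c \<le> norm (?f z) powr q"
        unfolding c_def norm_test_fun[OF a(1) p n] by (intro mult_left_mono) auto
      then show ?thesis using True by (simp add: ennreal_leI)
    qed simp
  qed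
  also have "\<dots> = emeasure \<nu> ?\<Delta>" unfolding \<nu>_def by (rule emeasure_density[symmetric]) auto
  also have "\<dots> \<le> emeasure \<nu> (disk \<inter> ball (apex a) s - {0})"
  proof (rule emeasure_mono)
    show "?\<Delta> \<subseteq> disk \<inter> ball (apex a) s - {0}"
      using pseudo_hyp_disk_bounds[OF a(1) r] a(2) by (auto simp: s_def dist_norm norm_minus_commute)
    have "disk \<inter> ball (apex a) s - {0} \<in> sets borel" by simp
    then show "disk \<inter> ball (apex a) s - {0} \<in> sets \<nu>"
      by (rule borel_subset_disk[OF \<nu>]) auto
  qed
  also have "\<dots> \<le> tent_sup \<mu> q ?f * ennreal (104 * s)"
  proof (rule emeasure_ball_le[OF \<nu>])
    fix b :: complex assume b: "b \<in> disk - {0}"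
    then show cs: "carleson_square b \<in> sets \<nu>" by (intro carleson_square_in_sets[OF \<nu>]) auto
    have "carleson_mean \<mu> q ?f b \<le> tent_sup \<mu> q ?f" unfolding tent_sup_def using b by (intro SUP_upper)
    then have "carleson_mean \<mu> q ?f b * ennreal (1 - norm b) \<le> tent_sup \<mu> q ?f * ennreal (1 - norm b)"
      by (rule mult_right_mono) simp
    moreover have "carleson_mean \<mu> q ?f b * ennreal (1 - norm b) = (\<integral>\<^sup>+z\<in>carleson_square b. ennreal (norm (?f z) powr q) \<partial>\<mu>)"
      unfolding carleson_mean_def using b by (simp add: ennreal_divide_times ennreal_divide_self)
    moreover have "emeasure \<nu> (carleson_square b) = (\<integral>\<^sup>+z\<in>carleson_square b. ennreal (norm (?f z) powr q) \<partial>\<mu>)"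
      unfolding \<nu>_def using cs by (intro emeasure_density) (auto simp: \<nu>_def)
    ultimately show "emeasure \<nu> (carleson_square b) \<le> tent_sup \<mu> q ?f * ennreal (1 - norm b)" by simp
  qed (use s in auto)
  finally have main: "ennreal c * emeasure \<mu> ?\<Delta> \<le> tent_sup \<mu> q ?f * ennreal (104 * s)" .
  have c: "c > 0" using Hh r by (simp add: c_def)
  have e1: "emeasure \<mu> ?\<Delta> / ennreal (H ?h powr (q / p) * ?h)
      = ennreal ((2 / (1 - r)) powr (n * q) / ?h) * (ennreal c * emeasure \<mu> ?\<Delta>)"
  proof -
    have "(2 / (1 - r)) powr (n * q) * ((1 - r) / 2) powr (n * q) = 1"
    proof -
      have "2 / (1 - r) * ((1 - r) / 2) = 1" using r by simp
      then show ?thesis using powr_mult[of "2 / (1 - r)" "(1 - r) / 2" "n * q"] by (simp only: powr_one_eq_one)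
    qed
    then have eq: "(2 / (1 - r)) powr (n * q) / ?h * c = 1 / (H ?h powr (q / p) * ?h)"
      using Hh h by (simp add: c_def powr_minus_divide field_simps)
    have "ennreal ((2 / (1 - r)) powr (n * q) / ?h) * (ennreal c * emeasure \<mu> ?\<Delta>)
      = ennreal ((2 / (1 - r)) powr (n * q) / ?h * c) * emeasure \<mu> ?\<Delta>"
      using h c by (subst ennreal_mult) (auto simp: mult.assoc)
    also have "\<dots> = emeasure \<mu> ?\<Delta> / ennreal (H ?h powr (q / p) * ?h)"
      unfolding eq using Hh h by (simp add: divide_ennreal_def inverse_ennreal mult.commute inverse_eq_divide)
    finally show ?thesis ..
  qed
  have "emeasure \<mu> ?\<Delta> / ennreal (H ?h powr (q / p) * ?h)
      \<le> ennreal ((2 / (1 - r)) powr (n * q) / ?h) * (tent_sup \<mu> q ?f * ennreal (104 * s))"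
    unfolding e1 by (intro mult_left_mono main) simp
  also have "\<dots> = ennreal ((2 / (1 - r)) powr (n * q) / ?h * (104 * s)) * tent_sup \<mu> q ?f"
    using h s by (subst ennreal_mult) (auto simp: mult_ac)
  also have "(2 / (1 - r)) powr (n * q) / ?h * (104 * s) = (2 / (1 - r)) powr (n * q) * (312 / (1 - r))"
  proof -
    have "x / y * (104 * (3 * y / (1 - r))) = x * (312 / (1 - r))" if "y \<noteq> 0" for x y :: real
      using that by simp
    from this[of ?h] show ?thesis using h by (simp only: s_def)
  qed
  finally show ?thesis .
qed

end


section \<open>Necessity\<close>

text \<open>Ties the Lebesgue measurable weight to a Borel radial profile \<open>g\<close>; from
  here on all computations use \<open>g\<close> and \<open>H\<close>.\<close>

locale weight_setting = doubling_weight +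
  fixes \<omega> :: "complex \<Rightarrow> real"
  assumes radial: "radial_weight \<omega>"
    and weight_eq: "AE z in lborel. z \<in> disk \<longrightarrow> \<omega> z = g (norm z)"
    and weight_hat_eq: "z \<in> disk \<Longrightarrow> weight_hat \<omega> z = ennreal (H (1 - norm z))"

lemma D_class_weight_setting:
  assumes \<omega>: "\<omega> \<in> D_class" and pos: "\<forall>z\<in>disk. weight_hat \<omega> z > 0"
  shows "\<exists>g D K \<kappa>. weight_setting g D K \<kappa> \<omega>"
proof -
  have rad: "radial_weight \<omega>" using \<omega> by (auto simp: D_class_def D_hat_def)
  obtain g where g [measurable]: "g \<in> borel_measurable borel" and g0: "\<And>s. 0 \<le> g s"
    and ae1: "AE s in lborel. 0 < s \<and> s < 1 \<longrightarrow> \<omega> (of_real s) = g s"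
    and ae2: "AE z in lborel. z \<in> disk \<longrightarrow> \<omega> z = g (norm z)"
    by (rule radial_weight_borel[OF rad]) (rule that)
  define T where "T h = (\<integral>\<^sup>+s\<in>{1 - h..<1}. ennreal (g s) \<partial>lborel)" for h
  have hat: "weight_hat \<omega> z = T (1 - norm z)" for z
    unfolding weight_hat_borel[where \<omega> = \<omega>, OF g ae1] T_def by simp
  obtain C where C: "C \<ge> 1" "\<And>r. 0 \<le> r \<and> r < 1 \<Longrightarrow>
      weight_hat \<omega> (of_real r) \<le> ennreal C * weight_hat \<omega> (of_real ((1 + r) / 2))"
    using \<omega> by (auto simp: D_class_def D_hat_def)
  obtain K C' where K: "K > 1" "C' > 1" "\<And>r. 0 \<le> r \<and> r < 1 \<Longrightarrow>
      weight_hat \<omega> (of_real r) \<ge> ennreal C' * weight_hat \<omega> (of_real (1 - (1 - r) / K))"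
    using \<omega> by (auto simp: D_class_def D_check_def)
  have dbl: "T (2 * h) \<le> ennreal C * T h" if "0 < h" "h \<le> 1 / 2" for h
  proof -
    have "norm (complex_of_real (1 - 2 * h)) = 1 - 2 * h" "norm (complex_of_real (1 - h)) = 1 - h"
      using that unfolding norm_of_real by auto
    moreover have "(1 + (1 - 2 * h)) / 2 = 1 - h" by simp
    ultimately show ?thesis using C(2)[of "1 - 2 * h"] that by (simp only: hat) simp
  qed
  have rev: "T (h / K) \<le> ennreal (1 / C') * T h" if h: "0 < h" "h \<le> 1" for h
  proof -
    have hK: "0 < h / K" "h / K \<le> 1" using h K by (auto simp: divide_le_eq)
    have "norm (complex_of_real (1 - h)) = 1 - h" "norm (complex_of_real (1 - h / K)) = 1 - h / K"
      using h hK unfolding norm_of_real by auto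
    moreover have "1 - (1 - (1 - h)) / K = 1 - h / K" by simp
    ultimately have le: "ennreal C' * T (h / K) \<le> T h" using K(3)[of "1 - h"] h by (simp only: hat) simp
    have "T (h / K) = ennreal (1 / C' * C') * T (h / K)" using K by simp
    also have "\<dots> = ennreal (1 / C') * (ennreal C' * T (h / K))"
      using K by (subst ennreal_mult) (auto simp: mult.assoc)
    also have "\<dots> \<le> ennreal (1 / C') * T h" using le by (rule mult_left_mono) simp
    finally show ?thesis .
  qed
  \<comment> \<open>Area integrability controls the radial profile only away from the origin, where
    the polar density is bounded below. Doubling at \<open>h = 1 / 2\<close> then yields a finite
    \<open>T 1\<close>.\<close>
  have "T (1 / 2) < \<infinity>"
  proof -
    have "integrable lebesgue (\<lambda>z. indicator disk z *\<^sub>R \<omega> z)"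
      using rad by (simp add: radial_weight_def set_integrable_def)
    then have "(\<integral>\<^sup>+z. ennreal (norm (indicator disk z *\<^sub>R \<omega> z)) \<partial>lebesgue) < \<infinity>"
      by (simp only: integrable_iff_bounded)
    also have "(\<integral>\<^sup>+z. ennreal (norm (indicator disk z *\<^sub>R \<omega> z)) \<partial>lebesgue) = (\<integral>\<^sup>+z. 1 * (ennreal (g (norm z)) * indicator disk z) \<partial>lborel)"
      unfolding nn_integral_completion using ae2 g0
      by (intro nn_integral_cong_AE) (auto elim!: eventually_mono split: split_indicator)
    also have "\<dots> = (\<integral>\<^sup>+z. 1 \<partial>radial_measure g)"
      unfolding radial_measure_def by (subst nn_integral_restrict_space) (auto simp: emeasure_density)
    also have "\<dots> = (\<integral>\<^sup>+\<rho>\<in>{0<..<1}. ennreal \<rho> * ennreal (g \<rho>) * (\<integral>\<^sup>+t\<in>{0..<2*pi}. 1 \<partial>lborel) \<partial>lborel)"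
      by (rule nn_integral_radial_measure) auto
    finally have fin: "(\<integral>\<^sup>+\<rho>\<in>{0<..<1}. ennreal \<rho> * ennreal (g \<rho>) * (\<integral>\<^sup>+t\<in>{0..<2*pi}. 1 \<partial>lborel) \<partial>lborel) < \<infinity>" .
    have "T (1 / 2) \<le> (\<integral>\<^sup>+\<rho>\<in>{0<..<1}. ennreal \<rho> * ennreal (g \<rho>) * (\<integral>\<^sup>+t\<in>{0..<2*pi}. 1 \<partial>lborel) \<partial>lborel)"
      unfolding T_def
    proof (intro nn_integral_mono)
      fix \<rho>
      have "1 * ennreal (g \<rho>) \<le> (ennreal \<rho> * ennreal (2 * pi)) * ennreal (g \<rho>)" if "1 / 2 \<le> \<rho>"
      proof (rule mult_right_mono)
        have "1 / 2 * 2 \<le> \<rho> * (2 * pi)" using that pi_gt3 by (intro mult_mono) auto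
        then show "1 \<le> ennreal \<rho> * ennreal (2 * pi)"
          using that by (subst ennreal_mult[symmetric]) (auto simp: ennreal_ge_1)
      qed simp
      then show "ennreal (g \<rho>) * indicator {1 - 1 / 2..<1} \<rho> \<le> ennreal \<rho> * ennreal (g \<rho>) * (\<integral>\<^sup>+t\<in>{0..<2*pi}. 1 \<partial>lborel) * indicator {0<..<1} \<rho>"
        by (auto split: split_indicator simp: mult_ac)
    qed
    then show ?thesis using fin by (rule le_less_trans)
  qed
  then have "ennreal C * T (1 / 2) < \<infinity>" by (simp add: ennreal_mult_less_top)
  moreover have "T 1 \<le> ennreal C * T (1 / 2)" using dbl[of "1 / 2"] by simp
  ultimately have T1: "T 1 < \<infinity>" by (rule le_less_trans[rotated])
  interpret doubling_weight g C K "1 / C'"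
  proof
    show "(\<integral>\<^sup>+s\<in>{0..<1}. ennreal (g s) \<partial>lborel) < \<infinity>" using T1 by (simp add: T_def)
    show "0 < (\<integral>\<^sup>+s\<in>{1 - h..<1}. ennreal (g s) \<partial>lborel)" if "0 < h" "h \<le> 1" for h
    proof -
      have "norm (complex_of_real (1 - h)) = 1 - h" using that unfolding norm_of_real by auto
      then show ?thesis using pos[rule_format, of "of_real (1 - h)"] that hat[of "of_real (1 - h)"]
        by (simp add: T_def del: of_real_diff)
    qed
    show "(\<integral>\<^sup>+s\<in>{1 - 2 * h..<1}. ennreal (g s) \<partial>lborel) \<le> ennreal C * (\<integral>\<^sup>+s\<in>{1 - h..<1}. ennreal (g s) \<partial>lborel)"
      if "0 < h" "h \<le> 1 / 2" for h using dbl[OF that] by (simp add: T_def)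
    show "(\<integral>\<^sup>+s\<in>{1 - h / K..<1}. ennreal (g s) \<partial>lborel) \<le> ennreal (1 / C') * (\<integral>\<^sup>+s\<in>{1 - h..<1}. ennreal (g s) \<partial>lborel)"
      if "0 < h" "h \<le> 1" for h using rev[OF that] by (simp add: T_def)
  qed (use g0 C K in auto)
  have "weight_setting g C K (1 / C') \<omega>"
  proof
    show "weight_hat \<omega> z = ennreal (H (1 - norm z))" if "z \<in> disk" for z
      using that by (subst ennreal_H) (auto simp: hat T_def)
  qed (use rad ae2 in auto)
  then show ?thesis by blast
qed

context weight_setting
begin

lemma carleson_mean_weight:
  assumes f: "f holomorphic_on disk" and a: "norm a < 1"
  shows "carleson_mean (weight_measure \<omega>) p f a = carleson_mean W p f a"
proof -
  have [measurable]: "f \<in> borel_measurable (restrict_space borel disk)"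
    by (rule holomorphic_measurable[OF refl f])
  have "carleson_square a \<in> sets (restrict_space borel disk)"
    by (rule carleson_square_in_sets[OF refl a])
  then have "(\<lambda>z. ennreal (norm (f z) powr p) * indicator (carleson_square a) z) \<in> borel_measurable (restrict_space borel disk)"
    by measurable
  from nn_integral_weight_measure[OF g_measurable radial weight_eq this]
  show ?thesis by (simp add: carleson_mean_def)
qed

lemma tent_sup_weight: "f holomorphic_on disk \<Longrightarrow> tent_sup (weight_measure \<omega>) p f = tent_sup W p f"
  unfolding tent_sup_def by (intro SUP_cong) (auto simp: carleson_mean_weight)

lemma tent_norm_weight: "f holomorphic_on disk \<Longrightarrow> p > 0 \<Longrightarrow> tent_norm (weight_measure \<omega>) p f = epow (tent_sup W p f) (1 / p)"
  by (simp add: tent_norm_eq tent_sup_weight)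

lemma holomorphic_measurable_weight:
  assumes "f holomorphic_on disk"
  shows "f \<in> borel_measurable (completion (weight_measure \<omega>))"
proof -
  have m: "f \<in> borel_measurable (restrict_space borel disk)" by (rule holomorphic_measurable[OF refl assms])
  have sub: "sets (restrict_space borel disk) \<subseteq> sets (restrict_space lebesgue (disk::complex set))"
    unfolding sets_restrict_space by (intro image_mono subsetI) simp
  have "f \<in> borel_measurable (restrict_space lebesgue disk)"
    using m measurable_mono[OF order_refl refl sub] by (auto simp: space_restrict_space)
  then have "f \<in> borel_measurable (weight_measure \<omega>)"
    by (simp add: weight_measure_def)
  then show ?thesis by (rule measurable_completion)
qed

lemma AT_infty_iff: "p > 0 \<Longrightarrow> f \<in> AT_infty \<omega> p \<longleftrightarrow> f holomorphic_on disk \<and> tent_sup W p f < \<infinity>"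
  by (auto simp: AT_infty_def tent_infty_def holomorphic_measurable_weight tent_norm_weight epow_less_top_iff
      simp del: infinity_ennreal_def)

lemma AT_zero_iff: "p > 0 \<Longrightarrow> f \<in> AT_zero \<omega> p \<longleftrightarrow>
  f holomorphic_on disk \<and> tent_sup W p f < \<infinity> \<and> (carleson_mean W p f \<longlongrightarrow> 0) to_circle"
proof -
  assume p: "p > 0"
  have "(carleson_mean (weight_measure \<omega>) p f \<longlongrightarrow> 0) to_circle \<longleftrightarrow> (carleson_mean W p f \<longlongrightarrow> 0) to_circle"
    if "f holomorphic_on disk"
  proof (rule tendsto_cong)
    show "eventually (\<lambda>a. carleson_mean (weight_measure \<omega>) p f a = carleson_mean W p f a) to_circle"
      unfolding eventually_to_circle using that by (intro exI[of _ 0]) (auto simp: carleson_mean_weight)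
  qed
  then show ?thesis using AT_infty_iff[OF p, of f] by (auto simp: AT_zero_def tent_zero_def AT_infty_def)
qed

lemma AT_zero_subset: "AT_zero \<omega> p \<subseteq> AT_infty \<omega> p"
  by (auto simp: AT_zero_def AT_infty_def tent_zero_def)

text \<open>For \<open>\<gamma> = q / p\<close> this is the \<open>q\<close>-th power of
  \<open>G_fun\<close>, free of roots and close to the shape of
  \<open>vanishing_growth\<close>.\<close>

definition ratio :: "complex measure \<Rightarrow> real \<Rightarrow> real \<Rightarrow> complex \<Rightarrow> ennreal" where
  "ratio \<mu> \<gamma> r z = emeasure \<mu> (pseudo_hyp_disk z r) / ennreal (H (1 - norm z) powr \<gamma> * (1 - norm z))"

lemma G_fun_eq:
  assumes p: "p > 0" "q > 0" and z: "z \<in> disk"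
  shows "epow (G_fun \<omega> \<mu> p q r z) q = ratio \<mu> (q / p) r z"
proof -
  let ?h = "1 - norm z"
  have h: "?h > 0" using z by simp
  have Hh: "H ?h > 0" by (rule H_pos[OF h])
  define X where "X = H ?h powr (1 / p) * ?h powr (1 / q)"
  have X: "X > 0" using Hh h by (simp add: X_def)
  have Xq: "X powr q = H ?h powr (q / p) * ?h"
    using p h by (simp add: X_def powr_mult powr_powr)
  have "epow (weight_hat \<omega> z) (1 / p) * ennreal (?h powr (1 / q)) = ennreal X"
    using Hh by (simp add: weight_hat_eq[OF z] X_def ennreal_mult)
  then have G: "G_fun \<omega> \<mu> p q r z = epow (emeasure \<mu> (pseudo_hyp_disk z r)) (1 / q) / ennreal X"
    by (simp add: G_fun_def)
  show ?thesis
  proof (cases "emeasure \<mu> (pseudo_hyp_disk z r)")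
    case (real x)
    then have "G_fun \<omega> \<mu> p q r z = ennreal (x powr (1 / q) / X)"
      using X by (simp add: G divide_ennreal)
    then have "epow (G_fun \<omega> \<mu> p q r z) q = ennreal ((x powr (1 / q) / X) powr q)" using X by simp
    also have "(x powr (1 / q) / X) powr q = x / (H ?h powr (q / p) * ?h)"
      using p real(1) by (simp add: powr_divide powr_powr Xq)
    also have "ennreal \<dots> = ratio \<mu> (q / p) r z"
      using real Hh h by (simp add: ratio_def divide_ennreal)
    finally show ?thesis .
  next
    case top
    then show ?thesis using X Hh h by (simp add: G ratio_def ennreal_top_divide)
  qed
qed

lemma vanishes_iff:
  assumes p: "p > 0" "q > 0"
  shows "vanishes_at_circle (G_fun \<omega> \<mu> p q r) \<longleftrightarrow>
    (\<forall>z\<in>disk. ratio \<mu> (q / p) r z < \<infinity>) \<and> (ratio \<mu> (q / p) r \<longlongrightarrow> 0) to_circle"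
proof -
  have "(G_fun \<omega> \<mu> p q r \<longlongrightarrow> 0) to_circle \<longleftrightarrow> ((\<lambda>z. epow (G_fun \<omega> \<mu> p q r z) q) \<longlongrightarrow> 0) to_circle"
    using p by (simp add: epow_tendsto_0)
  also have "\<dots> \<longleftrightarrow> (ratio \<mu> (q / p) r \<longlongrightarrow> 0) to_circle"
  proof (rule tendsto_cong)
    show "eventually (\<lambda>z. epow (G_fun \<omega> \<mu> p q r z) q = ratio \<mu> (q / p) r z) to_circle"
      unfolding eventually_to_circle using p by (intro exI[of _ 0]) (auto simp: G_fun_eq)
  qed
  finally show ?thesis
    unfolding vanishes_at_circle_def using G_fun_eq[OF p, of _ \<mu> r] by (metis epow_less_top_iff)
qed

text \<open>The spaces \<open>X\<close> and \<open>Y\<close> are left open between the bounds that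
  the proof uses, so both embeddings are covered: test functions need only lie in \<open>X\<close>,
  and \<open>Y\<close> only has to provide finite norms.\<close>

lemma necessity:
  assumes \<mu>: "sets \<mu> = sets (restrict_space borel disk)" and \<mu>0: "emeasure \<mu> {0} < \<infinity>" and p: "0 < p" "p \<le> q" and r: "0 < r" "r < 1"
    and ce: "compact_embedding X (tent_norm (weight_measure \<omega>) p) Y (tent_norm \<mu> q)"
    and X: "AT_zero \<omega> p \<subseteq> X" and Y: "Y \<subseteq> tent_infty \<mu> q"
  shows "vanishes_at_circle (G_fun \<omega> \<mu> p q r)"
proof -
  have q: "q > 0" using p by simp
  have XY: "X \<subseteq> Y" using ce by (simp add: compact_embedding_def)
  have Ym: "Y \<subseteq> borel_measurable (completion \<mu>)" using Y by (auto simp: tent_infty_def)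
  have zero_mem: "f \<in> AT_zero \<omega> p" if "f holomorphic_on disk" "\<And>z. z \<in> disk \<Longrightarrow> norm (f z) \<le> B" "tent_sup W p f < \<infinity>" for f B
    unfolding AT_zero_iff[OF p(1)] using that bounded_function_vanishing[OF that(1,2) p(1)] by blast
  \<comment> \<open>The constant function \<open>1\<close> lies in \<open>X\<close>. Its finite norm
    in \<open>Y\<close> makes \<open>\<mu>\<close> finite off the origin, and \<open>\<mu>0\<close>
    takes care of the origin itself.\<close>
  have fin: "ratio \<mu> (q / p) r z < \<infinity>" if z: "z \<in> disk" for z
  proof -
    let ?one = "\<lambda>_::complex. 1 :: complex"
    have hol: "?one holomorphic_on disk" by simp
    have "tent_sup W p ?one \<le> ennreal (1 * 32 * D * H 1)"
      unfolding tent_sup_def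
    proof (rule SUP_least)
      fix b :: complex assume b: "b \<in> disk - {0}"
      have "carleson_mean W p ?one b \<le> ennreal (1 powr p * 32 * D * H (1 - norm b))"
        using b p by (intro carleson_mean_bounded_function[OF hol]) auto
      also have "\<dots> \<le> ennreal (1 * 32 * D * H 1)"
        using b D H_mono[of "1 - norm b" 1] less_imp_le[OF H_pos[of "1 - norm b"]] by (intro ennreal_leI mult_mono) auto
      finally show "carleson_mean W p ?one b \<le> ennreal (1 * 32 * D * H 1)" .
    qed
    then have "tent_sup W p ?one < \<infinity>" by (rule le_less_trans) simp
    then have "?one \<in> AT_zero \<omega> p" by (intro zero_mem[OF hol, of 1]) auto
    then have "?one \<in> tent_infty \<mu> q" using X XY Y by blast
    then have A: "tent_sup \<mu> q ?one < \<infinity>"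
      using q by (simp only: tent_infty_def mem_Collect_eq tent_norm_eq epow_less_top_iff)
    have "emeasure \<mu> (disk \<inter> ball 1 3 - {0}) \<le> tent_sup \<mu> q ?one * ennreal (104 * 3)"
    proof (rule emeasure_ball_le[OF \<mu>])
      fix b :: complex assume b: "b \<in> disk - {0}"
      then show cs: "carleson_square b \<in> sets \<mu>" by (intro carleson_square_in_sets[OF \<mu>]) auto
      have "emeasure \<mu> (carleson_square b) / ennreal (1 - norm b) = carleson_mean \<mu> q ?one b"
        using cs by (simp add: carleson_mean_def)
      also have "\<dots> \<le> tent_sup \<mu> q ?one" unfolding tent_sup_def using b by (intro SUP_upper)
      finally have "emeasure \<mu> (carleson_square b) / ennreal (1 - norm b) * ennreal (1 - norm b) \<le> tent_sup \<mu> q ?one * ennreal (1 - norm b)"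
        by (rule mult_right_mono) simp
      then show "emeasure \<mu> (carleson_square b) \<le> tent_sup \<mu> q ?one * ennreal (1 - norm b)"
        using b by (simp add: ennreal_divide_times ennreal_divide_self)
    qed auto
    also have "\<dots> < \<infinity>" using A by (simp add: ennreal_mult_less_top)
    finally have fin1: "emeasure \<mu> (disk \<inter> ball 1 3 - {0}) < \<infinity>" .
    have "norm (1 - w) < 3" if "norm w < 1" for w :: complex
      using norm_triangle_ineq4[of 1 w] that by simp
    then have sub: "pseudo_hyp_disk z r \<subseteq> (disk \<inter> ball 1 3 - {0}) \<union> {0}"
      by (auto simp: pseudo_hyp_disk_def dist_norm)
    have s1: "disk \<inter> ball 1 3 - {0} \<in> sets \<mu>" "{0} \<in> sets \<mu>"
      by (rule borel_subset_disk[OF \<mu>]; auto)+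
    have "emeasure \<mu> (pseudo_hyp_disk z r) \<le> emeasure \<mu> ((disk \<inter> ball 1 3 - {0}) \<union> {0})"
      by (rule emeasure_mono[OF sub sets.Un[OF s1]])
    also have "\<dots> \<le> emeasure \<mu> (disk \<inter> ball 1 3 - {0}) + emeasure \<mu> {0}"
      by (rule emeasure_subadditive[OF s1])
    also have "\<dots> < \<infinity>" using fin1 \<mu>0 by simp
    finally have "emeasure \<mu> (pseudo_hyp_disk z r) < \<infinity>" .
    moreover have "H (1 - norm z) powr (q / p) * (1 - norm z) > 0" using z H_pos[of "1 - norm z"] by simp
    ultimately show ?thesis
      unfolding ratio_def by (cases "emeasure \<mu> (pseudo_hyp_disk z r)") (auto simp: divide_ennreal)
  qed
  \<comment> \<open>Any \<open>n\<close> with \<open>n * p \<ge> k\<close> and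
    \<open>4 * D < 2 ^ k\<close> will do.\<close>
  obtain n :: nat where n: "n > 0" "4 * D \<le> 2 powr (n * p)"
  proof -
    obtain k where k: "4 * D < 2 ^ k" using real_arch_pow[of 2 "4 * D"] by auto
    obtain n :: nat where "real k / p + 1 < n" using reals_Archimedean2 by blast
    then have "n > 0" "real k \<le> n * p" using p by (auto simp: field_simps intro: gr0I)
    moreover have "2 powr real k \<le> 2 powr (n * p)" using \<open>real k \<le> n * p\<close> by (intro powr_mono) auto
    ultimately show thesis using that[of n] k by (simp add: powr_realpow)
  qed
  have lim: "(ratio \<mu> (q / p) r \<longlongrightarrow> 0) to_circle"
  proof (rule ccontr)
    assume "\<not> ?thesis"
    then obtain e where e: "e > 0" "\<not> eventually (\<lambda>z. ratio \<mu> (q / p) r z < e) to_circle"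
      unfolding ennreal_tendsto_0_iff by blast
    \<comment> \<open>The maximum with \<open>r\<close> secures \<open>r \<le> norm (a j)\<close>,
      as \<open>test_fun_lower_bound\<close> requires.\<close>
    have "\<exists>a. max r (1 - 1 / Suc j) < norm a \<and> norm a < 1 \<and> \<not> ratio \<mu> (q / p) r a < e" for j :: nat
      using e(2) r unfolding eventually_to_circle by (auto dest!: spec[of _ "max r (1 - 1 / Suc j)"])
    then have "\<forall>j::nat. \<exists>a. max r (1 - 1 / Suc j) < norm a \<and> norm a < 1 \<and> \<not> ratio \<mu> (q / p) r a < e" ..
    from choice[OF this] obtain a where a': "\<forall>j::nat. max r (1 - 1 / Suc j) < norm (a j) \<and> norm (a j) < 1 \<and> \<not> ratio \<mu> (q / p) r (a j) < e" ..
    then have a: "norm (a j) < 1" "r \<le> norm (a j)" "1 - 1 / Suc j \<le> norm (a j)" "e \<le> ratio \<mu> (q / p) r (a j)" for j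
      by (auto simp: not_less less_imp_le dest: spec[of _ j])
    have a_lim: "(\<lambda>j. norm (a j)) \<longlonglongrightarrow> 1"
    proof (rule tendsto_sandwich[OF _ _ _ tendsto_const])
      have "(\<lambda>j. 1 - 1 / real (Suc j)) \<longlonglongrightarrow> 1 - 0"
        by (intro tendsto_intros LIMSEQ_Suc lim_1_over_n)
      then show "(\<lambda>j. 1 - 1 / real (Suc j)) \<longlonglongrightarrow> 1" by simp
    qed (use a in \<open>auto intro!: always_eventually less_imp_le\<close>)
    let ?f = "\<lambda>j. test_fun p n (a j)"
    have ts: "tent_sup W p (?f j) \<le> ennreal (128 * D\<^sup>2)" for j
      by (rule test_fun_tent_sup[OF a(1) p(1) n])
    have fX: "?f j \<in> X" for j
    proof -
      have "tent_sup W p (?f j) < \<infinity>" using ts[of j] by (rule le_less_trans) simp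
      then have "?f j \<in> AT_zero \<omega> p"
        using zero_mem[OF test_fun_holomorphic[OF a(1)] test_fun_bounded[OF a(1)]] by blast
      then show ?thesis using X by blast
    qed
    have "\<exists>\<sigma>. strict_mono (\<sigma> :: nat \<Rightarrow> nat) \<and> (\<lambda>j. tent_sup \<mu> q (?f (\<sigma> j))) \<longlonglongrightarrow> 0"
    proof (rule compact_embedding_null[OF ce \<mu> q Ym fX])
      show "tent_norm (weight_measure \<omega>) p (?f j) \<le> epow (ennreal (128 * D\<^sup>2)) (1 / p)" for j
        using p ts by (simp add: tent_norm_weight test_fun_holomorphic a(1) epow_mono del: epow_ennreal)
      show "epow (ennreal (128 * D\<^sup>2)) (1 / p) < \<infinity>" by simp
      show "(\<lambda>j. ?f j z) \<longlonglongrightarrow> 0" if "z \<in> disk" for z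
        by (rule test_fun_tendsto_0[OF a(1) a_lim p(1) n that])
    qed
    then obtain \<sigma> where \<sigma>: "strict_mono (\<sigma> :: nat \<Rightarrow> nat)" "(\<lambda>j. tent_sup \<mu> q (?f (\<sigma> j))) \<longlonglongrightarrow> 0" by blast
    define c where "c = ennreal ((2 / (1 - r)) powr (n * q) * (312 / (1 - r)))"
    have "(\<lambda>j. c * tent_sup \<mu> q (?f (\<sigma> j))) \<longlonglongrightarrow> c * 0"
      by (rule ennreal_tendsto_cmult[OF _ \<sigma>(2)]) (simp add: c_def)
    then have "(\<lambda>j. c * tent_sup \<mu> q (?f (\<sigma> j))) \<longlonglongrightarrow> 0" by simp
    then have "eventually (\<lambda>j. c * tent_sup \<mu> q (?f (\<sigma> j)) < e) sequentially"
      using e(1) by (rule order_tendstoD)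
    then obtain j where "c * tent_sup \<mu> q (?f (\<sigma> j)) < e" by (auto simp: eventually_sequentially)
    moreover have "ratio \<mu> (q / p) r (a (\<sigma> j)) \<le> c * tent_sup \<mu> q (?f (\<sigma> j))"
      unfolding ratio_def c_def by (rule test_fun_lower_bound[OF \<mu> p(1) q n(1) r a(1,2)])
    ultimately show False using a(4)[of "\<sigma> j"] by (meson not_le order_trans le_less_trans)
  qed
  show ?thesis using fin lim vanishes_iff[OF p(1) q, of \<mu> r] by blast
qed

end


section \<open>Sufficiency\<close>

lemma ennreal_divide_cancel: "c > 0 \<Longrightarrow> x / ennreal c * ennreal c = x"
  by (simp add: ennreal_divide_times ennreal_divide_self)

context weight_setting
begin

context
  fixes \<mu> :: "complex measure" and p q r :: real
  assumes \<mu>: "sets \<mu> = sets (restrict_space borel disk)"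
    and p: "0 < p" and pq: "p \<le> q" and r: "0 < r" "r < 1"
    and finite_ratio: "\<And>z. z \<in> disk \<Longrightarrow> ratio \<mu> (q / p) r z < \<infinity>"
    and ratio_lim: "(ratio \<mu> (q / p) r \<longlongrightarrow> 0) to_circle"
begin

lemma q_pos: "q > 0" using p pq by simp

lemma emeasure_pseudo_hyp_disk_finite:
  assumes z: "z \<in> disk"
  shows "emeasure \<mu> (pseudo_hyp_disk z r) < \<infinity>"
proof -
  have "H (1 - norm z) powr (q / p) * (1 - norm z) > 0" using z H_pos[of "1 - norm z"] by simp
  then show ?thesis
    using finite_ratio[OF z] by (cases "emeasure \<mu> (pseudo_hyp_disk z r)") (auto simp: ratio_def ennreal_top_divide)
qed

lemma sets_cball: "\<rho> < 1 \<Longrightarrow> cball 0 \<rho> \<in> sets \<mu>"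
  by (rule borel_subset_disk[OF \<mu>]) auto

text \<open>By compactness finitely many disks of finite measure cover the ball.\<close>

lemma emeasure_cball_finite:
  assumes "\<rho> < 1"
  shows "emeasure \<mu> (cball 0 \<rho>) < \<infinity>"
proof -
  have cover: "cball (0 :: complex) \<rho> \<subseteq> (\<Union>u\<in>cball 0 \<rho>. ball u (r * (1 - norm u)))"
  proof
    fix z :: complex assume z: "z \<in> cball 0 \<rho>"
    then have "r * (1 - norm z) > 0" using assms r by auto
    then show "z \<in> (\<Union>u\<in>cball 0 \<rho>. ball u (r * (1 - norm u)))"
      using z by (intro UN_I[of z]) simp_all
  qed
  obtain F where F: "F \<subseteq> cball (0 :: complex) \<rho>" "finite F" "cball 0 \<rho> \<subseteq> (\<Union>u\<in>F. ball u (r * (1 - norm u)))"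
    by (rule compactE_image[OF compact_cball _ cover], rule open_ball, rule that)
  have Fd: "u \<in> disk" if "u \<in> F" for u using F(1) assms that by auto
  have sub: "cball 0 \<rho> \<subseteq> (\<Union>u\<in>F. pseudo_hyp_disk u r)"
  proof
    fix z :: complex assume z: "z \<in> cball 0 \<rho>"
    then obtain u where u: "u \<in> F" "z \<in> ball u (r * (1 - norm u))" using F(3) by blast
    then have "z \<in> pseudo_hyp_disk u r"
      using ball_subset_pseudo_hyp_disk[of u r] Fd[OF u(1)] z assms by auto
    then show "z \<in> (\<Union>u\<in>F. pseudo_hyp_disk u r)" using u(1) by blast
  qed
  have m: "pseudo_hyp_disk u r \<in> sets \<mu>" if "u \<in> F" for u
    using sets_pseudo_hyp_disk[OF \<mu>] Fd[OF that] by simp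
  have "emeasure \<mu> (cball 0 \<rho>) \<le> emeasure \<mu> (\<Union>u\<in>F. pseudo_hyp_disk u r)"
    using m F(2) by (intro emeasure_mono sub) auto
  also have "\<dots> \<le> (\<Sum>u\<in>F. emeasure \<mu> (pseudo_hyp_disk u r))"
    using m F(2) by (intro emeasure_subadditive_finite) auto
  also have "\<dots> < \<infinity>" using emeasure_pseudo_hyp_disk_finite[OF Fd] F(2) by (simp add: less_top)
  finally show ?thesis .
qed

text \<open>A consequence of the growth condition rather than an assumption on \<open>\<mu>\<close>:
  closed balls of radius \<open>1 - 1 / Suc n\<close> exhaust the disk.\<close>

lemma sigma_finite_\<mu>: "sigma_finite_measure \<mu>"
proof
  let ?A = "range (\<lambda>n::nat. cball (0::complex) (1 - 1 / Suc n))"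
  have lt: "1 - 1 / real (Suc n) < 1" for n by simp
  have "\<exists>n. z \<in> cball 0 (1 - 1 / real (Suc n))" if z: "z \<in> disk" for z :: complex
  proof -
    obtain n where "inverse (real (Suc n)) < 1 - norm z" using reals_Archimedean[of "1 - norm z"] z by auto
    then show ?thesis by (auto simp: inverse_eq_divide intro!: exI[of _ n])
  qed
  moreover have "z \<in> disk" if "z \<in> cball 0 (1 - 1 / real (Suc n))" for z :: complex and n
    using that lt[of n] by (simp only: mem_cball_0 mem_ball_0 le_less_trans)
  ultimately have "\<Union> ?A = space \<mu>" unfolding space_eq_disk[OF \<mu>] by blast
  moreover have "?A \<subseteq> sets \<mu>" using sets_cball[OF lt] by blast
  moreover have "\<forall>a\<in>?A. emeasure \<mu> a \<noteq> \<infinity>" using emeasure_cball_finite[OF lt] by (auto simp: less_top)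
  ultimately show "\<exists>A. countable A \<and> A \<subseteq> sets \<mu> \<and> \<Union> A = space \<mu> \<and> (\<forall>a\<in>A. emeasure \<mu> a \<noteq> \<infinity>)"
    by (intro exI[of _ ?A]) auto
qed

text \<open>Here \<open>\<delta>\<close> is \<open>r\<close> itself, by
  \<open>ball_subset_pseudo_hyp_disk\<close>. The cap \<open>\<tau> \<le> 1\<close> keeps points of
  height below \<open>\<tau> / 2\<close> away from the origin.\<close>

lemma vanishing_growth_exists:
  assumes \<epsilon>: "\<epsilon> > 0"
  shows "\<exists>\<tau>. 0 < \<tau> \<and> \<tau> \<le> 1 \<and> vanishing_growth g D K \<kappa> \<mu> p q r \<epsilon> \<tau>"
proof -
  have "eventually (\<lambda>z. ratio \<mu> (q / p) r z < ennreal \<epsilon>) to_circle"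
    using ratio_lim \<epsilon> by (intro order_tendstoD) auto
  then obtain b where b: "b < 1" "\<And>z. b < norm z \<Longrightarrow> norm z < 1 \<Longrightarrow> ratio \<mu> (q / p) r z < ennreal \<epsilon>"
    unfolding eventually_to_circle by blast
  interpret sigma_finite_measure \<mu> by (rule sigma_finite_\<mu>)
  have "vanishing_growth g D K \<kappa> \<mu> p q r \<epsilon> (min 1 (1 - b))"
  proof
    fix u :: complex assume u: "norm u < 1" "1 - norm u < min 1 (1 - b)"
    let ?h = "1 - norm u"
    have x: "H ?h powr (q / p) * ?h > 0" using u H_pos[of ?h] by simp
    have m: "pseudo_hyp_disk u r \<in> sets \<mu>" by (rule sets_pseudo_hyp_disk[OF \<mu> u(1)])
    have "emeasure \<mu> (disk \<inter> ball u (r * ?h)) \<le> emeasure \<mu> (pseudo_hyp_disk u r)"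
      by (rule emeasure_mono[OF ball_subset_pseudo_hyp_disk[OF u(1)] m])
    also have "\<dots> = ratio \<mu> (q / p) r u * ennreal (H ?h powr (q / p) * ?h)"
      unfolding ratio_def by (rule ennreal_divide_cancel[OF x, symmetric])
    also have "\<dots> \<le> ennreal \<epsilon> * ennreal (H ?h powr (q / p) * ?h)"
      using b(2)[of u] u by (intro mult_right_mono) auto
    also have "\<dots> = ennreal (\<epsilon> * H ?h powr (q / p) * ?h)"
      using x \<epsilon> by (subst ennreal_mult[symmetric]) (auto simp: mult.assoc)
    finally show "emeasure \<mu> (disk \<inter> ball u (r * ?h)) \<le> ennreal (\<epsilon> * H ?h powr (q / p) * ?h)" .
  qed (use \<mu> p pq r \<epsilon> in auto)
  then show ?thesis using b(1) by (intro exI[of _ "min 1 (1 - b)"]) auto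
qed

lemma holomorphic_bounded_cball:
  assumes "f holomorphic_on disk" "\<rho> < 1"
  obtains B where "\<And>z. norm z \<le> \<rho> \<Longrightarrow> norm (f z) \<le> B"
proof -
  have "continuous_on (cball 0 \<rho>) f"
    using assms by (intro holomorphic_on_imp_continuous_on holomorphic_on_subset[OF assms(1)]) auto
  then have "bounded (f ` cball 0 \<rho>)" by (intro compact_imp_bounded compact_continuous_image) auto
  then obtain B where "\<And>z. z \<in> cball 0 \<rho> \<Longrightarrow> norm (f z) \<le> B" unfolding bounded_iff by blast
  then show thesis by (intro that[of B]) auto
qed

lemma choose_epsilon:
  assumes "e > 0"
  shows "\<exists>\<epsilon>>0. carleson_const r (q / p) * \<epsilon> * X \<le> e"
proof -
  \<comment> \<open>The denominator is the absolute value plus \<open>1\<close>, so neither the sign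
    nor the vanishing of \<open>X\<close> matters.\<close>
  have "carleson_const r (q / p) * (e / (\<bar>carleson_const r (q / p) * X\<bar> + 1)) * X = (carleson_const r (q / p) * X) / (\<bar>carleson_const r (q / p) * X\<bar> + 1) * e"
    by simp
  also have "\<dots> \<le> 1 * e"
  proof (rule mult_right_mono)
    have "x / (\<bar>x\<bar> + 1) \<le> 1" for x :: real by (subst pos_divide_le_eq) auto
    then show "(carleson_const r (q / p) * X) / (\<bar>carleson_const r (q / p) * X\<bar> + 1) \<le> 1" .
  qed (use assms in simp)
  finally show ?thesis using assms by (intro exI[of _ "e / (\<bar>carleson_const r (q / p) * X\<bar> + 1)"]) auto
qed

text \<open>The gain from the large space into the small one is what makes the two embeddings
  compact together: smallness of \<open>\<epsilon>\<close> near the circle forces the means of every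
  \<open>f\<close> to vanish there.\<close>

lemma AT_infty_subset_tent_zero: "AT_infty \<omega> p \<subseteq> tent_zero \<mu> q"
proof
  fix f assume "f \<in> AT_infty \<omega> p"
  then have f: "f holomorphic_on disk" and fin: "tent_sup W p f < \<infinity>" using AT_infty_iff[OF p] by auto
  define M where "M = enn2real (tent_sup W p f)"
  have M: "M \<ge> 0" "tent_sup W p f \<le> ennreal M" using fin by (auto simp: M_def)
  have fm: "f \<in> borel_measurable (completion \<mu>)"
    by (rule measurable_completion[OF holomorphic_measurable[OF \<mu> f]])
  \<comment> \<open>Membership in \<open>tent_infty\<close> needs only
    \<open>\<epsilon> = 1\<close>; small values enter for the limit.\<close>
  obtain \<tau> where \<tau>: "0 < \<tau>" "\<tau> \<le> 1" "vanishing_growth g D K \<kappa> \<mu> p q r 1 \<tau>"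
    using vanishing_growth_exists[of 1] by auto
  interpret vanishing_growth g D K \<kappa> \<mu> p q r 1 \<tau> by (rule \<tau>(3))
  obtain B where B: "\<And>z. norm z \<le> 1 - \<tau> / 2 \<Longrightarrow> norm (f z) \<le> B"
    using holomorphic_bounded_cball[OF f, of "1 - \<tau> / 2"] \<tau> by auto
  have "tent_sup \<mu> q f \<le> ennreal (carleson_const r (q / p) * 1 * M powr (q / p))
      + ennreal (B powr q) * emeasure \<mu> {z. norm z \<le> 1 - \<tau> / 2} / ennreal (\<tau> / 2)"
    by (rule tent_sup_le[OF f M \<tau>(1) B])
  also have "\<dots> < \<infinity>"
  proof -
    have "emeasure \<mu> {z. norm z \<le> 1 - \<tau> / 2} < \<infinity>"
      using emeasure_cball_finite[of "1 - \<tau> / 2"] \<tau>(1) by (simp add: cball_def)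
    then show ?thesis using \<tau>(1)
      by (auto simp: ennreal_mult_less_top ennreal_divide_eq_top_iff less_top[symmetric] ennreal_mult_eq_top_iff)
  qed
  finally have "f \<in> tent_infty \<mu> q"
    using fm q_pos by (simp only: tent_infty_def mem_Collect_eq tent_norm_eq epow_less_top_iff)
  moreover have "(carleson_mean \<mu> q f \<longlongrightarrow> 0) to_circle"
    unfolding ennreal_tendsto_0_iff
  proof (intro allI impI)
    fix e :: ennreal assume e: "e > 0"
    obtain e' where e': "e' > 0" "ennreal e' < e"
    proof (cases e)
      case (real x)
      then show thesis using that[of "x / 2"] e by (auto simp: ennreal_less_iff)
    next
      case top
      then show thesis using that[of 1] by simp
    qed
    obtain \<epsilon> where \<epsilon>: "\<epsilon> > 0" "carleson_const r (q / p) * \<epsilon> * M powr (q / p) \<le> e'"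
      using choose_epsilon[OF e'(1)] by blast
    obtain \<tau>' where \<tau>': "0 < \<tau>'" "\<tau>' \<le> 1" "vanishing_growth g D K \<kappa> \<mu> p q r \<epsilon> \<tau>'"
      using vanishing_growth_exists[OF \<epsilon>(1)] by auto
    interpret v: vanishing_growth g D K \<kappa> \<mu> p q r \<epsilon> \<tau>' by (rule \<tau>'(3))
    show "eventually (\<lambda>a. carleson_mean \<mu> q f a < e) to_circle"
      unfolding eventually_to_circle
    proof (intro exI[of _ "1 - \<tau>' / 2"] conjI allI impI)
      fix a :: complex assume a: "1 - \<tau>' / 2 < norm a \<and> norm a < 1"
      then have "a \<in> disk - {0}" "1 - norm a < \<tau>' / 2" using \<tau>' by auto
      then have "carleson_mean \<mu> q f a \<le> ennreal (carleson_const r (q / p) * \<epsilon> * M powr (q / p))"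
        by (rule v.carleson_mean_near_circle[OF f M])
      also have "\<dots> \<le> ennreal e'" by (rule ennreal_leI[OF \<epsilon>(2)])
      finally show "carleson_mean \<mu> q f a < e" using e'(2) by (rule le_less_trans)
    qed (use \<tau>' in auto)
  qed
  ultimately show "f \<in> tent_zero \<mu> q" by (simp add: tent_zero_def)
qed

text \<open>Locally uniform convergence handles the compact core, and the small growth constant
  handles the rest uniformly in \<open>n\<close>.\<close>

lemma convergent_subsequence:
  assumes f: "\<And>n::nat. f n holomorphic_on disk" and M: "M \<ge> 0" "\<And>n. tent_sup W p (f n) \<le> ennreal M"
  shows "\<exists>h\<in>AT_infty \<omega> p. \<exists>\<sigma>. strict_mono (\<sigma>::nat\<Rightarrow>nat) \<and> (\<lambda>n. tent_norm \<mu> q (\<lambda>z. f (\<sigma> n) z - h z)) \<longlonglongrightarrow> 0"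
proof -
  define \<H> where "\<H> = {u. u holomorphic_on disk \<and> tent_sup W p u \<le> ennreal M}"
  \<comment> \<open>By \<open>growth\<close> the common norm bound becomes a pointwise bound on
    compact sets, which is the hypothesis of Montel's theorem.\<close>
  have bound: "\<exists>B. \<forall>u\<in>\<H>. \<forall>z\<in>L. norm (u z) \<le> B" if L: "compact L" "L \<subseteq> disk" for L
  proof -
    obtain \<rho> where \<rho>: "\<rho> < 1" "\<And>z. z \<in> L \<Longrightarrow> norm z \<le> \<rho>"
    proof (cases "L = {}")
      case False
      obtain z where "z \<in> L" "\<forall>y\<in>L. norm y \<le> norm z"
        using continuous_attains_sup[OF L(1) False, of norm] by (auto intro: continuous_intros)
      then show thesis using L(2) by (intro that[of "norm z"]) auto
    qed (use that[of 0] in auto)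
    define B where "B = (832 * pointwise_const * M / H (1 - \<rho>)) powr (1 / p)"
    have "norm (u z) \<le> B" if u: "u \<in> \<H>" and z: "z \<in> L" for u z
    proof -
      have H0: "H (1 - \<rho>) > 0" using \<rho> by (intro H_pos) simp
      have zd: "norm z < 1" using z L(2) by auto
      have "norm (u z) powr p * H (1 - \<rho>) \<le> norm (u z) powr p * H (1 - norm z)"
        using \<rho>(1) \<rho>(2)[OF z] by (intro mult_left_mono H_mono) auto
      also have "\<dots> \<le> 832 * pointwise_const * M"
        using u M by (intro growth[OF _ p M(1) zd]) (auto simp: \<H>_def tent_sup_le_iff)
      finally have "norm (u z) powr p \<le> 832 * pointwise_const * M / H (1 - \<rho>)" using H0 by (simp add: pos_le_divide_eq)
      then have "(norm (u z) powr p) powr (1 / p) \<le> B" unfolding B_def using p by (intro powr_mono2) auto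
      then show ?thesis using p by (simp add: powr_powr)
    qed
    then show ?thesis by blast
  qed
  have range: "range f \<subseteq> \<H>" using f M by (auto simp: \<H>_def)
  obtain h \<sigma> where h: "h holomorphic_on disk" and \<sigma>: "strict_mono (\<sigma>::nat\<Rightarrow>nat)"
      and pw: "\<And>z. z \<in> disk \<Longrightarrow> (\<lambda>n. f (\<sigma> n) z) \<longlonglongrightarrow> h z"
      and ul: "\<And>L. compact L \<Longrightarrow> L \<subseteq> disk \<Longrightarrow> uniform_limit L (f \<circ> \<sigma>) h sequentially"
  proof (rule Montel[of disk \<H> f])
    show "u holomorphic_on disk" if "u \<in> \<H>" for u using that by (simp add: \<H>_def)
  qed (use bound range in auto)
  have Wm: "u \<in> borel_measurable (completion W)" if "u holomorphic_on disk" for u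
    by (rule measurable_completion[OF holomorphic_measurable[OF sets_radial_measure that]])
  have hM: "tent_sup W p h \<le> ennreal M"
    unfolding tent_sup_def
  proof (rule SUP_least)
    fix b :: complex assume b: "b \<in> disk - {0}"
    show "carleson_mean W p h b \<le> ennreal M"
    proof (rule carleson_mean_fatou[OF sets_radial_measure p, where x = "\<lambda>n. f (\<sigma> n)" and b = "\<lambda>_. ennreal M"])
      show "carleson_mean W p (f (\<sigma> n)) b \<le> ennreal M" for n
        using M(2)[of "\<sigma> n"] b by (auto simp: tent_sup_def SUP_le_iff)
    qed (use b pw Wm f h in auto)
  qed
  then have hA: "h \<in> AT_infty \<omega> p" unfolding AT_infty_iff[OF p] using h by (auto intro: le_less_trans)
  \<comment> \<open>A bound for all differences at once, so that \<open>\<epsilon>\<close> and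
    \<open>\<tau>\<close> can be fixed before \<open>n\<close>.\<close>
  define M' where "M' = 2 powr p * (M + M)"
  have M': "M' \<ge> 0" using M by (simp add: M'_def)
  have diff: "tent_sup W p (\<lambda>z. f (\<sigma> n) z - h z) \<le> ennreal M'" for n
  proof -
    have "tent_sup W p (\<lambda>z. f (\<sigma> n) z + - h z) \<le> ennreal (2 powr p) * (tent_sup W p (f (\<sigma> n)) + tent_sup W p (\<lambda>z. - h z))"
      using f h Wm holomorphic_on_minus[OF h] by (intro tent_sup_add[OF sets_radial_measure p]) auto
    also have "\<dots> \<le> ennreal (2 powr p) * (ennreal M + ennreal M)"
      unfolding tent_sup_minus by (intro mult_left_mono add_mono M(2) hM) auto
    also have "\<dots> = ennreal M'"
      by (simp only: M'_def ennreal_mult[OF powr_ge_zero add_nonneg_nonneg[OF M(1) M(1)]] ennreal_plus[OF M(1) M(1)])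
    finally show ?thesis by simp
  qed
  have holo: "(\<lambda>z. f (\<sigma> n) z - h z) holomorphic_on disk" for n
    using f h by (intro holomorphic_intros) auto
  have "(\<lambda>n. tent_sup \<mu> q (\<lambda>z. f (\<sigma> n) z - h z)) \<longlonglongrightarrow> 0"
    unfolding ennreal_tendsto_0_iff
  proof (intro allI impI)
    fix e :: ennreal assume e: "e > 0"
    obtain e' where e': "e' > 0" "ennreal (e' + e') < e"
    proof (cases e)
      case (real x)
      then show thesis using that[of "x / 4"] e by (auto simp: ennreal_less_iff)
    next
      case top
      then show thesis using that[of 1] by simp
    qed
    obtain \<epsilon> where \<epsilon>: "\<epsilon> > 0" "carleson_const r (q / p) * \<epsilon> * M' powr (q / p) \<le> e'"
      using choose_epsilon[OF e'(1)] by blast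
    obtain \<tau> where \<tau>: "0 < \<tau>" "\<tau> \<le> 1" "vanishing_growth g D K \<kappa> \<mu> p q r \<epsilon> \<tau>"
      using vanishing_growth_exists[OF \<epsilon>(1)] by auto
    interpret v: vanishing_growth g D K \<kappa> \<mu> p q r \<epsilon> \<tau> by (rule \<tau>(3))
    define m where "m = enn2real (emeasure \<mu> (cball 0 (1 - \<tau> / 2)))"
    have m: "emeasure \<mu> {z. norm z \<le> 1 - \<tau> / 2} = ennreal m" "m \<ge> 0"
      using emeasure_cball_finite[of "1 - \<tau> / 2"] \<tau>(1) by (auto simp: m_def cball_def)
    \<comment> \<open>The accuracy required on the core: it makes
      \<open>B powr q * m / (\<tau> / 2)\<close> at most \<open>e'\<close>. The summand
      \<open>1\<close> covers \<open>m = 0\<close>.\<close>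
    define B where "B = (e' * (\<tau> / 2) / (m + 1)) powr (1 / q)"
    have B: "B > 0" using e' \<tau> m by (simp add: B_def)
    have Bq: "B powr q * m / (\<tau> / 2) \<le> e'"
    proof -
      have "B powr q = e' * (\<tau> / 2) / (m + 1)" using q_pos e' \<tau> m by (simp add: B_def powr_powr)
      moreover have "x * t / y * m / t = x * (m / y)" if "t \<noteq> 0" for x t y :: real using that by simp
      ultimately have "B powr q * m / (\<tau> / 2) = e' * (m / (m + 1))" using \<tau>(1) by (metis half_gt_zero less_irrefl)
      also have "\<dots> \<le> e' * 1" using e' m by (intro mult_left_mono) auto
      finally show ?thesis by simp
    qed
    have "uniform_limit (cball 0 (1 - \<tau> / 2)) (f \<circ> \<sigma>) h sequentially"
      using \<tau> by (intro ul) auto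
    from uniform_limitD[OF this B] have "eventually (\<lambda>n. \<forall>z\<in>cball 0 (1 - \<tau> / 2). dist (f (\<sigma> n) z) (h z) < B) sequentially"
      by simp
    then show "eventually (\<lambda>n. tent_sup \<mu> q (\<lambda>z. f (\<sigma> n) z - h z) < e) sequentially"
    proof eventually_elim
      case (elim n)
      have "tent_sup \<mu> q (\<lambda>z. f (\<sigma> n) z - h z) \<le> ennreal (carleson_const r (q / p) * \<epsilon> * M' powr (q / p))
          + ennreal (B powr q) * emeasure \<mu> {z. norm z \<le> 1 - \<tau> / 2} / ennreal (\<tau> / 2)"
        using elim by (intro v.tent_sup_le[OF holo M' diff \<tau>(1)]) (auto simp: dist_norm less_imp_le)
      also have "\<dots> = ennreal (carleson_const r (q / p) * \<epsilon> * M' powr (q / p)) + ennreal (B powr q * m / (\<tau> / 2))"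
        unfolding m(1) using \<tau>(1) m(2) by (simp add: ennreal_mult[symmetric] divide_ennreal)
      also have "\<dots> \<le> ennreal e' + ennreal e'" by (intro add_mono ennreal_leI \<epsilon>(2) Bq)
      also have "\<dots> = ennreal (e' + e')" using e' by (intro ennreal_plus[symmetric]) auto
      finally show ?case using e'(2) by (rule le_less_trans)
    qed
  qed
  then have "(\<lambda>n. tent_norm \<mu> q (\<lambda>z. f (\<sigma> n) z - h z)) \<longlonglongrightarrow> 0"
    using q_pos by (simp add: tent_norm_eq epow_tendsto_0)
  then show ?thesis using hA \<sigma> by blast
qed

text \<open>As in \<open>necessity\<close> the spaces are left open between bounds; the limits found
  lie in \<open>AT_infty\<close>, hence in \<open>tent_zero\<close>, hence in \<open>Y\<close> for
  either choice.\<close>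

lemma sufficiency:
  assumes X: "X \<subseteq> AT_infty \<omega> p" and XY: "X \<subseteq> Y" and Y: "tent_zero \<mu> q \<subseteq> Y" "Y \<subseteq> tent_infty \<mu> q"
  shows "compact_embedding X (tent_norm (weight_measure \<omega>) p) Y (tent_norm \<mu> q)"
  unfolding compact_embedding_def
proof (intro conjI allI impI XY)
  fix S assume S: "S \<subseteq> X" and bdd: "\<exists>M<\<infinity>. \<forall>f\<in>S. tent_norm (weight_measure \<omega>) p f \<le> M"
  have Ym: "Y \<subseteq> borel_measurable (completion \<mu>)" using Y by (auto simp: tent_infty_def)
  interpret quasi_gauge Y "tent_norm \<mu> q" "2 powr ((q + 1) / q)"
    by (rule quasi_gauge_tent_norm[OF \<mu> q_pos Ym])
  obtain M0 where M0: "M0 < \<infinity>" "\<And>f. f \<in> S \<Longrightarrow> tent_norm (weight_measure \<omega>) p f \<le> M0" using bdd by blast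
  define M where "M = enn2real (epow M0 p)"
  have "epow M0 p < \<infinity>" using M0(1) epow_less_top_iff by blast
  then have M: "ennreal M = epow M0 p" "M \<ge> 0" by (auto simp: M_def)
  have S': "f holomorphic_on disk \<and> tent_sup W p f \<le> ennreal M" if "f \<in> S" for f
  proof -
    have h: "f holomorphic_on disk" using that S X by (auto simp: AT_infty_def)
    then show ?thesis using M0(2)[OF that] p by (simp add: tent_norm_weight epow_le_iff M(1))
  qed
  show "compactin (qnorm_topology Y (tent_norm \<mu> q)) (qnorm_topology Y (tent_norm \<mu> q) closure_of S)"
  proof (rule relatively_compact)
    show "S \<subseteq> Y" using S XY by blast
    fix x assume x: "\<And>n::nat. x n \<in> S"
    obtain h \<sigma> where "h \<in> AT_infty \<omega> p" "strict_mono (\<sigma>::nat\<Rightarrow>nat)" "(\<lambda>n. tent_norm \<mu> q (\<lambda>z. x (\<sigma> n) z - h z)) \<longlonglongrightarrow> 0"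
      using convergent_subsequence[of x M] S'[OF x] M(2) by blast
    then show "\<exists>h\<in>Y. \<exists>\<sigma>. strict_mono \<sigma> \<and> (\<lambda>n. tent_norm \<mu> q (\<lambda>z. x (\<sigma> n) z - h z)) \<longlonglongrightarrow> 0"
      using AT_infty_subset_tent_zero Y(1) by blast
  qed
qed

end

end

theorem theorem4p7:
  fixes p q :: real and \<omega> :: "complex \<Rightarrow> real" and \<mu> :: "complex measure"
  assumes "0 < p" and "p \<le> q"
    and "\<omega> \<in> D_class" and "\<forall>z\<in>disk. weight_hat \<omega> z > 0"
    and "sets \<mu> = sets (restrict_space borel disk)" and "emeasure \<mu> {0} < \<infinity>"
  defines "a \<equiv> compact_embedding (AT_infty \<omega> p) (tent_norm (weight_measure \<omega>) p)
                 (tent_infty \<mu> q) (tent_norm \<mu> q)"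
    and "b \<equiv> compact_embedding (AT_zero \<omega> p) (tent_norm (weight_measure \<omega>) p)
                 (tent_zero \<mu> q) (tent_norm \<mu> q)"
    and "c \<equiv> (\<lambda>r. vanishes_at_circle (G_fun \<omega> \<mu> p q r))"
  shows "(a \<longleftrightarrow> b) \<and> (b \<longleftrightarrow> (\<exists>r\<in>{0<..<1/4}. c r)) \<and> ((\<exists>r\<in>{0<..<1/4}. c r) \<longleftrightarrow> (\<forall>r\<in>{0<..<1/4}. c r))"
proof -
  have q: "q > 0" using assms(1,2) by simp
  obtain g D K \<kappa> where ws: "weight_setting g D K \<kappa> \<omega>"
    using D_class_weight_setting[OF assms(3,4)] by blast
  interpret weight_setting g D K \<kappa> \<omega> by (rule ws)
  have zero_infty: "tent_zero \<mu> q \<subseteq> tent_infty \<mu> q" by (auto simp: tent_zero_def)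
  have ac: "c r" if a "r \<in> {0<..<1/4}" for r
    using that unfolding a_def c_def
    by (intro necessity[OF assms(5,6,1,2) _ _ _ AT_zero_subset order_refl]) auto
  have bc: "c r" if b "r \<in> {0<..<1/4}" for r
    using that unfolding b_def c_def
    by (intro necessity[OF assms(5,6,1,2) _ _ _ order_refl zero_infty]) auto
  \<comment> \<open>One radius yields both embeddings, and either embedding gives the condition for
    every radius; this links "some" with "any".\<close>
  have ca: "a \<and> b" if r: "r \<in> {0<..<1/4}" and "c r" for r
  proof -
    have v: "\<And>z. z \<in> disk \<Longrightarrow> ratio \<mu> (q / p) r z < \<infinity>" "(ratio \<mu> (q / p) r \<longlongrightarrow> 0) to_circle"
      using \<open>c r\<close> vanishes_iff[OF assms(1) q, of \<mu> r] unfolding c_def by auto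
    have r': "0 < r" "r < 1" using r by auto
    note sub = AT_infty_subset_tent_zero[OF assms(5,1,2) r' v]
    show ?thesis
      unfolding a_def b_def
      using AT_zero_subset sub zero_infty
      by (intro conjI sufficiency[OF assms(5,1,2) r' v]) blast+
  qed
  \<comment> \<open>Nonemptiness of the interval, to pass from every radius to some radius.\<close>
  have ex: "(1 / 8 :: real) \<in> {0<..<1/4}" by simp
  show ?thesis using ac bc ca ex by blast
qed

end
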